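(* Suppose that the equation $F(x,y,z)=c$ is a constant-rank elimination problem (CREP) with a Riemannian input space $\mathcal X$ and a Riemannian output space $\mathcal Y$, and let $(x_0,y_0,z_0)$ be a particular solution. Consider the system for a linear map $DH(x_0)\colon T_{x_0}\mathcal X\to T_{y_0}\mathcal Y$ (which has a unique solution, namely the differential at $x_0$ of the canonical solution map $H$) $$\begin{cases}(\dot x, DH(x_0)[\dot x])\in D\pi_{\mathcal X\times\mathcal Y}\left[\ker DF\right]\quad\text{for all }\dot x\in T_{x_0}\mathcal X,\\ \operatorname{Im} DH(x_0)\perp D\pi_{\mathcal Y}\left[\ker\frac{\partial F}{\partial(y,z)}\right],\end{cases}$$ with all derivatives evaluated at $(x_0,y_0,z_0)$ or its projections. Then the solution of this system is $$DH(x_0)\colon\dot x\mapsto\operatorname*{arg\,min}_{\dot y}\|\dot y\|\quad\text{s.t.}\quad DF(x_0,y_0,z_0)[\dot x,\dot y,\dot z]=0\ \text{ for some }\dot z\in T_{z_0}\mathcal Z.$$ Consequently, $\kappa_{x\mapsto y}[F](x_0,y_0,z_0)$ is the operator norm of this map $DH(x_0)$.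
   Context: Constant-rank elimination problem (CREP): Let $F\colon\mathcal X\times\mathcal Y\times\mathcal Z\to\mathcal W$ be a smooth map, where $\mathcal X,\mathcal Y,\mathcal Z,\mathcal W$ are smooth manifolds, and let $c$ be a constant in the image of $F$. Let $DF$ be the total derivative of $F$. Suppose there are $r,k\in\mathbb N$ such that everywhere on $\mathcal X\times\mathcal Y\times\mathcal Z$ (i) $\operatorname{rank} DF(x,y,z)=\operatorname{rank}\frac{\partial}{\partial (y,z)}F(x,y,z)=r$, and (ii) $\operatorname{rank}\frac{\partial}{\partial z}F(x,y,z)=k$. Then the equation $F(x,y,z)=c$ is called a CREP. $\mathcal X,\mathcal Y,\mathcal Z$ are the input, output and latent space, respectively. Canonical solution map: Let $(x_0,y_0,z_0)$ be a solution of a CREP, where $\mathcal Y$ is Riemannian with distance $d_{\mathcal Y}$. For all sufficiently small neighbourhoods $\widehat{\mathcal Z}\subseteq\mathcal Z$ of $z_0$, the map $$H(x):=\operatorname*{arg\,min}_{y\,:\,\exists z\in\widehat{\mathcal Z},\ F(x,y,z)=c}d_{\mathcal Y}(y_0,y)$$ is well-defined and smooth for $x$ in a neighbourhood of $x_0$. Condition number: If $\mathcal X$ and $\mathcal Y$ are Riemannian with distances $d_{\mathcal X},d_{\mathcal Y}$, then $$\kappa_{x\mapsto y}[F](x_0,y_0,z_0):=\limsup_{x\to x_0}\frac{d_{\mathcal Y}(y_0,H(x))}{d_{\mathcal X}(x_0,x)}.$$ This does not depend on the choice of the (sufficiently small) $\widehat{\mathcal Z}$. Notation: $\pi_{\mathcal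 X\times\mathcal Y}$ and $\pi_{\mathcal Y}$ are coordinate projections. So $D\pi_{\mathcal X\times\mathcal Y}[\ker DF]=\{(\dot x,\dot y) : \exists \dot z\in T_{z_0}\mathcal Z,\ DF(x_0,y_0,z_0)[\dot x,\dot y,\dot z]=0\}$ and $D\pi_{\mathcal Y}[\ker\frac{\partial F}{\partial (y,z)}]=\{\dot y : \exists\dot z\in T_{z_0}\mathcal Z,\ DF(x_0,y_0,z_0)[0,\dot y,\dot z]=0\}$. Norms and orthogonality are with respect to the Riemannian metrics at $x_0$ and $y_0$. *)

theory Defs
  imports "HOL-Analysis.Analysis" "HOL-Library.Function_Algebras"
begin

section \<open>Model spaces\<close>

text \<open>Euclidean model spaces. The class \<^class>\<open>euclidean_space\<close> excludes dimension 0, but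
  manifolds of dimension 0 (for instance a trivial latent space) have to be allowed.\<close>

class finite_dim_inner = real_inner +
  assumes finite_dim: "\<exists>B. finite B \<and> (\<forall>x. \<exists>c. x = (\<Sum>b\<in>B. c b *\<^sub>R b))"

instance euclidean_space \<subseteq> finite_dim_inner
  by standard (metis finite_Basis euclidean_representation)

text \<open>Pointwise vector space structure on functions; tangent vectors below are functions from
  charts to coordinates.\<close>

instantiation "fun" :: (type, real_vector) real_vector
begin

definition scaleR_fun_def: "a *\<^sub>R f = (\<lambda>x. a *\<^sub>R f x)"

instance
  by standard (simp_all add: scaleR_fun_def fun_eq_iff algebra_simps)

end

primrec Ck_on ::
  "nat \<Rightarrow> 'a::real_normed_vector set \<Rightarrow> ('a \<Rightarrow> 'b::real_normed_vector) \<Rightarrow> bool" where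
  "Ck_on 0 S f \<longleftrightarrow> continuous_on S f"
| "Ck_on (Suc k) S f \<longleftrightarrow>
     (\<forall>x\<in>S. f differentiable (at x)) \<and> (\<forall>v. Ck_on k S (\<lambda>x. frechet_derivative f (at x) v))"

text \<open>Used for open \<open>S\<close> in finite-dimensional spaces only, where continuity of all directional
  derivatives amounts to continuity of the derivative.\<close>

definition smooth_on ::
  "'a::real_normed_vector set \<Rightarrow> ('a \<Rightarrow> 'b::real_normed_vector) \<Rightarrow> bool" where
  "smooth_on S f \<longleftrightarrow> (\<forall>k. Ck_on k S f)"


section \<open>Smooth manifolds\<close>

text \<open>A chart is a domain together with a coordinate map, of which only the values on the domain
  matter. A manifold is a whole type with an atlas (not required to be maximal).\<close>

type_synonym ('m, 'e) chart = "'m set \<times> ('m \<Rightarrow> 'e)"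

definition chart_inv :: "('m, 'e) chart \<Rightarrow> 'e \<Rightarrow> 'm" where
  "chart_inv \<kappa> = inv_into (fst \<kappa>) (snd \<kappa>)"

definition is_chart :: "('m::topological_space, 'e::real_normed_vector) chart \<Rightarrow> bool" where
  "is_chart \<kappa> \<longleftrightarrow> open (fst \<kappa>) \<and> open (snd \<kappa> ` fst \<kappa>) \<and>
     homeomorphism (fst \<kappa>) (snd \<kappa> ` fst \<kappa>) (snd \<kappa>) (chart_inv \<kappa>)"

definition smooth_manifold ::
  "('m::{t2_space, second_countable_topology}, 'e::finite_dim_inner) chart set \<Rightarrow> bool" where
  "smooth_manifold A \<longleftrightarrow>
     (\<forall>\<kappa>\<in>A. is_chart \<kappa>) \<and> (\<Union>\<kappa>\<in>A. fst \<kappa>) = UNIV \<and>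
     (\<forall>\<kappa>\<in>A. \<forall>\<mu>\<in>A. smooth_on (snd \<kappa> ` (fst \<kappa> \<inter> fst \<mu>)) (snd \<mu> \<circ> chart_inv \<kappa>))"

definition charts_at :: "('m, 'e) chart set \<Rightarrow> 'm \<Rightarrow> ('m, 'e) chart set" where
  "charts_at A p = {\<kappa> \<in> A. p \<in> fst \<kappa>}"

definition prod_chart ::
  "('m, 'e) chart \<Rightarrow> ('n, 'f) chart \<Rightarrow> ('m \<times> 'n, 'e \<times> 'f) chart" where
  "prod_chart \<kappa> \<mu> = (fst \<kappa> \<times> fst \<mu>, map_prod (snd \<kappa>) (snd \<mu>))"

definition prod_atlas ::
  "('m, 'e) chart set \<Rightarrow> ('n, 'f) chart set \<Rightarrow> ('m \<times> 'n, 'e \<times> 'f) chart set" where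
  "prod_atlas A B = {prod_chart \<kappa> \<mu> | \<kappa> \<mu>. \<kappa> \<in> A \<and> \<mu> \<in> B}"

definition smooth_map ::
  "('m::topological_space, 'e::real_normed_vector) chart set \<Rightarrow>
   ('n::topological_space, 'f::real_normed_vector) chart set \<Rightarrow> ('m \<Rightarrow> 'n) \<Rightarrow> bool" where
  "smooth_map A B f \<longleftrightarrow> continuous_on UNIV f \<and>
     (\<forall>\<kappa>\<in>A. \<forall>\<mu>\<in>B. smooth_on (snd \<kappa> ` (fst \<kappa> \<inter> f -` fst \<mu>)) (snd \<mu> \<circ> f \<circ> chart_inv \<kappa>))"


section \<open>Tangent vectors and differentials\<close>

text \<open>A tangent vector at \<open>p\<close> is the family of its coordinate vectors in all charts around \<open>p\<close>,
  related by the derivatives of the transition maps, and extended by 0 to all other charts.\<close>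

type_synonym ('m, 'e) tangent = "('m, 'e) chart \<Rightarrow> 'e"

definition tangent_space ::
  "('m, 'e::real_normed_vector) chart set \<Rightarrow> 'm \<Rightarrow> ('m, 'e) tangent set" where
  "tangent_space A p = {v.
     (\<forall>\<kappa>\<in>charts_at A p. \<forall>\<mu>\<in>charts_at A p.
        v \<mu> = frechet_derivative (snd \<mu> \<circ> chart_inv \<kappa>) (at (snd \<kappa> p)) (v \<kappa>)) \<and>
     (\<forall>\<kappa>. \<kappa> \<notin> charts_at A p \<longrightarrow> v \<kappa> = 0)}"

text \<open>The tangent vector at \<open>p\<close> with coordinates \<open>a\<close> in the chart \<open>\<kappa>\<close>.\<close>

definition coord_vector ::
  "('m, 'e::real_normed_vector) chart set \<Rightarrow> 'm \<Rightarrow> ('m, 'e) chart \<Rightarrow> 'e \<Rightarrow> ('m, 'e) tangent" where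
  "coord_vector A p \<kappa> a = (\<lambda>\<mu>. if \<mu> \<in> charts_at A p
     then frechet_derivative (snd \<mu> \<circ> chart_inv \<kappa>) (at (snd \<kappa> p)) a else 0)"

definition differential ::
  "('m, 'e::real_normed_vector) chart set \<Rightarrow> ('n, 'f::real_normed_vector) chart set \<Rightarrow>
   ('m \<Rightarrow> 'n) \<Rightarrow> 'm \<Rightarrow> ('m, 'e) tangent \<Rightarrow> ('n, 'f) tangent" where
  "differential A B f p v = (let \<kappa> = (SOME \<kappa>. \<kappa> \<in> charts_at A p) in
     (\<lambda>\<mu>. if \<mu> \<in> charts_at B (f p)
        then frechet_derivative (snd \<mu> \<circ> f \<circ> chart_inv \<kappa>) (at (snd \<kappa> p)) (v \<kappa>) else 0))"

definition differentiable_map_at ::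
  "('m::t2_space, 'e::real_normed_vector) chart set \<Rightarrow>
   ('n::topological_space, 'f::real_normed_vector) chart set \<Rightarrow> ('m \<Rightarrow> 'n) \<Rightarrow> 'm \<Rightarrow> bool" where
  "differentiable_map_at A B f p \<longleftrightarrow> isCont f p \<and>
     (\<forall>\<kappa>\<in>charts_at A p. \<forall>\<mu>\<in>charts_at B (f p).
        (snd \<mu> \<circ> f \<circ> chart_inv \<kappa>) differentiable (at (snd \<kappa> p)))"

definition ker_differential ::
  "('m, 'e::real_normed_vector) chart set \<Rightarrow> ('n, 'f::real_normed_vector) chart set \<Rightarrow>
   ('m \<Rightarrow> 'n) \<Rightarrow> 'm \<Rightarrow> ('m, 'e) tangent set" where
  "ker_differential A B f p = {v \<in> tangent_space A p. differential A B f p v = 0}"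

definition rank_at ::
  "('m, 'e::real_normed_vector) chart set \<Rightarrow> ('n, 'f::real_normed_vector) chart set \<Rightarrow>
   ('m \<Rightarrow> 'n) \<Rightarrow> 'm \<Rightarrow> nat" where
  "rank_at A B f p = dim (differential A B f p ` tangent_space A p)"

text \<open>Linear maps between subsets (subspaces) \<open>V\<close> and \<open>W\<close>; they are taken to be extensional, so
  that they are determined by their values on \<open>V\<close>.\<close>

definition linear_maps :: "'a::real_vector set \<Rightarrow> 'b::real_vector set \<Rightarrow> ('a \<Rightarrow> 'b) set" where
  "linear_maps V W = {L \<in> V \<rightarrow>\<^sub>E W.
     (\<forall>u\<in>V. \<forall>v\<in>V. L (u + v) = L u + L v) \<and> (\<forall>r. \<forall>u\<in>V. L (r *\<^sub>R u) = r *\<^sub>R L u)}"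


section \<open>Riemannian metrics and distances\<close>

definition inner_product_on :: "'a::real_vector set \<Rightarrow> ('a \<Rightarrow> 'a \<Rightarrow> real) \<Rightarrow> bool" where
  "inner_product_on V b \<longleftrightarrow>
     (\<forall>u\<in>V. \<forall>v\<in>V. \<forall>w\<in>V. b (u + v) w = b u w + b v w) \<and>
     (\<forall>r. \<forall>u\<in>V. \<forall>v\<in>V. b (r *\<^sub>R u) v = r * b u v) \<and>
     (\<forall>u\<in>V. \<forall>v\<in>V. b u v = b v u) \<and>
     (\<forall>u\<in>V. u \<noteq> 0 \<longrightarrow> b u u > 0)"

type_synonym ('m, 'e) metric_tensor = "'m \<Rightarrow> ('m, 'e) tangent \<Rightarrow> ('m, 'e) tangent \<Rightarrow> real"

text \<open>Smoothness of the metric is smoothness of its coefficients in every chart.\<close>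

definition riemannian_metric ::
  "('m, 'e::real_normed_vector) chart set \<Rightarrow> ('m, 'e) metric_tensor \<Rightarrow> bool" where
  "riemannian_metric A g \<longleftrightarrow>
     (\<forall>p. inner_product_on (tangent_space A p) (g p)) \<and>
     (\<forall>\<kappa>\<in>A. \<forall>a b. smooth_on (snd \<kappa> ` fst \<kappa>)
        (\<lambda>s. g (chart_inv \<kappa> s) (coord_vector A (chart_inv \<kappa> s) \<kappa> a)
                               (coord_vector A (chart_inv \<kappa> s) \<kappa> b)))"

definition riem_norm ::
  "('m, 'e) metric_tensor \<Rightarrow> 'm \<Rightarrow> ('m, 'e) tangent \<Rightarrow> real" where
  "riem_norm g p v = sqrt (g p v v)"

definition velocity ::
  "('m, 'e::real_normed_vector) chart set \<Rightarrow> (real \<Rightarrow> 'm) \<Rightarrow> real \<Rightarrow> ('m, 'e) tangent" where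
  "velocity A \<gamma> t = (\<lambda>\<kappa>. if \<kappa> \<in> charts_at A (\<gamma> t)
     then vector_derivative (snd \<kappa> \<circ> \<gamma>) (at t) else 0)"

definition piecewise_C1_curve ::
  "('m::topological_space, 'e::real_normed_vector) chart set \<Rightarrow> (real \<Rightarrow> 'm) \<Rightarrow> bool" where
  "piecewise_C1_curve A \<gamma> \<longleftrightarrow> continuous_on {0..1} \<gamma> \<and>
     (\<exists>S. finite S \<and>
        (\<forall>\<kappa>\<in>A. (snd \<kappa> \<circ> \<gamma>) C1_differentiable_on (({0..1} - S) \<inter> \<gamma> -` fst \<kappa>)))"

definition curve_length ::
  "('m, 'e::real_normed_vector) chart set \<Rightarrow> ('m, 'e) metric_tensor \<Rightarrow> (real \<Rightarrow> 'm) \<Rightarrow> ennreal" where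
  "curve_length A g \<gamma> = (\<integral>\<^sup>+ t\<in>{0..1}. ennreal (riem_norm g (\<gamma> t) (velocity A \<gamma> t)) \<partial>lborel)"

text \<open>Points that cannot be joined by a curve have distance \<open>\<infinity>\<close>.\<close>

definition riem_dist ::
  "('m::topological_space, 'e::real_normed_vector) chart set \<Rightarrow> ('m, 'e) metric_tensor \<Rightarrow>
   'm \<Rightarrow> 'm \<Rightarrow> ennreal" where
  "riem_dist A g p q =
     (INF \<gamma>\<in>{\<gamma>. piecewise_C1_curve A \<gamma> \<and> \<gamma> 0 = p \<and> \<gamma> 1 = q}. curve_length A g \<gamma>)"

definition riem_onorm ::
  "('m, 'e::real_normed_vector) chart set \<Rightarrow> ('m, 'e) metric_tensor \<Rightarrow> 'm \<Rightarrow>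
   ('n, 'f) metric_tensor \<Rightarrow> 'n \<Rightarrow>
   (('m, 'e) tangent \<Rightarrow> ('n, 'f) tangent) \<Rightarrow> ennreal" where
  "riem_onorm A g p h q L =
     (SUP v\<in>tangent_space A p. ennreal (riem_norm h q (L v) / riem_norm g p v))"


section \<open>Constant-rank elimination problems\<close>

definition CREP ::
  "('x::{t2_space, second_countable_topology}, 'a::finite_dim_inner) chart set \<Rightarrow>
   ('y::{t2_space, second_countable_topology}, 'b::finite_dim_inner) chart set \<Rightarrow>
   ('z::{t2_space, second_countable_topology}, 'c::finite_dim_inner) chart set \<Rightarrow>
   ('w::{t2_space, second_countable_topology}, 'd::finite_dim_inner) chart set \<Rightarrow>
   ('x \<times> 'y \<times> 'z \<Rightarrow> 'w) \<Rightarrow> 'w \<Rightarrow> nat \<Rightarrow> nat \<Rightarrow> bool" where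
  "CREP X Y Z W F c r k \<longleftrightarrow>
     smooth_manifold X \<and> smooth_manifold Y \<and> smooth_manifold Z \<and> smooth_manifold W \<and>
     smooth_map (prod_atlas X (prod_atlas Y Z)) W F \<and> c \<in> range F \<and>
     (\<forall>x y z.
        rank_at (prod_atlas X (prod_atlas Y Z)) W F (x, y, z) = r \<and>
        rank_at (prod_atlas Y Z) W (\<lambda>(y', z'). F (x, y', z')) (y, z) = r \<and>
        rank_at Z W (\<lambda>z'. F (x, y, z')) z = k)"

text \<open>A minimiser of the distance to \<open>y0\<close>, for latent variables in \<open>Zh\<close>.\<close>

definition canonical_solution ::
  "('y::topological_space, 'b::real_normed_vector) chart set \<Rightarrow> ('y, 'b) metric_tensor \<Rightarrow>
   ('x \<times> 'y \<times> 'z \<Rightarrow> 'w) \<Rightarrow> 'w \<Rightarrow> 'y \<Rightarrow> 'z set \<Rightarrow> 'x \<Rightarrow> 'y" where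
  "canonical_solution Y gY F c y0 Zh x =
     arg_min (riem_dist Y gY y0) (\<lambda>y. \<exists>z\<in>Zh. F (x, y, z) = c)"

definition condition_number ::
  "('x::topological_space, 'a::real_normed_vector) chart set \<Rightarrow> ('x, 'a) metric_tensor \<Rightarrow>
   ('y::topological_space, 'b::real_normed_vector) chart set \<Rightarrow> ('y, 'b) metric_tensor \<Rightarrow>
   ('x \<times> 'y \<times> 'z \<Rightarrow> 'w) \<Rightarrow> 'w \<Rightarrow> 'x \<Rightarrow> 'y \<Rightarrow> 'z set \<Rightarrow> ennreal" where
  "condition_number X gX Y gY F c x0 y0 Zh =
     Limsup (at x0) (\<lambda>x. riem_dist Y gY y0 (canonical_solution Y gY F c y0 Zh x)
                        / riem_dist X gX x0 x)"

text \<open>A tangent vector \<open>u\<close> of the product manifold stands for the triple of its components, the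
  images of \<open>u\<close> under the differentials of the coordinate projections. So the following two sets
  are \<open>{(\<xi>, \<eta>). \<exists>\<zeta>. DF[\<xi>, \<eta>, \<zeta>] = 0}\<close> and \<open>{\<eta>. \<exists>\<zeta>. \<partial>F/\<partial>(y,z)[\<eta>, \<zeta>] = 0}\<close>.\<close>

definition proj_ker_xy ::
  "('x, 'a::real_normed_vector) chart set \<Rightarrow> ('y, 'b::real_normed_vector) chart set \<Rightarrow>
   ('z, 'c::real_normed_vector) chart set \<Rightarrow> ('w, 'd::real_normed_vector) chart set \<Rightarrow>
   ('x \<times> 'y \<times> 'z \<Rightarrow> 'w) \<Rightarrow> 'x \<times> 'y \<times> 'z \<Rightarrow> (('x, 'a) tangent \<times> ('y, 'b) tangent) set" where
  "proj_ker_xy X Y Z W F p =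
     (\<lambda>u. (differential (prod_atlas X (prod_atlas Y Z)) X (\<lambda>(x, y, z). x) p u,
           differential (prod_atlas X (prod_atlas Y Z)) Y (\<lambda>(x, y, z). y) p u))
       ` ker_differential (prod_atlas X (prod_atlas Y Z)) W F p"

definition proj_ker_y ::
  "('y, 'b::real_normed_vector) chart set \<Rightarrow>
   ('z, 'c::real_normed_vector) chart set \<Rightarrow> ('w, 'd::real_normed_vector) chart set \<Rightarrow>
   ('x \<times> 'y \<times> 'z \<Rightarrow> 'w) \<Rightarrow> 'x \<times> 'y \<times> 'z \<Rightarrow> ('y, 'b) tangent set" where
  "proj_ker_y Y Z W F p =
     differential (prod_atlas Y Z) Y (\<lambda>(y, z). y) (snd p)
       ` ker_differential (prod_atlas Y Z) W (\<lambda>(y, z). F (fst p, y, z)) (snd p)"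

definition solves_system ::
  "('x, 'a::real_normed_vector) chart set \<Rightarrow> ('y, 'b::real_normed_vector) chart set \<Rightarrow>
   ('z, 'c::real_normed_vector) chart set \<Rightarrow> ('w, 'd::real_normed_vector) chart set \<Rightarrow>
   ('y, 'b) metric_tensor \<Rightarrow> ('x \<times> 'y \<times> 'z \<Rightarrow> 'w) \<Rightarrow> 'x \<Rightarrow> 'y \<Rightarrow> 'z \<Rightarrow>
   (('x, 'a) tangent \<Rightarrow> ('y, 'b) tangent) \<Rightarrow> bool" where
  "solves_system X Y Z W gY F x0 y0 z0 L \<longleftrightarrow>
     L \<in> linear_maps (tangent_space X x0) (tangent_space Y y0) \<and>
     (\<forall>\<xi>\<in>tangent_space X x0. (\<xi>, L \<xi>) \<in> proj_ker_xy X Y Z W F (x0, y0, z0)) \<and>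
     (\<forall>\<xi>\<in>tangent_space X x0. \<forall>\<eta>\<in>proj_ker_y Y Z W F (x0, y0, z0). gY y0 (L \<xi>) \<eta> = 0)"

end

theory Submission
  imports Defs
begin

text \<open>In charts, the constant rank of \<open>DF\<close> and \<open>\<partial>F/\<partial>z\<close> allows one to eliminate \<open>z\<close>: with
  \<open>K = D\<pi>\<^sub>Y[ker \<partial>F/\<partial>(y,z)]\<close> and the projection \<open>P\<close> onto \<open>K\<close> that is orthogonal for the metric at
  \<open>y0\<close>, the solutions near \<open>(x0, y0)\<close> form a graph \<open>y = \<Phi> (x, P y)\<close>, however small the neighbourhood
  of \<open>z0\<close> is. Here \<open>\<Phi>' (0, k) = k\<close> for \<open>k \<in> K\<close>, and \<open>L = \<Phi>' (_, 0)\<close> takes values orthogonal to \<open>K\<close>.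
  So \<open>L\<close> solves the linear system, and \<open>L \<xi>\<close> is the shortest feasible vector by Pythagoras. The
  Riemannian distance agrees with the norm at the base point up to factors \<open>1 \<plusminus> \<epsilon>\<close>. Therefore a
  minimiser over the solutions for \<open>x\<close> is almost as close to \<open>y0\<close> as \<open>\<Phi> (x, P y0)\<close>, which forces its
  component in \<open>K\<close> to be of lower order. This gives its differential \<open>L\<close>, and the condition
  number as a limit of quotients of norms.\<close>


section \<open>Finite-dimensional inner product spaces\<close>

text \<open>The obstacle is that nothing is known about the minimiser beforehand, neither uniqueness
  nor continuity, and that the distance is a mere infimum of lengths. So the distance is never
  differentiated. A minimiser is compared with one explicit competitor, and orthogonality turns a
  relative error \<epsilon> in length into an error of order sqrt \<epsilon> in direction, which
  suffices for differentiability at \<open>x0\<close> whichever minimiser is chosen. Existence comes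
  from compactness of a piece of the graph; solutions elsewhere, inside or outside the chart, are
  excluded by a lower bound for the distance.

  The rank hypotheses act at three places. Constant rank of \<open>DF\<close> makes the level set a
  graph over the kernel directions at the base point. Equality with the rank in the
  \<open>(y, z)\<close> directions lets the input remain a free coordinate of that graph. Constant
  rank of the \<open>z\<close>-derivative keeps the leftover latent coordinates from moving the
  output.\<close>

lemma finite_orthonormal_basis:
  "\<exists>B::'a::finite_dim_inner set. finite B \<and> (\<forall>b\<in>B. \<forall>c\<in>B. b \<bullet> c = (if b = c then 1 else 0)) \<and>
     (\<forall>x. (\<Sum>b\<in>B. (x \<bullet> b) *\<^sub>R b) = x)"
proof -
  obtain B0 :: "'a set" where B0: "finite B0" "\<And>x. \<exists>c. x = (\<Sum>b\<in>B0. c b *\<^sub>R b)"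
    using finite_dim by blast
  have "span B0 = UNIV"
    using B0(2) by (metis (mono_tags, lifting) UNIV_eq_I span_base span_scale span_sum)
  with basis_orthogonal[OF B0(1)] obtain C :: "'a set"
    where C: "finite C" "span C = UNIV" "pairwise orthogonal C" by auto
  \<comment> \<open>The orthogonal spanning set may contain 0, which has to go before
    normalising.\<close>
  define B where "B = (\<lambda>c. c /\<^sub>R norm c) ` (C - {0})"
  have fin: "finite B" using C(1) by (simp add: B_def)
  have ortho: "b \<bullet> c = (if b = c then 1 else 0)" if bc: "b \<in> B" "c \<in> B" for b c
  proof -
    obtain u v where uv: "u \<in> C" "u \<noteq> 0" "b = u /\<^sub>R norm u" "v \<in> C" "v \<noteq> 0" "c = v /\<^sub>R norm v"
      using bc unfolding B_def by blast
    show ?thesis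
    proof (cases "u = v")
      case True
      then show ?thesis using uv by (simp add: power2_norm_eq_inner[symmetric] power2_eq_square field_simps)
    next
      case False
      then have 1: "u \<bullet> v = 0" using C(3) uv by (auto simp: pairwise_def orthogonal_def)
      then have "b \<bullet> c = 0" using uv by simp
      moreover have "b \<bullet> b \<noteq> 0" using uv by simp
      ultimately show ?thesis by auto
    qed
  qed
  have "span C \<subseteq> span B"
  proof (rule span_minimal)
    show "C \<subseteq> span B"
    proof
      fix x assume "x \<in> C"
      show "x \<in> span B"
      proof (cases "x = 0")
        case False
        then have "x /\<^sub>R norm x \<in> B" using \<open>x \<in> C\<close> by (auto simp: B_def)
        then have "norm x *\<^sub>R (x /\<^sub>R norm x) \<in> span B" by (intro span_scale span_base)
        then show ?thesis using False by simp
      qed (simp add: span_zero)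
    qed
  qed simp
  then have spn: "span B = UNIV" using C by auto
  have "(\<Sum>b\<in>B. (x \<bullet> b) *\<^sub>R b) = x" for x
  proof -
    obtain u where u: "x = (\<Sum>b\<in>B. u b *\<^sub>R b)"
      using span_finite[OF fin] spn by auto
    have "x \<bullet> c = u c" if "c \<in> B" for c
    proof -
      have "x \<bullet> c = (\<Sum>b\<in>B. u b * (b \<bullet> c))" unfolding u by (simp add: inner_sum_left)
      also have "\<dots> = (\<Sum>b\<in>B. if b = c then u b else 0)"
        using that by (intro sum.cong) (auto simp: ortho)
      also have "\<dots> = u c" using that fin by simp
      finally show ?thesis .
    qed
    then show ?thesis using u by simp
  qed
  then show ?thesis using fin ortho by blast
qed

text \<open>Takes the place of \<open>Basis\<close> in a class that includes the zero space, where
  it is empty.\<close>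

definition onb :: "'a::finite_dim_inner set" where
  "onb = (SOME B. finite B \<and> (\<forall>b\<in>B. \<forall>c\<in>B. b \<bullet> c = (if b = c then 1 else 0)) \<and>
     (\<forall>x. (\<Sum>b\<in>B. (x \<bullet> b) *\<^sub>R b) = x))"

lemma finite_onb [simp]: "finite (onb :: 'a::finite_dim_inner set)"
  using someI_ex[OF finite_orthonormal_basis] unfolding onb_def by (rule conjunct1)

lemma inner_onb: "b \<in> onb \<Longrightarrow> c \<in> onb \<Longrightarrow> b \<bullet> c = (if b = c then 1 else 0)"
  using someI_ex[OF finite_orthonormal_basis, THEN conjunct2, THEN conjunct1]
  unfolding onb_def by blast

lemma onb_representation: "(\<Sum>b\<in>onb. (x \<bullet> b) *\<^sub>R b) = x"
  using someI_ex[OF finite_orthonormal_basis, THEN conjunct2, THEN conjunct2]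
  unfolding onb_def by blast

lemma norm_onb: "b \<in> onb \<Longrightarrow> norm b = 1"
  using inner_onb[of b b] by (simp add: norm_eq_sqrt_inner)

lemma span_onb: "span (onb :: 'a::finite_dim_inner set) = UNIV"
  using onb_representation by (metis (mono_tags, lifting) UNIV_eq_I span_base span_scale span_sum)

lemma independent_onb: "independent (onb :: 'a::finite_dim_inner set)"
proof (rule pairwise_orthogonal_independent)
  show "pairwise orthogonal (onb::'a set)"
    by (auto simp: pairwise_def orthogonal_def inner_onb)
  show "0 \<notin> (onb::'a set)" using norm_onb by fastforce
qed

lemma linear_onb:
  assumes "linear (f :: 'a::finite_dim_inner \<Rightarrow> 'b::real_vector)"
  shows "f x = (\<Sum>b\<in>onb. (x \<bullet> b) *\<^sub>R f b)"
  by (subst onb_representation[of x, symmetric])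
     (simp add: linear_sum[OF assms] linear_cmul[OF assms])

lemma norm_linear_onb_le:
  assumes "linear (f :: 'a::finite_dim_inner \<Rightarrow> 'b::real_normed_vector)"
  shows "norm (f x) \<le> norm x * (\<Sum>b\<in>onb. norm (f b))"
proof -
  have "norm (f x) \<le> (\<Sum>b\<in>onb. norm ((x \<bullet> b) *\<^sub>R f b))"
    unfolding linear_onb[OF assms, of x] by (rule norm_sum)
  also have "\<dots> \<le> (\<Sum>b\<in>onb. norm x * norm (f b))"
    by (intro sum_mono) (simp add: mult_right_mono Cauchy_Schwarz_ineq2[THEN order_trans] norm_onb)
  finally show ?thesis by (simp add: sum_distrib_left)
qed

lemma linear_imp_bounded_linear:
  assumes "linear (f :: 'a::finite_dim_inner \<Rightarrow> 'b::real_normed_vector)"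
  shows "bounded_linear f"
  by (rule bounded_linear_intro[OF linear_add[OF assms] linear_cmul[OF assms] norm_linear_onb_le[OF assms]])

text \<open>Boundedness is passed to coordinates, one element of \<open>onb\<close> at a time. The
  instance supplies completeness of closed balls for the fixed point argument, and compactness of
  spheres, coordinate balls and sets of candidate minimisers.\<close>

instance finite_dim_inner \<subseteq> heine_borel
proof
  fix f :: "nat \<Rightarrow> 'a"
  assume f: "bounded (range f)"
  have "\<forall>\<delta>\<subseteq>onb. \<exists>l::'a. \<exists> r::nat\<Rightarrow>nat.
    strict_mono r \<and> (\<forall>\<epsilon>>0. eventually (\<lambda>n. \<forall>i\<in>\<delta>. dist (f (r n) \<bullet> i) (l \<bullet> i) < \<epsilon>) sequentially)"
  proof (rule compact_lemma_general[where unproj="\<lambda>e. \<Sum>i\<in>onb. e i *\<^sub>R i", OF finite_onb])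
    show "bounded ((\<lambda>x. x \<bullet> k) ` range f)" for k
      by (intro bounded_linear_image f bounded_linear_inner_left)
    show "(\<Sum>i\<in>onb. \<epsilon> i *\<^sub>R i) \<bullet> k = \<epsilon> k" if "k \<in> onb" for \<epsilon> and k :: 'a
    proof -
      have "(\<Sum>i\<in>onb. \<epsilon> i *\<^sub>R i) \<bullet> k = (\<Sum>i\<in>onb. if i = k then \<epsilon> i else 0)"
        unfolding inner_sum_left using that by (intro sum.cong) (auto simp: inner_onb)
      then show ?thesis using that by simp
    qed
  qed (rule onb_representation)
  then obtain l and r :: "nat \<Rightarrow> nat" where r: "strict_mono r"
    and l: "\<And>e. e > 0 \<Longrightarrow> eventually (\<lambda>n. \<forall>i\<in>onb. dist (f (r n) \<bullet> i) (l \<bullet> i) < e) sequentially"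
    by blast
  have "(\<lambda>n. \<Sum>i\<in>onb. (f (r n) \<bullet> i) *\<^sub>R i) \<longlonglongrightarrow> (\<Sum>i\<in>onb. (l \<bullet> i) *\<^sub>R i)"
  proof (intro tendsto_sum tendsto_scaleR tendsto_const tendstoI)
    fix i :: 'a and e :: real assume "i \<in> onb" "e > 0"
    show "\<forall>\<^sub>F n in sequentially. dist (f (r n) \<bullet> i) (l \<bullet> i) < e"
      using l[OF \<open>e > 0\<close>] by eventually_elim (use \<open>i \<in> onb\<close> in auto)
  qed
  then have "(f \<circ> r) \<longlonglongrightarrow> l" by (simp add: onb_representation o_def)
  with r show "\<exists>l r. strict_mono r \<and> (f \<circ> r) \<longlonglongrightarrow> l" by blast
qed

text \<open>Charts of product manifolds take values in products of model spaces.\<close>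

instance prod :: (finite_dim_inner, finite_dim_inner) finite_dim_inner
proof
  let ?B = "(\<lambda>b. (b, 0::'b)) ` (onb :: 'a set) \<union> (\<lambda>b. (0::'a, b)) ` (onb :: 'b set)"
  have fin: "finite ?B" by (simp add: finite_onb)
  have "x \<in> span ?B" for x :: "'a \<times> 'b"
  proof -
    have "x = (\<Sum>b\<in>onb. (fst x \<bullet> b) *\<^sub>R (b, 0::'b)) + (\<Sum>b\<in>onb. (snd x \<bullet> b) *\<^sub>R (0::'a, b))"
      by (rule prod_eqI) (simp_all add: fst_sum snd_sum onb_representation)
    also have "\<dots> \<in> span ?B"
      by (intro span_add span_sum span_scale span_base) auto
    finally show ?thesis .
  qed
  then have "\<exists>c. x = (\<Sum>b\<in>?B. c b *\<^sub>R b)" for x :: "'a \<times> 'b"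
    using span_finite[OF fin] by blast
  then show "\<exists>B :: ('a \<times> 'b) set. finite B \<and> (\<forall>x. \<exists>c. x = (\<Sum>b\<in>B. c b *\<^sub>R b))"
    using fin by blast
qed

section \<open>Dimensions and ranks of linear images\<close>

lemma dim_linear_image:
  assumes "linear f" "subspace V" "inj_on f V"
  shows "dim (f ` V) = dim V"
proof -
  obtain B where B: "B \<subseteq> V" "independent B" "V \<subseteq> span B" "card B = dim V"
    using basis_exists[of V] by metis
  have sp: "span B = V" using B assms(2) by (simp add: span_minimal subset_antisym)
  have "independent (f ` B)"
    using linear_independent_injective_image[OF assms(1) B(2)] assms(3) sp by simp
  moreover have "span (f ` B) = span (f ` V)"
    using linear_span_image[OF assms(1), of B] sp
    by (metis assms(1) assms(2) linear_span_image span_eq_iff)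
  ultimately have "dim (f ` V) = card (f ` B)" using dim_eq_card by metis
  also have "\<dots> = card B" using assms(3) B(1) by (intro card_image) (auto intro: inj_on_subset)
  finally show ?thesis using B(4) by simp
qed

lemma subspace_eq_if_dim_eq:
  fixes S T :: "'a::finite_dim_inner set"
  assumes "subspace S" "subspace T" "S \<subseteq> T" "dim S = dim T"
  shows "S = T"
proof -
  interpret fdi: finite_dimensional_vector_space "scaleR :: real \<Rightarrow> 'a \<Rightarrow> 'a" onb
    rewrites "module.subspace (*\<^sub>R) = subspace" and "vector_space.dim (*\<^sub>R) = dim"
    using finite_onb independent_onb span_onb
    by unfold_locales (auto simp: dependent_raw_def span_raw_def subspace_raw_def dim_raw_def)
  show ?thesis using fdi.subspace_dim_equal[OF assms(1-3)] assms(4) by simp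
qed

text \<open>This is how constant rank is exploited: \<open>U\<close> is a subspace on which
  \<open>A0\<close> already attains its range. If \<open>A\<close> is still injective on
  \<open>U\<close>, its image of \<open>U\<close> has dimension \<open>dim U\<close>, hence the rank
  of \<open>A0\<close>, which is the rank of \<open>A\<close>; so \<open>A\<close> attains its whole
  range on \<open>U\<close> too.\<close>

lemma range_eq_if_rank_eq:
  fixes A A0 :: "'e::real_vector \<Rightarrow> 'd::finite_dim_inner"
  assumes "linear A" "linear A0" "subspace U" "inj_on A U" "inj_on A0 U"
    and "A0 ` U = range A0" "dim (range A) = dim (range A0)"
  shows "A ` U = range A"
proof (rule subspace_eq_if_dim_eq)
  show "subspace (A ` U)" "subspace (range A)"
    using assms by (auto intro: linear_subspace_image subspace_UNIV)
  show "dim (A ` U) = dim (range A)"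
    using assms by (metis dim_linear_image)
qed auto


section \<open>Constant rank level sets\<close>

lemma inj_linear_imp_bij:
  fixes f :: "'e::finite_dim_inner \<Rightarrow> 'e"
  assumes "linear f" "inj f"
  shows "bij f"
proof -
  have "range f = UNIV"
  proof (rule subspace_eq_if_dim_eq)
    show "subspace (range f)" using assms(1) by (intro linear_subspace_image subspace_UNIV)
    show "dim (range f) = dim (UNIV :: 'e set)"
      using assms by (intro dim_linear_image) auto
  qed auto
  then show ?thesis using assms(2) by (simp add: bij_def)
qed

lemma linear_left_inverse_bij:
  assumes "linear f" "bij f"
  shows "linear (inv f)" "f (inv f y) = y" "inv f (f x) = x"
proof -
  show 1: "f (inv f y) = y" for y using assms(2) by (meson bij_inv_eq_iff)
  show 2: "inv f (f x) = x" for x using assms(2) by (simp add: bij_is_inj)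
  show "linear (inv f)"
  proof (rule linearI)
    show "inv f (x + y) = inv f x + inv f y" for x y
      using 2[of "inv f x + inv f y"] by (simp add: 1 linear_add[OF assms(1)])
    show "inv f (c *\<^sub>R x) = c *\<^sub>R inv f x" for c x
      using 2[of "c *\<^sub>R inv f x"] by (simp add: 1 linear_cmul[OF assms(1)])
  qed
qed

text \<open>With \<open>L\<close> the inverse of \<open>g' p0\<close>, the map
  \<open>h p = p - L (g p)\<close> has derivative 0 at \<open>p0\<close>, so it is a contraction
  nearby; \<open>g p = q\<close> says that \<open>p\<close> is a fixed point of
  \<open>\<lambda>p. h p + L q\<close>. Continuity of the derivative at the single point
  \<open>p0\<close> yields uniform smallness on a ball.\<close>

lemma local_inverse:
  fixes g :: "'e::finite_dim_inner \<Rightarrow> 'e"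
  assumes G: "open G" "p0 \<in> G"
    and der: "\<And>p. p \<in> G \<Longrightarrow> (g has_derivative g' p) (at p)"
    and cont: "\<And>v. isCont (\<lambda>p. g' p v) p0"
    and inj: "inj (g' p0)"
  obtains r \<rho> \<Theta> where "r > 0" "cball p0 r \<subseteq> G" "\<rho> > 0"
    "\<And>p. p \<in> ball p0 r \<Longrightarrow> bij (g' p)"
    "\<And>q. q \<in> ball (g p0) \<rho> \<Longrightarrow> \<Theta> q \<in> ball p0 r \<and> g (\<Theta> q) = q"
    "\<And>p. p \<in> ball p0 r \<Longrightarrow> g p \<in> ball (g p0) \<rho> \<Longrightarrow> \<Theta> (g p) = p"
    "\<And>q. q \<in> ball (g p0) \<rho> \<Longrightarrow> (\<Theta> has_derivative inv (g' (\<Theta> q))) (at q)"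
proof -
  have lin: "linear (g' p)" if "p \<in> G" for p
    using der[OF that] by (auto dest: has_derivative_linear)
  have bij0: "bij (g' p0)" using inj_linear_imp_bij[OF lin[OF G(2)] inj] .
  define L where "L = inv (g' p0)"
  have L: "linear L" "\<And>y. g' p0 (L y) = y" "\<And>x. L (g' p0 x) = x"
    using linear_left_inverse_bij[OF lin[OF G(2)] bij0] by (auto simp: L_def)
  have blL: "bounded_linear L" using L(1) by (rule linear_imp_bounded_linear)
  obtain C where C: "C > 0" "\<And>x. norm (L x) \<le> norm x * C"
    using bounded_linear.pos_bounded[OF blL] by blast
  \<comment> \<open>\<open>s p\<close> bounds the operator norm of
    \<open>L \<circ> g' p - id\<close> by its values on a basis, so that continuity in each single
    direction is enough.\<close>
  define s where "s p = (\<Sum>b\<in>onb. norm (L (g' p b) - b))" for p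
  have "(s \<longlongrightarrow> (\<Sum>b\<in>onb. norm (L (g' p0 b) - b))) (at p0)"
    unfolding s_def
    by (intro tendsto_intros bounded_linear.tendsto[OF blL] cont[unfolded isCont_def])
  then have "(s \<longlongrightarrow> 0) (at p0)" by (simp add: L(3))
  then have "\<forall>\<^sub>F p in at p0. s p < 1/2"
    by (rule order_tendstoD) simp
  then obtain d where d: "d > 0" "\<And>p. p \<noteq> p0 \<Longrightarrow> dist p p0 < d \<Longrightarrow> s p < 1/2"
    unfolding eventually_at by auto
  have s0: "s p0 = 0" by (simp add: s_def L(3))
  obtain d' where d': "d' > 0" "cball p0 d' \<subseteq> G"
    using G open_contains_cball by blast
  define r where "r = min (d/2) d'"
  have r: "r > 0" "cball p0 r \<subseteq> G" using d(1) d' by (auto simp: r_def)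
  have sr: "s p \<le> 1/2" if "p \<in> cball p0 r" for p
  proof (cases "p = p0")
    case False
    moreover have "dist p p0 < d" using that d(1) by (auto simp: r_def dist_commute)
    ultimately show ?thesis using d(2) by fastforce
  qed (simp add: s0)
  have near: "norm (L (g' p v) - v) \<le> norm v / 2" if "p \<in> cball p0 r" for p v
  proof -
    have "p \<in> G" using that r(2) by auto
    have "linear (\<lambda>v. L (g' p v) - v)"
      using linear_compose_sub[OF linear_compose[OF lin[OF \<open>p \<in> G\<close>] L(1)] linear_id]
      by (simp add: o_def id_def)
    from norm_linear_onb_le[OF this, of v] have "norm (L (g' p v) - v) \<le> norm v * s p"
      by (simp add: s_def)
    also have "\<dots> \<le> norm v * (1/2)" using sr[OF that] by (intro mult_left_mono) auto
    finally show ?thesis by simp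
  qed
  have bij: "bij (g' p)" if "p \<in> cball p0 r" for p
  proof (rule inj_linear_imp_bij)
    show l: "linear (g' p)" using lin that r(2) by auto
    have "v = 0" if "g' p v = 0" for v
      using near[OF \<open>p \<in> cball p0 r\<close>, of v] that linear_0[OF L(1)] by simp
    then show "inj (g' p)" using l linear_injective_0 by blast
  qed
  define h where "h p = p - L (g p)" for p
  have lip: "norm (h x - h y) \<le> 1/2 * norm (x - y)" if "x \<in> cball p0 r" "y \<in> cball p0 r" for x y
  proof (rule differentiable_bound[OF convex_cball _ _ that(1) that(2)])
    fix p assume p: "p \<in> cball p0 r"
    have "(h has_derivative (\<lambda>v. v - L (g' p v))) (at p)"
      unfolding h_def using der[of p] p r(2)
      by (intro derivative_intros bounded_linear.has_derivative[OF blL]) auto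
    then show "(h has_derivative (\<lambda>v. v - L (g' p v))) (at p within cball p0 r)"
      by (rule has_derivative_at_withinI)
    show "onorm (\<lambda>v. v - L (g' p v)) \<le> 1/2"
      using near[OF p] by (intro onorm_bound) (simp_all add: norm_minus_commute)
  qed
  \<comment> \<open>Half of \<open>norm (x - y)\<close> is absorbed by the contraction
    \<open>h\<close>. The estimate gives injectivity of \<open>g\<close> and the Lipschitz bound of
    the inverse.\<close>
  have expand: "norm (x - y) \<le> 2 * norm (L (g x) - L (g y))"
    if "x \<in> cball p0 r" "y \<in> cball p0 r" for x y
  proof -
    have "x - y = (h x - h y) + (L (g x) - L (g y))" by (simp add: h_def)
    then have "norm (x - y) \<le> norm (h x - h y) + norm (L (g x) - L (g y))"
      by (metis norm_triangle_ineq)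
    then show ?thesis using lip[OF that] by simp
  qed
  \<comment> \<open>A target \<open>q\<close> within \<open>\<rho>\<close> shifts the centre by at
    most \<open>r / 4\<close>. With the contraction factor 1/2, the closed ball is mapped to within
    \<open>r / 2 + r / 4 < r\<close> of \<open>p0\<close>, so the fixed point lies in the open
    ball.\<close>
  define \<rho> where "\<rho> = r / (4 * C)"
  have \<rho>: "\<rho> > 0" using r C by (simp add: \<rho>_def)
  have ex: "\<exists>p. p \<in> ball p0 r \<and> g p = q" if q: "q \<in> ball (g p0) \<rho>" for q
  proof -
    have Lq: "norm (L q - L (g p0)) \<le> r / 4"
    proof -
      have "norm (L q - L (g p0)) = norm (L (q - g p0))"
        by (simp add: linear_diff[OF L(1)])
      also have "\<dots> \<le> norm (q - g p0) * C" by (rule C(2))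
      also have "\<dots> \<le> \<rho> * C"
        using q C(1) by (intro mult_right_mono) (auto simp: dist_norm norm_minus_commute)
      also have "\<dots> = r / 4" using C by (simp add: \<rho>_def)
      finally show ?thesis .
    qed
    define T where "T p = h p + L q" for p
    have Tb: "norm (T p - p0) < r" if "p \<in> cball p0 r" for p
    proof -
      have "T p - p0 = (h p - h p0) + (L q - L (g p0))" by (simp add: T_def h_def)
      then have "norm (T p - p0) \<le> norm (h p - h p0) + norm (L q - L (g p0))"
        by (metis norm_triangle_ineq)
      also have "\<dots> \<le> 1/2 * norm (p - p0) + r / 4"
        using lip[OF that, of p0] Lq r(1) by auto
      also have "\<dots> \<le> 1/2 * r + r/4"
        using that by (auto simp: dist_norm norm_minus_commute)
      also have "\<dots> < r" using r(1) by simp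
      finally show ?thesis .
    qed
    have "\<exists>!p\<in>cball p0 r. T p = p"
    proof (rule Banach_fix[where c="1/2"])
      show "complete (cball p0 r)" by (simp add: complete_eq_closed)
      show "T ` cball p0 r \<subseteq> cball p0 r"
        using Tb by (force simp: dist_norm norm_minus_commute)
      show "dist (T x) (T y) \<le> 1/2 * dist x y" if "x \<in> cball p0 r" "y \<in> cball p0 r" for x y
        using lip[OF that] by (simp add: dist_norm T_def)
    qed (use r in auto)
    then obtain p where p: "p \<in> cball p0 r" "T p = p" by blast
    then have "L (g p) = L q" by (simp add: T_def h_def algebra_simps)
    then have "g p = q" using L(2) by metis
    moreover have "p \<in> ball p0 r" using Tb[OF p(1)] p(2) by (simp add: dist_norm norm_minus_commute)
    ultimately show ?thesis by blast
  qed
  define \<Theta> where "\<Theta> q = (SOME p. p \<in> ball p0 r \<and> g p = q)" for q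
  have \<Theta>: "\<Theta> q \<in> ball p0 r" "g (\<Theta> q) = q" if "q \<in> ball (g p0) \<rho>" for q
    using someI_ex[OF ex[OF that]] by (auto simp: \<Theta>_def)
  have \<Theta>lip: "norm (\<Theta> q - \<Theta> q') \<le> 2 * (norm (q - q') * C)"
    if "q \<in> ball (g p0) \<rho>" "q' \<in> ball (g p0) \<rho>" for q q'
  proof -
    have "norm (\<Theta> q - \<Theta> q') \<le> 2 * norm (L q - L q')"
      using expand[of "\<Theta> q" "\<Theta> q'"] \<Theta>[OF that(1)] \<Theta>[OF that(2)] by (simp add: less_imp_le)
    then show ?thesis using C(2)[of "q - q'"] by (simp add: linear_diff[OF L(1)])
  qed
  show thesis
  proof (rule that[OF r \<rho>])
    show "bij (g' p)" if "p \<in> ball p0 r" for p using bij that by auto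
    show "\<Theta> q \<in> ball p0 r \<and> g (\<Theta> q) = q" if "q \<in> ball (g p0) \<rho>" for q using \<Theta>[OF that] by auto
    show "\<Theta> (g p) = p" if "p \<in> ball p0 r" "g p \<in> ball (g p0) \<rho>" for p
      using expand[of "\<Theta> (g p)" p] \<Theta>[OF that(2)] that(1) by simp
    fix q assume q: "q \<in> ball (g p0) \<rho>"
    have inG: "\<Theta> q \<in> G" using \<Theta>[OF q] r(2) by auto
    have b: "bij (g' (\<Theta> q))" using \<Theta>[OF q] by (intro bij) auto
    show "(\<Theta> has_derivative inv (g' (\<Theta> q))) (at q)"
    proof (rule has_derivative_inverse_basic[where g = \<Theta> and y = q, OF der[OF inG] _ _ _ open_ball q])
      show "bounded_linear (inv (g' (\<Theta> q)))"
        using linear_left_inverse_bij[OF lin[OF inG] b] by (intro linear_imp_bounded_linear)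
      show "inv (g' (\<Theta> q)) \<circ> g' (\<Theta> q) = id" using b by (simp add: bij_is_inj)
      show "g (\<Theta> z) = z" if "z \<in> ball (g p0) \<rho>" for z using \<Theta>[OF that] by simp
      have "((\<lambda>q'. \<Theta> q' - \<Theta> q) \<longlongrightarrow> 0) (at q)"
      proof (rule Lim_null_comparison)
        show "\<forall>\<^sub>F q' in at q. norm (\<Theta> q' - \<Theta> q) \<le> 2 * (norm (q' - q) * C)"
          using eventually_at_in_open'[OF open_ball q] by eventually_elim (use \<Theta>lip q in auto)
        show "((\<lambda>q'. 2 * (norm (q' - q) * C)) \<longlongrightarrow> 0) (at q)"
          by (auto intro!: tendsto_eq_intros)
      qed
      then show "continuous (at q) \<Theta>" by (simp add: continuous_at LIM_zero_iff)
    qed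
  qed
qed

text \<open>The map \<open>\<lambda>p. R p + T (f p - c)\<close> is a local diffeomorphism, where \<open>T\<close> inverts the derivative of
  \<open>f\<close> on the kernel of \<open>R\<close>. Constancy of the rank makes \<open>f\<close> constant along the image of \<open>R\<close> in the
  new coordinates.\<close>

lemma constant_rank_level_set:
  fixes f :: "'e::finite_dim_inner \<Rightarrow> 'd::finite_dim_inner"
  assumes G: "open G" "p0 \<in> G"
    and der: "\<And>p. p \<in> G \<Longrightarrow> (f has_derivative f' p) (at p)"
    and cont: "\<And>v. isCont (\<lambda>p. f' p v) p0"
    and rank: "\<And>p. p \<in> G \<Longrightarrow> dim (range (f' p)) = dim (range (f' p0))"
    and R: "linear R" "\<And>x. R (R x) = R x"
    and injR: "inj_on (f' p0) {u. R u = 0}"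
    and ranR: "f' p0 ` {u. R u = 0} = range (f' p0)"
    and p0: "f p0 = c"
  obtains \<rho> \<Theta> \<Theta>' S where "\<rho> > 0" "open S" "p0 \<in> S" "S \<subseteq> G" "\<Theta> (R p0) = p0"
    "\<And>q. q \<in> ball (R p0) \<rho> \<Longrightarrow> R q = q \<Longrightarrow> \<Theta> q \<in> S \<and> f (\<Theta> q) = c \<and> R (\<Theta> q) = q"
    "\<And>p. p \<in> S \<Longrightarrow> R p \<in> ball (R p0) \<rho>"
    "\<And>p. p \<in> S \<Longrightarrow> f p = c \<Longrightarrow> \<Theta> (R p) = p"
    "\<And>p. p \<in> S \<Longrightarrow> inj_on (f' p) {u. R u = 0}"
    "\<And>q. q \<in> ball (R p0) \<rho> \<Longrightarrow> R q = q \<Longrightarrow> (\<Theta> has_derivative \<Theta>' q) (at q)"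
    "\<And>q v. q \<in> ball (R p0) \<rho> \<Longrightarrow> R q = q \<Longrightarrow> R v = v \<Longrightarrow>
       R (\<Theta>' q v) = v \<and> f' (\<Theta> q) (\<Theta>' q v) = 0"
proof -
  have lin: "linear (f' p)" if "p \<in> G" for p
    using der[OF that] by (auto dest: has_derivative_linear)
  have sub: "subspace {u. R u = 0}" using R(1) by (rule linear_subspace_kernel)
  obtain T where T: "T \<in> UNIV \<rightarrow> {u. R u = 0}" "linear T" "\<forall>v\<in>{u. R u = 0}. T (f' p0 v) = v"
    using linear_exists_left_inverse_on[OF lin[OF G(2)] sub injR] by blast
  have RT: "R (T x) = 0" for x using T(1) by auto
  have blR: "bounded_linear R" and blT: "bounded_linear T"
    using R(1) T(2) by (auto intro: linear_imp_bounded_linear)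
  \<comment> \<open>As \<open>T\<close> takes values in the kernel of \<open>R\<close>, applying
    \<open>R\<close> to \<open>\<Psi> p\<close> gives \<open>R p\<close>; and on the level set
    \<open>\<Psi> p = R p\<close>. So the level set is read off from \<open>\<Theta>\<close> on the
    range of \<open>R\<close>.\<close>
  define \<Psi> where "\<Psi> p = R p + T (f p - c)" for p
  define \<Psi>' where "\<Psi>' p v = R v + T (f' p v)" for p v
  have R\<Psi>: "R (\<Psi> p) = R p" for p by (simp add: \<Psi>_def linear_add[OF R(1)] RT R(2))
  have R\<Psi>': "R (\<Psi>' p v) = R v" for p v by (simp add: \<Psi>'_def linear_add[OF R(1)] RT R(2))
  have \<Psi>0: "\<Psi> p0 = R p0" by (simp add: \<Psi>_def p0 linear_0[OF T(2)])
  have d\<Psi>: "(\<Psi> has_derivative \<Psi>' p) (at p)" if "p \<in> G" for p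
  proof -
    have "((\<lambda>p. R p + T (f p - c)) has_derivative (\<lambda>v. R v + T (f' p v - 0))) (at p)"
      by (intro derivative_intros bounded_linear.has_derivative[OF blR]
            bounded_linear.has_derivative[OF blT] der[OF that] has_derivative_ident)
    then show ?thesis by (simp add: \<Psi>_def[abs_def] \<Psi>'_def[abs_def])
  qed
  have c\<Psi>: "isCont (\<lambda>p. \<Psi>' p v) p0" for v
    unfolding \<Psi>'_def isCont_def
    by (intro tendsto_intros bounded_linear.tendsto[OF blT] cont[unfolded isCont_def])
  have l\<Psi>: "linear (\<Psi>' p)" if "p \<in> G" for p
    using d\<Psi>[OF that] by (auto dest: has_derivative_linear)
  have inj\<Psi>: "inj (\<Psi>' p0)"
  proof -
    have "v = 0" if "\<Psi>' p0 v = 0" for v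
    proof -
      have Rv: "R v = 0" using R\<Psi>'[of p0 v] that by (simp add: linear_0[OF R(1)])
      then have "\<Psi>' p0 v = v" using T(3) by (simp add: \<Psi>'_def)
      then show ?thesis using that by simp
    qed
    then show ?thesis using l\<Psi>[OF G(2)] linear_injective_0 by blast
  qed
  obtain r \<rho> \<Theta> where r: "r > 0" "cball p0 r \<subseteq> G" and \<rho>: "\<rho> > 0"
    and bij: "\<And>p. p \<in> ball p0 r \<Longrightarrow> bij (\<Psi>' p)"
    and \<Theta>: "\<And>q. q \<in> ball (\<Psi> p0) \<rho> \<Longrightarrow> \<Theta> q \<in> ball p0 r \<and> \<Psi> (\<Theta> q) = q"
    and \<Theta>inv: "\<And>p. p \<in> ball p0 r \<Longrightarrow> \<Psi> p \<in> ball (\<Psi> p0) \<rho> \<Longrightarrow> \<Theta> (\<Psi> p) = p"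
    and d\<Theta>: "\<And>q. q \<in> ball (\<Psi> p0) \<rho> \<Longrightarrow> (\<Theta> has_derivative inv (\<Psi>' (\<Theta> q))) (at q)"
    by (rule local_inverse[where g = \<Psi>, OF G d\<Psi> c\<Psi> inj\<Psi>]) (assumption+, rule that, assumption+)
  define S where "S = ball p0 r \<inter> R -` ball (R p0) \<rho>"
  have "open S" unfolding S_def
    using bounded_linear.continuous_on[OF blR continuous_on_id] by (intro open_Int open_vimage) auto
  \<comment> \<open>On the kernel of \<open>R\<close> the derivative \<open>\<Psi>' p\<close> is
    \<open>T \<circ> f' p\<close>.\<close>
  have inj: "inj_on (f' p) {u. R u = 0}" if "p \<in> ball p0 r" for p
  proof -
    have "p \<in> G" using that r(2) by auto
    have "u = 0" if "R u = 0" "f' p u = 0" for u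
    proof -
      have "\<Psi>' p u = 0" using that by (simp add: \<Psi>'_def linear_0[OF T(2)])
      then show ?thesis
        using bij[OF \<open>p \<in> ball p0 r\<close>] l\<Psi>[OF \<open>p \<in> G\<close>] linear_injective_0 by (metis bij_is_inj)
    qed
    then show ?thesis
      using linear_inj_on_iff_eq_0[OF lin[OF \<open>p \<in> G\<close>] sub] by auto
  qed
  have key: "R (inv (\<Psi>' (\<Theta> q)) v) = v \<and> f' (\<Theta> q) (inv (\<Psi>' (\<Theta> q)) v) = 0"
    if q: "q \<in> ball (R p0) \<rho>" and v: "R v = v" for q v
  proof -
    define p where "p = \<Theta> q"
    have p: "p \<in> ball p0 r" using \<Theta>[of q] q by (auto simp: \<Psi>0 p_def)
    then have pO: "p \<in> G" using r(2) by auto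
    define u where "u = inv (\<Psi>' p) v"
    have u: "\<Psi>' p u = v" unfolding u_def using linear_left_inverse_bij[OF l\<Psi>[OF pO] bij[OF p]] by simp
    have Ru: "R u = v" using R\<Psi>'[of p u] u v by simp
    then have Tu: "T (f' p u) = 0" using u by (simp add: \<Psi>'_def)
    \<comment> \<open>\<open>T (f' p u) = 0\<close> alone does not give \<open>f' p u = 0\<close>,
      as \<open>T\<close> may have a kernel. Equal rank replaces \<open>u\<close> by some
      \<open>w\<close> in the kernel of \<open>R\<close>, where \<open>T \<circ> f' p\<close> is
      injective.\<close>
    have "f' p ` {u. R u = 0} = range (f' p)"
      by (rule range_eq_if_rank_eq[OF lin[OF pO] lin[OF G(2)] sub inj[OF p] injR ranR rank[OF pO]])
    then obtain w where w: "R w = 0" "f' p u = f' p w" by (metis (mono_tags, lifting) imageE mem_Collect_eq rangeI)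
    then have "\<Psi>' p w = 0" using Tu by (simp add: \<Psi>'_def)
    then have "w = 0" using bij[OF p] l\<Psi>[OF pO] linear_injective_0 by (metis bij_is_inj)
    then show ?thesis using Ru w by (simp add: u_def p_def linear_0[OF lin[OF pO[unfolded p_def]]])
  qed
  have const: "f (\<Theta> q) = c" if q: "q \<in> ball (R p0) \<rho>" and Rq: "R q = q" for q
  proof -
    have \<Theta>0: "\<Theta> (R p0) = p0" using \<Theta>inv[of p0] r \<rho> by (simp add: \<Psi>0)
    let ?S = "{q. R q = q} \<inter> ball (R p0) \<rho>"
    have "subspace {q. R q = q}"
      by (simp add: subspace_def linear_0[OF R(1)] linear_add[OF R(1)] linear_cmul[OF R(1)])
    then have cvx: "convex ?S" by (intro convex_Int subspace_imp_convex convex_ball)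
    \<comment> \<open>The segment from \<open>R p0\<close> to \<open>q\<close> consists of fixed
      points of \<open>R\<close>, so by \<open>key\<close> the derivative of
      \<open>f \<circ> \<Theta>\<close> along it is 0.\<close>
    define k where "k t = f (\<Theta> (R p0 + t *\<^sub>R (q - R p0)))" for t :: real
    have in_S: "R p0 + t *\<^sub>R (q - R p0) \<in> ?S" if "t \<in> {0..1}" for t
    proof -
      have "(1 - t) *\<^sub>R R p0 + t *\<^sub>R q \<in> ?S"
        using that q Rq \<rho> R(2) by (intro convexD[OF cvx]) auto
      then show ?thesis by (simp add: algebra_simps)
    qed
    have "(k has_derivative (\<lambda>h. 0)) (at t within {0..1})" if t: "t \<in> {0..1}" for t
    proof -
      define q' where "q' = R p0 + t *\<^sub>R (q - R p0)"
      have q': "q' \<in> ball (R p0) \<rho>" "R q' = q'" using in_S[OF t] by (auto simp: q'_def)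
      have "\<Theta> q' \<in> G" using \<Theta>[of q'] q' r(2) by (auto simp: \<Psi>0)
      have "(k has_derivative (\<lambda>h. f' (\<Theta> q') (inv (\<Psi>' (\<Theta> q')) (h *\<^sub>R (q - R p0))))) (at t within {0..1})"
        unfolding k_def
      proof (rule has_derivative_compose[where g=f])
        have "((\<lambda>t. R p0 + t *\<^sub>R (q - R p0)) has_derivative (\<lambda>h. h *\<^sub>R (q - R p0))) (at t within {0..1})"
          by (auto intro!: derivative_eq_intros)
        then show "((\<lambda>t. \<Theta> (R p0 + t *\<^sub>R (q - R p0))) has_derivative
            (\<lambda>h. inv (\<Psi>' (\<Theta> q')) (h *\<^sub>R (q - R p0)))) (at t within {0..1})"
          by (rule has_derivative_compose) (use d\<Theta>[of q'] q' in \<open>simp add: \<Psi>0 q'_def\<close>)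
        show "(f has_derivative f' (\<Theta> q')) (at (\<Theta> (R p0 + t *\<^sub>R (q - R p0))))"
          using der[OF \<open>\<Theta> q' \<in> G\<close>] by (simp add: q'_def)
      qed
      moreover have "f' (\<Theta> q') (inv (\<Psi>' (\<Theta> q')) (h *\<^sub>R (q - R p0))) = 0" for h
        using key[OF q'(1), of "h *\<^sub>R (q - R p0)"] Rq R(2)
        by (simp add: linear_cmul[OF R(1)] linear_diff[OF R(1)])
      ultimately show ?thesis by simp
    qed
    then obtain C where "\<And>t. t \<in> {0..1} \<Longrightarrow> k t = C"
      using has_derivative_zero_constant[of "{0..1::real}" k] by auto
    then have "k 1 = k 0" by simp
    then show ?thesis by (simp add: k_def \<Theta>0 p0)
  qed
  show thesis
  proof (rule that[OF \<rho> \<open>open S\<close>, of \<Theta> "\<lambda>q. inv (\<Psi>' (\<Theta> q))"])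
    show "p0 \<in> S" using r \<rho> by (simp add: S_def)
    show "S \<subseteq> G" using r by (auto simp: S_def)
    show "\<Theta> (R p0) = p0" using \<Theta>inv[of p0] r \<rho> by (simp add: \<Psi>0)
    show "\<Theta> q \<in> S \<and> f (\<Theta> q) = c \<and> R (\<Theta> q) = q" if "q \<in> ball (R p0) \<rho>" "R q = q" for q
      using \<Theta>[of q] that const[OF that] R\<Psi>[of "\<Theta> q"] by (auto simp: S_def \<Psi>0)
    show "R p \<in> ball (R p0) \<rho>" if "p \<in> S" for p using that by (simp add: S_def)
    show "\<Theta> (R p) = p" if "p \<in> S" "f p = c" for p
      using \<Theta>inv[of p] that by (simp add: S_def \<Psi>0) (simp add: \<Psi>_def linear_0[OF T(2)])
    show "inj_on (f' p) {u. R u = 0}" if "p \<in> S" for p using that inj by (simp add: S_def)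
    show "(\<Theta> has_derivative inv (\<Psi>' (\<Theta> q))) (at q)" if "q \<in> ball (R p0) \<rho>" "R q = q" for q
      using d\<Theta>[of q] that by (simp add: \<Psi>0)
    show "R (inv (\<Psi>' (\<Theta> q)) v) = v \<and> f' (\<Theta> q) (inv (\<Psi>' (\<Theta> q)) v) = 0"
      if "q \<in> ball (R p0) \<rho>" "R q = q" "R v = v" for q v
      using key that by blast
  qed
qed

section \<open>Elimination of the latent variable\<close>

lemma exists_linear_projection:
  assumes "subspace (V :: 'a::real_vector set)"
  obtains Q where "linear Q" "\<And>x. Q x \<in> V" "\<And>x. x \<in> V \<Longrightarrow> Q x = x"
proof -
  obtain Q where "Q \<in> UNIV \<rightarrow> V" "linear Q" "\<forall>v\<in>V. Q (id v) = v"
    using linear_exists_left_inverse_on[OF linear_id assms inj_on_id] by blast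
  then show thesis by (intro that[of Q]) auto
qed

text \<open>In the coordinates given by \<open>(x, y, z) \<mapsto> (x, P y, Q z)\<close>, where \<open>Q\<close> projects onto the kernel of
  \<open>\<partial>f/\<partial>z\<close>, the \<open>y\<close>-component of the solution set does not depend on \<open>Q z\<close>, because \<open>\<partial>f/\<partial>z\<close> has
  constant rank. This eliminates \<open>z\<close>.\<close>

lemma constant_rank_elimination:
  fixes f :: "'a::finite_dim_inner \<times> 'b::finite_dim_inner \<times> 'c::finite_dim_inner \<Rightarrow> 'd::finite_dim_inner"
  assumes G: "open G" "(a0, b0, c0) \<in> G"
    and der: "\<And>p. p \<in> G \<Longrightarrow> (f has_derivative f' p) (at p)"
    and cont: "\<And>v. isCont (\<lambda>p. f' p v) (a0, b0, c0)"
    and rank: "\<And>p. p \<in> G \<Longrightarrow> dim (range (f' p)) = r"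
    and rank_yz: "dim (range (\<lambda>u. f' (a0, b0, c0) (0, u))) = r"
    and rank_z: "\<And>p. p \<in> G \<Longrightarrow> dim (range (\<lambda>\<zeta>. f' p (0, 0, \<zeta>))) = k"
    and P: "linear P" "\<And>\<eta>. P (P \<eta>) = P \<eta>"
    and PK: "\<And>\<eta>. P \<eta> = \<eta> \<longleftrightarrow> (\<exists>\<zeta>. f' (a0, b0, c0) (0, \<eta>, \<zeta>) = 0)"
    and f0: "f (a0, b0, c0) = c"
  obtains N V J \<Phi> \<Phi>' where
    "open N" "c0 \<in> N" "open V" "(a0, b0) \<in> V" "open J" "(a0, P b0) \<in> J"
    "\<And>a b \<zeta>. (a, b) \<in> V \<Longrightarrow> \<zeta> \<in> N \<Longrightarrow> f (a, b, \<zeta>) = c \<Longrightarrow> b = \<Phi> (a, P b)"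
    "\<And>M. open M \<Longrightarrow> c0 \<in> M \<Longrightarrow> \<forall>\<^sub>F (a, b) in nhds (a0, b0).
       b = \<Phi> (a, P b) \<longrightarrow> (\<exists>\<zeta>\<in>M. (a, b, \<zeta>) \<in> G \<and> f (a, b, \<zeta>) = c)"
    "\<And>a k. (a, k) \<in> J \<Longrightarrow> P k = k \<Longrightarrow> isCont \<Phi> (a, k) \<and> P (\<Phi> (a, k)) = k"
    "\<Phi> (a0, P b0) = b0"
    "(\<Phi> has_derivative \<Phi>') (at (a0, P b0))"
    "\<And>a k. P k = k \<Longrightarrow> P (\<Phi>' (a, k)) = k \<and> (\<exists>\<zeta>. f' (a0, b0, c0) (a, \<Phi>' (a, k), \<zeta>) = 0)"
proof -
  define p0 where "p0 = (a0, b0, c0)"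
  have lin: "linear (f' p)" if "p \<in> G" for p
    using der[OF that] by (auto dest: has_derivative_linear)
  have lin0: "linear (f' p0)" using lin G(2) by (simp add: p0_def)
  have z1: "f' p (0, 0, \<zeta> + \<zeta>') = f' p (0, 0, \<zeta>) + f' p (0, 0, \<zeta>')" if "p \<in> G" for p \<zeta> \<zeta>'
    using linear_add[OF lin[OF that], of "(0, 0, \<zeta>)" "(0, 0, \<zeta>')"] by simp
  have z2: "f' p (0, 0, t *\<^sub>R \<zeta>) = t *\<^sub>R f' p (0, 0, \<zeta>)" if "p \<in> G" for p t \<zeta>
    using linear_cmul[OF lin[OF that], of t "(0, 0, \<zeta>)"] by (simp add: zero_prod_def)
  have linz: "linear (\<lambda>\<zeta>. f' p (0, 0, \<zeta>))" if "p \<in> G" for p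
    using z1[OF that] z2[OF that] by (intro linearI)
  define Z where "Z = {\<zeta>. f' p0 (0, 0, \<zeta>) = 0}"
  have "subspace Z"
    unfolding Z_def using linear_subspace_kernel[OF linz] G(2) by (simp add: p0_def)
  then obtain Q where Q: "linear Q" "\<And>x. Q x \<in> Z" "\<And>x. x \<in> Z \<Longrightarrow> Q x = x"
    using exists_linear_projection by blast
  define R :: "'a \<times> 'b \<times> 'c \<Rightarrow> 'a \<times> 'b \<times> 'c" where "R = (\<lambda>(a, b, \<zeta>). (a, P b, Q \<zeta>))"
  have R[simp]: "R (a, b, \<zeta>) = (a, P b, Q \<zeta>)" for a b \<zeta> by (simp add: R_def)
  have QQ: "Q (Q x) = Q x" for x using Q by blast
  have linR: "linear R"
    by (rule linearI) (auto simp: linear_add[OF P(1)] linear_add[OF Q(1)] linear_cmul[OF P(1)] linear_cmul[OF Q(1)])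
  have RR: "R (R x) = R x" for x by (cases x) (simp add: P(2) QQ)
  \<comment> \<open>A vector \<open>(0, b, \<zeta>)\<close> in the kernel of \<open>f' p0\<close>
    has \<open>b\<close> in the range of \<open>P\<close>, while \<open>R u = 0\<close> puts
    \<open>b\<close> in the kernel of \<open>P\<close>; so \<open>b = 0\<close>. The same argument
    with \<open>Q\<close> then removes \<open>\<zeta>\<close>.\<close>
  have inj0: "inj_on (f' p0) {u. R u = 0}"
  proof -
    have "u = 0" if "R u = 0" "f' p0 u = 0" for u
    proof -
      obtain a b \<zeta> where u: "u = (a, b, \<zeta>)" by (cases u)
      have h: "a = 0" "P b = 0" "Q \<zeta> = 0" using that(1) u by (auto simp: zero_prod_def)
      then have "f' p0 (0, b, \<zeta>) = 0" using that(2) u by simp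
      then have "P b = b" using PK[of b] unfolding p0_def by blast
      then have "b = 0" using h by simp
      then have "\<zeta> \<in> Z" using that(2) u h by (simp add: Z_def)
      then have "\<zeta> = 0" using Q(3) h by simp
      then show ?thesis using u h \<open>b = 0\<close> by (simp add: zero_prod_def)
    qed
    then show ?thesis
      using linear_inj_on_iff_eq_0[OF lin0 linear_subspace_kernel[OF linR]] by auto
  qed
  have ran0: "f' p0 ` {u. R u = 0} = range (f' p0)"
  proof -
    \<comment> \<open>The full rank equals the rank in the \<open>(y, z)\<close> directions: input
      directions add nothing to the range, which is why the input can remain a free
      coordinate.\<close>
    have full: "range (\<lambda>u. f' p0 (0, u)) = range (f' p0)"
    proof (rule subspace_eq_if_dim_eq)
      have "linear (\<lambda>u. (0, u) :: 'a \<times> 'b \<times> 'c)" by (rule linearI) auto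
      from linear_compose[OF this lin0] show "subspace (range (\<lambda>u. f' p0 (0, u)))"
        by (intro linear_subspace_image subspace_UNIV) (simp add: o_def)
      show "subspace (range (f' p0))" using lin0 by (intro linear_subspace_image subspace_UNIV)
      show "dim (range (\<lambda>u. f' p0 (0, u))) = dim (range (f' p0))"
        using rank_yz rank[OF G(2)] by (simp add: p0_def)
    qed auto
    have in_im: "f' p0 (0, u) \<in> f' p0 ` {u. R u = 0}" for u
    proof -
      obtain b \<zeta> where u: "u = (b, \<zeta>)" by (cases u)
      \<comment> \<open>Subtracting a lift \<open>(0, P b, \<zeta>')\<close> of \<open>P b\<close>
        into the kernel of \<open>f' p0\<close>, and then the \<open>Q\<close>-part, which is in the
        kernel as well, leaves a vector in the kernel of \<open>R\<close> with the same
        image.\<close>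
      have "P (P b) = P b" by (rule P(2))
      then obtain \<zeta>' where \<zeta>': "f' p0 (0, P b, \<zeta>') = 0" using PK by (auto simp: p0_def)
      define \<zeta>'' where "\<zeta>'' = \<zeta> - \<zeta>'"
      have q0: "f' p0 (0, 0, Q \<zeta>'') = 0" using Q(2) by (auto simp: Z_def)
      have "(0 :: 'a, u) = (0, P b, \<zeta>') + (0, 0, Q \<zeta>'') + (0, b - P b, \<zeta>'' - Q \<zeta>'')"
        by (simp add: u \<zeta>''_def)
      then have "f' p0 (0, u) = f' p0 (0, b - P b, \<zeta>'' - Q \<zeta>'')"
        by (simp only: linear_add[OF lin0] \<zeta>' q0) simp
      moreover have "R (0, b - P b, \<zeta>'' - Q \<zeta>'') = 0"
        by (simp add: linear_diff[OF P(1)] linear_diff[OF Q(1)] P(2) QQ zero_prod_def)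
      ultimately show ?thesis by blast
    qed
    have "range (\<lambda>u. f' p0 (0, u)) \<subseteq> f' p0 ` {u. R u = 0}"
      using in_im by (rule image_subsetI)
    then show ?thesis unfolding full by (rule subset_antisym[OF image_mono[OF subset_UNIV]])
  qed
  have rk: "dim (range (f' p)) = dim (range (f' p0))" if "p \<in> G" for p
    using rank[OF that] rank[OF G(2)] by (simp add: p0_def)
  obtain \<rho> \<Theta> \<Theta>' S where \<rho>: "\<rho> > 0" and S: "open S" "p0 \<in> S" "S \<subseteq> G" and \<Theta>0: "\<Theta> (R p0) = p0"
    and \<Theta>: "\<And>q. q \<in> ball (R p0) \<rho> \<Longrightarrow> R q = q \<Longrightarrow> \<Theta> q \<in> S \<and> f (\<Theta> q) = c \<and> R (\<Theta> q) = q"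
    and Sball: "\<And>p. p \<in> S \<Longrightarrow> R p \<in> ball (R p0) \<rho>"
    and \<Theta>R: "\<And>p. p \<in> S \<Longrightarrow> f p = c \<Longrightarrow> \<Theta> (R p) = p"
    and injS: "\<And>p. p \<in> S \<Longrightarrow> inj_on (f' p) {u. R u = 0}"
    and d\<Theta>: "\<And>q. q \<in> ball (R p0) \<rho> \<Longrightarrow> R q = q \<Longrightarrow> (\<Theta> has_derivative \<Theta>' q) (at q)"
    and \<Theta>': "\<And>q v. q \<in> ball (R p0) \<rho> \<Longrightarrow> R q = q \<Longrightarrow> R v = v \<Longrightarrow>
       R (\<Theta>' q v) = v \<and> f' (\<Theta> q) (\<Theta>' q v) = 0"
  proof (rule constant_rank_level_set[where f = f and f' = f' and R = R and c = c,
        OF G[folded p0_def] der cont[folded p0_def] rk linR RR inj0 ran0 f0[folded p0_def]])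
  qed (assumption+, rule that, assumption+)
  have kerS: "u = 0" if "p \<in> S" "R u = 0" "f' p u = 0" for p u
  proof -
    have "p \<in> G" using that(1) S(3) by blast
    then show ?thesis
      using inj_onD[OF injS[OF that(1)], of u 0] that linear_0[OF lin] linear_0[OF linR] by simp
  qed
  define w0 where "w0 = Q c0"
  have Rp0: "R p0 = (a0, P b0, w0)" by (simp add: p0_def w0_def)
  \<comment> \<open>The remaining latent coordinate is frozen at its value for the base point; by
    \<open>indep\<close> another value gives the same output.\<close>
  define \<Phi> where "\<Phi> = (\<lambda>(a, k). fst (snd (\<Theta> (a, k, w0))))"
  have slice0: "(a, b, w0) \<in> ball (R p0) \<rho>" if "(a, b, w) \<in> ball (R p0) \<rho>" for a b w
  proof -
    have "dist (R p0) (a, b, w0) \<le> dist (R p0) (a, b, w)"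
      by (simp add: Rp0 dist_Pair_Pair)
    then show ?thesis using that by simp
  qed
  \<comment> \<open>The partial derivative in \<open>z\<close> attains its range on the kernel of
    \<open>Q\<close>, again by equal rank. So \<open>(0, 0, w)\<close> can be corrected by some
    \<open>\<zeta>1\<close> with \<open>Q \<zeta>1 = 0\<close> to a kernel vector of
    \<open>f' p\<close> with zero \<open>y\<close>-part and the same image under \<open>R\<close>;
    and a kernel vector is determined by that image.\<close>
  have vert: "fst (snd (\<Theta>' q (0, 0, w))) = 0"
    if q: "q \<in> ball (R p0) \<rho>" "R q = q" and w: "Q w = w" for q w
  proof -
    define p where "p = \<Theta> q"
    have pS: "p \<in> S" using \<Theta>[OF q] by (simp add: p_def)
    then have pG: "p \<in> G" using S by blast
    define A0 where "A0 = (\<lambda>\<zeta>. f' p0 (0, 0, \<zeta>))"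
    define A where "A = (\<lambda>\<zeta>. f' p (0, 0, \<zeta>))"
    have lA0: "linear A0" and lA: "linear A"
      using linz[of p0] linz[of p] pG G(2) by (auto simp: A0_def A_def p0_def)
    have subQ: "subspace {\<zeta>. Q \<zeta> = 0}" by (rule linear_subspace_kernel[OF Q(1)])
    have iA: "inj_on A {\<zeta>. Q \<zeta> = 0}"
    proof -
      have "\<zeta> = 0" if "Q \<zeta> = 0" "A \<zeta> = 0" for \<zeta>
      proof -
        have "R (0, 0, \<zeta>) = 0" using that by (simp add: linear_0[OF P(1)] zero_prod_def)
        then have "(0, 0, \<zeta>) = (0 :: 'a \<times> 'b \<times> 'c)"
          using kerS[OF pS] that(2) by (simp add: A_def)
        then show ?thesis by (simp add: zero_prod_def)
      qed
      then show ?thesis using linear_inj_on_iff_eq_0[OF lA subQ] by auto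
    qed
    have iA0: "inj_on A0 {\<zeta>. Q \<zeta> = 0}"
    proof -
      have "\<zeta> = 0" if "Q \<zeta> = 0" "A0 \<zeta> = 0" for \<zeta>
        using Q(3)[of \<zeta>] that by (simp add: Z_def A0_def)
      then show ?thesis using linear_inj_on_iff_eq_0[OF lA0 subQ] by auto
    qed
    have rA0: "A0 ` {\<zeta>. Q \<zeta> = 0} = range A0"
    proof -
      have "A0 \<zeta> \<in> A0 ` {\<zeta>. Q \<zeta> = 0}" for \<zeta>
      proof -
        have "A0 (Q \<zeta>) = 0" using Q(2) by (auto simp: Z_def A0_def)
        then have "A0 \<zeta> = A0 (\<zeta> - Q \<zeta>)" by (simp add: linear_diff[OF lA0])
        moreover have "Q (\<zeta> - Q \<zeta>) = 0" by (simp add: linear_diff[OF Q(1)] QQ)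
        ultimately show ?thesis by blast
      qed
      then show ?thesis by blast
    qed
    have "dim (range A) = dim (range A0)"
      using rank_z[OF pG] rank_z[OF G(2)] by (simp add: A_def A0_def p0_def)
    from range_eq_if_rank_eq[OF lA lA0 subQ iA iA0 rA0 this]
    have "A w \<in> A ` {\<zeta>. Q \<zeta> = 0}" by simp
    then obtain \<zeta>1 where \<zeta>1: "Q \<zeta>1 = 0" "A w = A \<zeta>1" by auto
    define u where "u = (0 :: 'a, 0 :: 'b, w - \<zeta>1)"
    have "f' p u = 0" using \<zeta>1(2) linear_diff[OF lA, of w \<zeta>1] by (simp add: u_def A_def)
    have vw: "R (0, 0, w) = (0, 0, w)" by (simp add: w linear_0[OF P(1)])
    have Ru: "R u = (0, 0, w)" by (simp add: u_def linear_diff[OF Q(1)] \<zeta>1 w linear_0[OF P(1)])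
    define v where "v = \<Theta>' q (0, 0, w)"
    have v: "R v = (0, 0, w)" "f' p v = 0" using \<Theta>'[OF q vw] by (auto simp: v_def p_def)
    have "R (v - u) = 0" "f' p (v - u) = 0"
      using Ru v \<open>f' p u = 0\<close> by (auto simp: linear_diff[OF linR] linear_diff[OF lin[OF pG]])
    then have "v = u" using kerS[OF pS, of "v - u"] by simp
    then show ?thesis by (simp add: v_def[symmetric] u_def)
  qed
  have indep: "fst (snd (\<Theta> (a, k, w))) = \<Phi> (a, k)"
    if q: "(a, k, w) \<in> ball (R p0) \<rho>" and k: "P k = k" and w: "Q w = w" for a k w
  proof -
    define h where "h t = fst (snd (\<Theta> (a, k, w0 + t *\<^sub>R (w - w0))))" for t :: real
    have Qw0: "Q w0 = w0" by (simp add: w0_def QQ)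
    have inb: "(a, k, w0 + t *\<^sub>R (w - w0)) \<in> ball (R p0) \<rho>" if "t \<in> {0..1}" for t
    proof -
      have "(1 - t) *\<^sub>R (a, k, w0) + t *\<^sub>R (a, k, w) \<in> ball (R p0) \<rho>"
        using that q slice0[OF q] by (intro convexD[OF convex_ball]) auto
      then show ?thesis by (simp add: algebra_simps)
    qed
    have "(h has_derivative (\<lambda>s. 0)) (at t within {0..1})" if t: "t \<in> {0..1}" for t
    proof -
      define q where "q = (a, k, w0 + t *\<^sub>R (w - w0))"
      have q: "q \<in> ball (R p0) \<rho>" "R q = q"
        using inb[OF t] by (auto simp: q_def k w Qw0 linear_add[OF Q(1)] linear_cmul[OF Q(1)] linear_diff[OF Q(1)])
      have "((\<lambda>t. (a, k, w0 + t *\<^sub>R (w - w0))) has_derivative (\<lambda>s. (0, 0, s *\<^sub>R (w - w0)))) (at t within {0..1})"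
        by (auto intro!: derivative_eq_intros)
      then have "((\<lambda>t. \<Theta> (a, k, w0 + t *\<^sub>R (w - w0))) has_derivative
          (\<lambda>s. \<Theta>' q (0, 0, s *\<^sub>R (w - w0)))) (at t within {0..1})"
        by (rule has_derivative_compose) (use d\<Theta>[OF q] in \<open>simp add: q_def\<close>)
      then have "(h has_derivative (\<lambda>s. fst (snd (\<Theta>' q (0, 0, s *\<^sub>R (w - w0)))))) (at t within {0..1})"
        unfolding h_def by (intro has_derivative_fst has_derivative_snd)
      moreover have "fst (snd (\<Theta>' q (0, 0, s *\<^sub>R (w - w0)))) = 0" for s
        by (rule vert[OF q]) (simp add: w Qw0 linear_cmul[OF Q(1)] linear_diff[OF Q(1)])
      ultimately show ?thesis by simp
    qed
    then obtain C where "\<And>t. t \<in> {0..1} \<Longrightarrow> h t = C"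
      using has_derivative_zero_constant[of "{0..1::real}" h] by auto
    then have "h 1 = h 0" by simp
    then show ?thesis by (simp add: h_def \<Phi>_def)
  qed
  have blP: "bounded_linear P" using P(1) by (rule linear_imp_bounded_linear)
  have "(a0, b0, c0) \<in> S" using S(2) by (simp add: p0_def)
  \<comment> \<open>A box inside \<open>S\<close> separates the latent neighbourhood
    \<open>N\<close> from the neighbourhood \<open>A \<times> B\<close> in input and output
    coordinates.\<close>
  with S(1) obtain A B' where A: "open A" "open B'" "a0 \<in> A" "(b0, c0) \<in> B'" "A \<times> B' \<subseteq> S"
    by (rule open_prod_elim) (simp add: that)
  from A(2,4) obtain B N where B: "open B" "open N" "b0 \<in> B" "c0 \<in> N" "B \<times> N \<subseteq> B'"
    by (rule open_prod_elim) (simp add: that)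
  have box: "(a, b, \<zeta>) \<in> S" if "(a, b) \<in> A \<times> B" "\<zeta> \<in> N" for a b \<zeta>
    using that A(5) B(5) by blast
  define J where "J = {x. (fst x, snd x, w0) \<in> ball (R p0) \<rho>}"
  have Rfix: "R (a, k, w0) = (a, k, w0)" if "P k = k" for a k
    using that by (simp add: w0_def QQ)
  have d\<Phi>: "(\<Phi> has_derivative (\<lambda>v. fst (snd (\<Theta>' (a, k, w0) (fst v, snd v, 0))))) (at (a, k))"
    if "(a, k) \<in> J" "P k = k" for a k
  proof -
    have "((\<lambda>x. (fst x, snd x, w0)) has_derivative (\<lambda>v. (fst v, snd v, 0))) (at (a, k))"
      by (auto intro!: derivative_eq_intros)
    then have "((\<lambda>x. \<Theta> (fst x, snd x, w0)) has_derivative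
        (\<lambda>v. \<Theta>' (a, k, w0) (fst v, snd v, 0))) (at (a, k))"
      by (rule has_derivative_compose) (use d\<Theta>[OF _ Rfix[OF that(2)]] that(1) in \<open>simp add: J_def\<close>)
    then show ?thesis
      unfolding \<Phi>_def case_prod_beta' by (intro has_derivative_fst has_derivative_snd)
  qed
  have J0: "(a0, P b0) \<in> J" using \<rho> by (simp add: J_def Rp0)
  define \<Phi>' where "\<Phi>' = (\<lambda>v. fst (snd (\<Theta>' (a0, P b0, w0) (fst v, snd v, 0))))"
  show thesis
  proof (rule that[of N "A \<times> B" J \<Phi> \<Phi>'])
    show "open N" "c0 \<in> N" "open (A \<times> B)" "(a0, b0) \<in> A \<times> B" "(a0, P b0) \<in> J"
      using A B J0 by (auto intro: open_Times)
    have "J = (\<lambda>x. (fst x, snd x, w0)) -` ball (R p0) \<rho>" by (auto simp: J_def)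
    then show "open J" by (auto intro!: open_vimage continuous_intros)
    show "b = \<Phi> (a, P b)" if "(a, b) \<in> A \<times> B" "\<zeta> \<in> N" "f (a, b, \<zeta>) = c" for a b \<zeta>
    proof -
      have s: "(a, b, \<zeta>) \<in> S" using box that by blast
      have "\<Theta> (a, P b, Q \<zeta>) = (a, b, \<zeta>)" using \<Theta>R[OF s that(3)] by simp
      moreover have "(a, P b, Q \<zeta>) \<in> ball (R p0) \<rho>" using Sball[OF s] by simp
      ultimately show ?thesis using indep[of a "P b" "Q \<zeta>"] P(2) QQ by simp
    qed
    show "\<Phi> (a0, P b0) = b0" using \<Theta>0 unfolding Rp0 by (simp add: \<Phi>_def p0_def)
    show "isCont \<Phi> (a, k) \<and> P (\<Phi> (a, k)) = k" if "(a, k) \<in> J" "P k = k" for a k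
    proof
      show "isCont \<Phi> (a, k)" using d\<Phi>[OF that] has_derivative_continuous by blast
      have "R (\<Theta> (a, k, w0)) = (a, k, w0)"
        using \<Theta>[OF _ Rfix[OF that(2)], of a] that(1) by (simp add: J_def)
      then show "P (\<Phi> (a, k)) = k" by (cases "\<Theta> (a, k, w0)") (simp add: \<Phi>_def)
    qed
    show "(\<Phi> has_derivative \<Phi>') (at (a0, P b0))"
      unfolding \<Phi>'_def by (rule d\<Phi>[OF J0 P(2)])
    show "P (\<Phi>' (a, k)) = k \<and> (\<exists>\<zeta>. f' (a0, b0, c0) (a, \<Phi>' (a, k), \<zeta>) = 0)" if "P k = k" for a k
    proof -
      have "R (a, k, 0) = (a, k, 0)" by (simp add: that linear_0[OF Q(1)])
      moreover have "(a0, P b0, w0) \<in> ball (R p0) \<rho>" "R (a0, P b0, w0) = (a0, P b0, w0)"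
        using J0 by (auto simp: J_def P(2) w0_def QQ)
      ultimately have *: "R (\<Theta>' (a0, P b0, w0) (a, k, 0)) = (a, k, 0)"
          "f' (\<Theta> (a0, P b0, w0)) (\<Theta>' (a0, P b0, w0) (a, k, 0)) = 0"
        using \<Theta>' by blast+
      obtain a' b' \<zeta>' where v: "\<Theta>' (a0, P b0, w0) (a, k, 0) = (a', b', \<zeta>')"
        by (cases "\<Theta>' (a0, P b0, w0) (a, k, 0)")
      have "\<Theta> (a0, P b0, w0) = (a0, b0, c0)" using \<Theta>0 unfolding Rp0 by (simp add: p0_def)
      then show ?thesis using * v by (auto simp: \<Phi>'_def)
    qed
    show "\<forall>\<^sub>F (a, b) in nhds (a0, b0). b = \<Phi> (a, P b) \<longrightarrow>
        (\<exists>\<zeta>\<in>M. (a, b, \<zeta>) \<in> G \<and> f (a, b, \<zeta>) = c)" if M: "open M" "c0 \<in> M" for M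
    proof -
      \<comment> \<open>\<open>\<Theta> (q x)\<close> is a solution that depends continuously on
        \<open>x\<close> at the base point, where it equals \<open>p0\<close>; so its latent
        component enters every \<open>M\<close>.\<close>
      define q where "q x = (fst x, P (snd x), w0)" for x :: "'a \<times> 'b"
      have q0: "q (a0, b0) = R p0" by (simp add: q_def Rp0)
      have cq: "isCont q (a0, b0)"
        unfolding q_def by (intro continuous_intros bounded_linear.isCont[OF blP])
      have "isCont \<Theta> (R p0)"
        using d\<Theta>[of "R p0"] \<rho> RR has_derivative_continuous by simp blast
      then have "isCont (\<lambda>x. \<Theta> (q x)) (a0, b0)"
        using isCont_o2[OF cq] q0 by simp
      then have "((\<lambda>x. \<Theta> (q x)) \<longlongrightarrow> p0) (nhds (a0, b0))"
        using tendsto_at_iff_tendsto_nhds[of "\<lambda>x. \<Theta> (q x)" "(a0, b0)"] by (simp only: isCont_def q0 \<Theta>0)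
      from tendsto_snd[OF tendsto_snd[OF this]]
      have "((\<lambda>x. snd (snd (\<Theta> (q x)))) \<longlongrightarrow> c0) (nhds (a0, b0))"
        by (simp add: p0_def)
      then have ev1: "\<forall>\<^sub>F x in nhds (a0, b0). snd (snd (\<Theta> (q x))) \<in> M"
        using M by (rule topological_tendstoD)
      have "(q \<longlongrightarrow> R p0) (nhds (a0, b0))"
        using cq tendsto_at_iff_tendsto_nhds[of q "(a0, b0)"] by (simp only: isCont_def q0)
      then have ev2: "\<forall>\<^sub>F x in nhds (a0, b0). q x \<in> ball (R p0) \<rho>"
        using \<rho> by (intro topological_tendstoD) auto
      from ev1 ev2 show ?thesis
      proof eventually_elim
        case (elim x)
        obtain a b where x: "x = (a, b)" by (cases x)
        have "R (q x) = q x" by (simp add: q_def P(2) w0_def QQ)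
        from \<Theta>[OF elim(2) this] have t: "\<Theta> (q x) \<in> S" "f (\<Theta> (q x)) = c" "R (\<Theta> (q x)) = q x" by auto
        obtain a' b' \<zeta> where v: "\<Theta> (q x) = (a', b', \<zeta>)" by (cases "\<Theta> (q x)")
        have "a' = a" using t(3) v by (simp add: q_def x)
        have "b' = \<Phi> (a, P b)" using v by (simp add: \<Phi>_def q_def x)
        moreover have "(a', b', \<zeta>) \<in> G" "f (a', b', \<zeta>) = c" "\<zeta> \<in> M"
          using t v elim(1) S(3) by auto
        ultimately show ?case using x \<open>a' = a\<close> by auto
      qed
    qed
  qed
qed


section \<open>Charts and tangent spaces\<close>

lemma is_chartD:
  assumes "is_chart \<kappa>"
  shows is_chart_open: "open (fst \<kappa>)" "open (snd \<kappa> ` fst \<kappa>)"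
    and is_chart_inj: "inj_on (snd \<kappa>) (fst \<kappa>)"
    and is_chart_cont: "continuous_on (fst \<kappa>) (snd \<kappa>)"
    and is_chart_cont_inv: "continuous_on (snd \<kappa> ` fst \<kappa>) (chart_inv \<kappa>)"
    and is_chart_inv: "p \<in> fst \<kappa> \<Longrightarrow> chart_inv \<kappa> (snd \<kappa> p) = p"
    and is_chart_inv_in: "s \<in> snd \<kappa> ` fst \<kappa> \<Longrightarrow> chart_inv \<kappa> s \<in> fst \<kappa>"
    and is_chart_inv_right: "s \<in> snd \<kappa> ` fst \<kappa> \<Longrightarrow> snd \<kappa> (chart_inv \<kappa> s) = s"
proof -
  have h: "homeomorphism (fst \<kappa>) (snd \<kappa> ` fst \<kappa>) (snd \<kappa>) (chart_inv \<kappa>)"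
    using assms by (simp add: is_chart_def)
  then have inv: "\<And>x. x \<in> fst \<kappa> \<Longrightarrow> chart_inv \<kappa> (snd \<kappa> x) = x"
    by (auto simp: homeomorphism_def)
  show "open (fst \<kappa>)" "open (snd \<kappa> ` fst \<kappa>)" using assms by (auto simp: is_chart_def)
  show "inj_on (snd \<kappa>) (fst \<kappa>)" using inv by (rule inj_on_inverseI)
  show "continuous_on (fst \<kappa>) (snd \<kappa>)" "continuous_on (snd \<kappa> ` fst \<kappa>) (chart_inv \<kappa>)"
    using h by (auto simp: homeomorphism_def)
  show "p \<in> fst \<kappa> \<Longrightarrow> chart_inv \<kappa> (snd \<kappa> p) = p" by (rule inv)
  show "s \<in> snd \<kappa> ` fst \<kappa> \<Longrightarrow> chart_inv \<kappa> s \<in> fst \<kappa>"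
    "s \<in> snd \<kappa> ` fst \<kappa> \<Longrightarrow> snd \<kappa> (chart_inv \<kappa> s) = s" using inv by auto
qed

lemma is_chart_isCont:
  assumes "is_chart \<kappa>" "p \<in> fst \<kappa>"
  shows "isCont (snd \<kappa>) p" "isCont (chart_inv \<kappa>) (snd \<kappa> p)"
  using assms is_chart_cont[OF assms(1)] is_chart_cont_inv[OF assms(1)] is_chart_open[OF assms(1)]
  by (auto simp: continuous_on_eq_continuous_at)

lemma eventually_in_chart:
  "is_chart \<kappa> \<Longrightarrow> p \<in> fst \<kappa> \<Longrightarrow> \<forall>\<^sub>F x in nhds p. x \<in> fst \<kappa>"
  by (rule eventually_nhds_in_open[OF is_chart_open(1)])

lemma eventually_in_chart_image:
  "is_chart \<kappa> \<Longrightarrow> p \<in> fst \<kappa> \<Longrightarrow> \<forall>\<^sub>F s in nhds (snd \<kappa> p). s \<in> snd \<kappa> ` fst \<kappa>"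
  by (rule eventually_nhds_in_open[OF is_chart_open(2) imageI])

text \<open>Weaker than \<open>smooth_manifold\<close>. Differentiable transition maps carry the
  calculus of tangent vectors, and the property passes to product atlases by the chain rule at a
  point.\<close>

definition diff_atlas :: "('m::t2_space, 'e::real_normed_vector) chart set \<Rightarrow> bool" where
  "diff_atlas A \<longleftrightarrow> (\<forall>\<kappa>\<in>A. is_chart \<kappa>) \<and> (\<Union>\<kappa>\<in>A. fst \<kappa>) = UNIV \<and>
     (\<forall>\<kappa>\<in>A. \<forall>\<mu>\<in>A. \<forall>p\<in>fst \<kappa> \<inter> fst \<mu>. (snd \<mu> \<circ> chart_inv \<kappa>) differentiable (at (snd \<kappa> p)))"

lemma smooth_onD: "smooth_on S f \<Longrightarrow> x \<in> S \<Longrightarrow> f differentiable (at x)"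
  "smooth_on S f \<Longrightarrow> continuous_on S (\<lambda>x. frechet_derivative f (at x) v)"
  by (auto simp: smooth_on_def dest: spec[of _ 1])

lemma smooth_manifold_imp_diff_atlas: "smooth_manifold A \<Longrightarrow> diff_atlas A"
  unfolding smooth_manifold_def diff_atlas_def by (blast intro: smooth_onD(1))

section \<open>Tangent vectors and differentials in charts\<close>

abbreviation chart_change ::
    "('m, 'e::real_normed_vector) chart \<Rightarrow> ('m, 'e) chart \<Rightarrow> 'm \<Rightarrow> 'e \<Rightarrow> 'e" where
  "chart_change \<kappa> \<mu> p \<equiv> frechet_derivative (snd \<mu> \<circ> chart_inv \<kappa>) (at (snd \<kappa> p))"

lemma charts_at_chart: "diff_atlas A \<Longrightarrow> \<kappa> \<in> charts_at A p \<Longrightarrow> is_chart \<kappa> \<and> p \<in> fst \<kappa>"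
  by (auto simp: diff_atlas_def charts_at_def)

lemma charts_at_nonempty: "diff_atlas A \<Longrightarrow> \<exists>\<kappa>. \<kappa> \<in> charts_at A p"
  unfolding diff_atlas_def charts_at_def by blast

lemma chart_change_derivative:
  assumes "diff_atlas A" "\<kappa> \<in> charts_at A p" "\<mu> \<in> charts_at A p"
  shows "(snd \<mu> \<circ> chart_inv \<kappa> has_derivative chart_change \<kappa> \<mu> p) (at (snd \<kappa> p))"
  using assms unfolding diff_atlas_def charts_at_def by (auto simp: frechet_derivative_works)

lemma eventually_chart_inv:
  fixes \<kappa> :: "('m::t2_space, 'e::real_normed_vector) chart"
  assumes "is_chart \<kappa>" "p \<in> fst \<kappa>" "\<forall>\<^sub>F x in nhds p. Q x"
  shows "\<forall>\<^sub>F s in nhds (snd \<kappa> p). s \<in> snd \<kappa> ` fst \<kappa> \<and> Q (chart_inv \<kappa> s)"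
proof (rule eventually_conj)
  show "\<forall>\<^sub>F s in nhds (snd \<kappa> p). s \<in> snd \<kappa> ` fst \<kappa>"
    using assms is_chart_open[OF assms(1)] by (intro eventually_nhds_in_open) auto
  have "(chart_inv \<kappa> \<longlongrightarrow> p) (nhds (snd \<kappa> p))"
    using is_chart_isCont(2)[OF assms(1,2)] tendsto_at_iff_tendsto_nhds[of "chart_inv \<kappa>" "snd \<kappa> p"]
    by (simp add: isCont_def is_chart_inv[OF assms(1,2)])
  then show "\<forall>\<^sub>F s in nhds (snd \<kappa> p). Q (chart_inv \<kappa> s)"
    using assms(3) by (simp add: filterlim_iff)
qed

lemma eventually_chart:
  fixes \<kappa> :: "('m::t2_space, 'e::real_normed_vector) chart"
  assumes "is_chart \<kappa>" "p \<in> fst \<kappa>" "\<forall>\<^sub>F s in nhds (snd \<kappa> p). Q s"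
  shows "\<forall>\<^sub>F x in nhds p. x \<in> fst \<kappa> \<and> Q (snd \<kappa> x)"
proof (rule eventually_conj)
  show "\<forall>\<^sub>F x in nhds p. x \<in> fst \<kappa>"
    using assms is_chart_open[OF assms(1)] by (intro eventually_nhds_in_open) auto
  have "(snd \<kappa> \<longlongrightarrow> snd \<kappa> p) (nhds p)"
    using is_chart_isCont(1)[OF assms(1,2)] tendsto_at_iff_tendsto_nhds[of "snd \<kappa>" p]
    by (simp add: isCont_def)
  then show "\<forall>\<^sub>F x in nhds p. Q (snd \<kappa> x)"
    using assms(3) by (simp add: filterlim_iff)
qed

lemma isCont_eventually_nhds:
  assumes "isCont f p" "\<forall>\<^sub>F y in nhds (f p). Q y"
  shows "\<forall>\<^sub>F x in nhds p. Q (f x)"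
proof -
  have "(f \<longlongrightarrow> f p) (nhds p)"
    using assms(1) tendsto_at_iff_tendsto_nhds[of f p] by (simp add: isCont_def)
  then show ?thesis using assms(2) by (simp add: filterlim_iff)
qed

lemma has_derivative_nhds_cong:
  assumes "(f has_derivative f') (at x)" "\<forall>\<^sub>F y in nhds x. f y = g y"
  shows "(g has_derivative f') (at x)"
proof -
  obtain S where "open S" "x \<in> S" "\<And>y. y \<in> S \<Longrightarrow> f y = g y"
    using assms(2) by (auto simp: eventually_nhds)
  then show ?thesis using has_derivative_transform_within_open[OF assms(1)] by blast
qed

text \<open>The chain rule for three coordinate maps. Their composition equals the new
  representation only where the intermediate chart domains are met, so the derivative is carried
  over along an equality near the point; continuity of \<open>f\<close> provides the
  neighbourhood.\<close>

lemma coordinate_change: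
  assumes A: "diff_atlas A" and B: "diff_atlas B" and f: "isCont f p"
    and \<kappa>: "\<kappa> \<in> charts_at A p" "\<kappa>' \<in> charts_at A p"
    and \<mu>: "\<mu> \<in> charts_at B (f p)" "\<mu>' \<in> charts_at B (f p)"
    and L: "(snd \<mu> \<circ> f \<circ> chart_inv \<kappa> has_derivative L) (at (snd \<kappa> p))"
  shows "(snd \<mu>' \<circ> f \<circ> chart_inv \<kappa>' has_derivative
    (\<lambda>a. chart_change \<mu> \<mu>' (f p) (L (chart_change \<kappa>' \<kappa> p a)))) (at (snd \<kappa>' p))"
proof -
  note k = charts_at_chart[OF A \<kappa>(1)] and k' = charts_at_chart[OF A \<kappa>(2)]
  note m = charts_at_chart[OF B \<mu>(1)] and m' = charts_at_chart[OF B \<mu>(2)]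
  have p: "chart_inv \<kappa> (snd \<kappa> p) = p" "chart_inv \<kappa>' (snd \<kappa>' p) = p"
    using k k' by (auto simp: is_chart_inv)
  have 1: "(snd \<kappa> \<circ> chart_inv \<kappa>' has_derivative chart_change \<kappa>' \<kappa> p) (at (snd \<kappa>' p))"
    by (rule chart_change_derivative[OF A \<kappa>(2,1)])
  have 2: "((\<lambda>s. (snd \<mu> \<circ> f \<circ> chart_inv \<kappa>) ((snd \<kappa> \<circ> chart_inv \<kappa>') s)) has_derivative
      (\<lambda>a. L (chart_change \<kappa>' \<kappa> p a))) (at (snd \<kappa>' p))"
    by (rule has_derivative_compose[OF 1]) (use L p in \<open>simp add: o_def\<close>)
  have 3: "((\<lambda>s. (snd \<mu>' \<circ> chart_inv \<mu>) ((snd \<mu> \<circ> f \<circ> chart_inv \<kappa>) ((snd \<kappa> \<circ> chart_inv \<kappa>') s)))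
      has_derivative (\<lambda>a. chart_change \<mu> \<mu>' (f p) (L (chart_change \<kappa>' \<kappa> p a)))) (at (snd \<kappa>' p))"
    by (rule has_derivative_compose[OF 2]) (use chart_change_derivative[OF B \<mu>] p in \<open>simp add: o_def\<close>)
  have "\<forall>\<^sub>F x in nhds (f p). x \<in> fst \<mu>"
    using m by (blast intro: eventually_in_chart)
  then have "\<forall>\<^sub>F x in nhds p. f x \<in> fst \<mu>" by (rule isCont_eventually_nhds[OF f])
  moreover have "\<forall>\<^sub>F x in nhds p. x \<in> fst \<kappa>"
    using k by (blast intro: eventually_in_chart)
  ultimately have "\<forall>\<^sub>F x in nhds p. x \<in> fst \<kappa> \<and> f x \<in> fst \<mu>" by (simp add: eventually_conj)
  from eventually_chart_inv[OF k'[THEN conjunct1] k'[THEN conjunct2] this]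
  have "\<forall>\<^sub>F s in nhds (snd \<kappa>' p).
     (snd \<mu>' \<circ> chart_inv \<mu>) ((snd \<mu> \<circ> f \<circ> chart_inv \<kappa>) ((snd \<kappa> \<circ> chart_inv \<kappa>') s)) =
     (snd \<mu>' \<circ> f \<circ> chart_inv \<kappa>') s"
    by eventually_elim (use k m in \<open>simp add: is_chart_inv\<close>)
  then show ?thesis by (rule has_derivative_nhds_cong[OF 3])
qed

lemma chart_change_refl:
  assumes A: "diff_atlas A" and \<kappa>: "\<kappa> \<in> charts_at A p"
  shows "chart_change \<kappa> \<kappa> p a = a"
proof -
  note k = charts_at_chart[OF A \<kappa>]
  have "\<forall>\<^sub>F s in nhds (snd \<kappa> p). s = (snd \<kappa> \<circ> chart_inv \<kappa>) s"
    using eventually_chart_inv[of \<kappa> p "\<lambda>_. True"] k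
    by (auto elim!: eventually_mono simp: is_chart_inv_right)
  then have "(snd \<kappa> \<circ> chart_inv \<kappa> has_derivative (\<lambda>a. a)) (at (snd \<kappa> p))"
    by (rule has_derivative_nhds_cong[OF has_derivative_ident])
  then have "(\<lambda>a. a) = chart_change \<kappa> \<kappa> p" by (rule frechet_derivative_at)
  then show ?thesis by metis
qed

lemma chart_change_trans:
  assumes A: "diff_atlas A" and c: "\<kappa> \<in> charts_at A p" "\<mu> \<in> charts_at A p" "\<nu> \<in> charts_at A p"
  shows "chart_change \<mu> \<nu> p (chart_change \<kappa> \<mu> p a) = chart_change \<kappa> \<nu> p a"
proof -
  have "(snd \<nu> \<circ> (\<lambda>x. x) \<circ> chart_inv \<kappa> has_derivative
    (\<lambda>a. chart_change \<mu> \<nu> p (chart_change \<kappa> \<mu> p (chart_change \<kappa> \<kappa> p a)))) (at (snd \<kappa> p))"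
    using chart_change_derivative[OF A c(1,2)] c
    by (intro coordinate_change[OF A A]) (auto simp: o_def)
  then have "(snd \<nu> \<circ> chart_inv \<kappa> has_derivative
    (\<lambda>a. chart_change \<mu> \<nu> p (chart_change \<kappa> \<mu> p a))) (at (snd \<kappa> p))"
    unfolding chart_change_refl[OF A c(1)] by (simp add: o_def)
  from frechet_derivative_at[OF this] show ?thesis by metis
qed

lemma linear_chart_change:
  "diff_atlas A \<Longrightarrow> \<kappa> \<in> charts_at A p \<Longrightarrow> \<mu> \<in> charts_at A p \<Longrightarrow> linear (chart_change \<kappa> \<mu> p)"
  by (rule has_derivative_linear[OF chart_change_derivative])

lemma coord_vector_same:
  "diff_atlas A \<Longrightarrow> \<kappa> \<in> charts_at A p \<Longrightarrow> coord_vector A p \<kappa> a \<kappa> = a"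
  by (simp add: coord_vector_def chart_change_refl)

lemma coord_vector_in_tangent_space:
  "diff_atlas A \<Longrightarrow> \<kappa> \<in> charts_at A p \<Longrightarrow> coord_vector A p \<kappa> a \<in> tangent_space A p"
  by (auto simp: tangent_space_def coord_vector_def chart_change_trans)

lemma tangent_spaceD:
  assumes "v \<in> tangent_space A p"
  shows "\<kappa> \<in> charts_at A p \<Longrightarrow> \<mu> \<in> charts_at A p \<Longrightarrow> chart_change \<kappa> \<mu> p (v \<kappa>) = v \<mu>"
    and "\<kappa> \<notin> charts_at A p \<Longrightarrow> v \<kappa> = 0"
  using assms unfolding tangent_space_def mem_Collect_eq by metis+

lemma tangent_space_coord:
  assumes "\<kappa> \<in> charts_at A p" "v \<in> tangent_space A p"
  shows "coord_vector A p \<kappa> (v \<kappa>) = v"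
proof
  show "coord_vector A p \<kappa> (v \<kappa>) \<mu> = v \<mu>" for \<mu>
    using tangent_spaceD(1)[OF assms(2,1), of \<mu>] tangent_spaceD(2)[OF assms(2), of \<mu>]
    unfolding coord_vector_def by presburger
qed

lemma linear_coord_vector:
  assumes "diff_atlas A" "\<kappa> \<in> charts_at A p"
  shows "linear (coord_vector A p \<kappa>)"
  using linear_chart_change[OF assms]
  by (intro linearI) (auto simp: coord_vector_def fun_eq_iff scaleR_fun_def linear_add linear_cmul)

lemma tangent_space_eq_range:
  assumes "diff_atlas A" "\<kappa> \<in> charts_at A p"
  shows "tangent_space A p = range (coord_vector A p \<kappa>)"
  using coord_vector_in_tangent_space[OF assms] tangent_space_coord[OF assms(2), symmetric] by blast

lemma subspace_tangent_space: "diff_atlas A \<Longrightarrow> subspace (tangent_space A p)"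
proof -
  assume A: "diff_atlas A"
  from charts_at_nonempty[OF A] obtain \<kappa> where \<kappa>: "\<kappa> \<in> charts_at A p" by blast
  show ?thesis unfolding tangent_space_eq_range[OF A \<kappa>]
    by (intro linear_subspace_image linear_coord_vector[OF A \<kappa>] subspace_UNIV)
qed

text \<open>\<open>differential\<close> is defined with a chart picked by \<open>SOME\<close>; this
  frees it from that choice, so that all derivatives can be computed in charts fixed in
  advance.\<close>

lemma differential_coord:
  assumes A: "diff_atlas A" and B: "diff_atlas B" and f: "isCont f p"
    and \<kappa>: "\<kappa> \<in> charts_at A p" and \<mu>: "\<mu> \<in> charts_at B (f p)"
    and L: "(snd \<mu> \<circ> f \<circ> chart_inv \<kappa> has_derivative L) (at (snd \<kappa> p))"
  shows "differentiable_map_at A B f p"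
    and "v \<in> tangent_space A p \<Longrightarrow> differential A B f p v = coord_vector B (f p) \<mu> (L (v \<kappa>))"
proof -
  show "differentiable_map_at A B f p"
    unfolding differentiable_map_at_def differentiable_def
    using f coordinate_change[OF A B f \<kappa> _ \<mu> _ L] by blast
  assume v: "v \<in> tangent_space A p"
  define \<kappa>' where "\<kappa>' = (SOME \<kappa>. \<kappa> \<in> charts_at A p)"
  have \<kappa>': "\<kappa>' \<in> charts_at A p" unfolding \<kappa>'_def by (rule someI[of "\<lambda>\<kappa>. \<kappa> \<in> charts_at A p", OF \<kappa>])
  have "frechet_derivative (snd \<mu>' \<circ> f \<circ> chart_inv \<kappa>') (at (snd \<kappa>' p)) (v \<kappa>') =
      chart_change \<mu> \<mu>' (f p) (L (v \<kappa>))" if "\<mu>' \<in> charts_at B (f p)" for \<mu>'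
  proof -
    have "chart_change \<kappa>' \<kappa> p (v \<kappa>') = v \<kappa>"
      by (rule tangent_spaceD(1)[OF v \<kappa>' \<kappa>])
    moreover have "frechet_derivative (snd \<mu>' \<circ> f \<circ> chart_inv \<kappa>') (at (snd \<kappa>' p)) =
      (\<lambda>a. chart_change \<mu> \<mu>' (f p) (L (chart_change \<kappa>' \<kappa> p a)))"
      by (rule frechet_derivative_at[symmetric, OF coordinate_change[OF A B f \<kappa> \<kappa>' \<mu> that L]])
    ultimately show ?thesis by simp
  qed
  then show "differential A B f p v = coord_vector B (f p) \<mu> (L (v \<kappa>))"
    by (auto simp: differential_def Let_def coord_vector_def \<kappa>'_def[symmetric])
qed

text \<open>\<open>coord_vector\<close> is a linear isomorphism onto the tangent space, so the
  dimension of the image can be counted in coordinates.\<close>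

lemma rank_at_coord:
  fixes B :: "('n::t2_space, 'f::finite_dim_inner) chart set"
  assumes A: "diff_atlas A" and B: "diff_atlas B" and f: "isCont f p"
    and \<kappa>: "\<kappa> \<in> charts_at A p" and \<mu>: "\<mu> \<in> charts_at B (f p)"
    and L: "(snd \<mu> \<circ> f \<circ> chart_inv \<kappa> has_derivative L) (at (snd \<kappa> p))"
  shows "rank_at A B f p = dim (range L)"
proof -
  have "differential A B f p ` tangent_space A p = coord_vector B (f p) \<mu> ` range L"
  proof -
    have "differential A B f p (coord_vector A p \<kappa> a) = coord_vector B (f p) \<mu> (L a)" for a
      using differential_coord(2)[OF A B f \<kappa> \<mu> L coord_vector_in_tangent_space[OF A \<kappa>]]
      by (simp add: coord_vector_same[OF A \<kappa>])
    then show ?thesis by (simp add: tangent_space_eq_range[OF A \<kappa>] image_image)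
  qed
  moreover have "dim (coord_vector B (f p) \<mu> ` range L) = dim (range L)"
  proof (rule dim_linear_image[OF linear_coord_vector[OF B \<mu>]])
    show "subspace (range L)"
      using has_derivative_linear[OF L] by (intro linear_subspace_image subspace_UNIV)
    show "inj_on (coord_vector B (f p) \<mu>) (range L)"
      using coord_vector_same[OF B \<mu>] by (metis inj_onI)
  qed
  ultimately show ?thesis by (simp add: rank_at_def)
qed

section \<open>Products of charts\<close>

lemma prod_chart_simps [simp]:
  "fst (prod_chart \<kappa> \<mu>) = fst \<kappa> \<times> fst \<mu>"
  "snd (prod_chart \<kappa> \<mu>) (x, y) = (snd \<kappa> x, snd \<mu> y)"
  by (simp_all add: prod_chart_def)

lemma prod_chart_image: "snd (prod_chart \<kappa> \<mu>) ` fst (prod_chart \<kappa> \<mu>) = snd \<kappa> ` fst \<kappa> \<times> snd \<mu> ` fst \<mu>"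
  by (auto simp: prod_chart_def map_prod_def image_iff)

lemma prod_chart_inv:
  assumes "is_chart \<kappa>" "is_chart \<mu>" "s \<in> snd \<kappa> ` fst \<kappa>" "t \<in> snd \<mu> ` fst \<mu>"
  shows "chart_inv (prod_chart \<kappa> \<mu>) (s, t) = (chart_inv \<kappa> s, chart_inv \<mu> t)"
proof -
  have "inj_on (snd (prod_chart \<kappa> \<mu>)) (fst (prod_chart \<kappa> \<mu>))"
    using is_chart_inj[OF assms(1)] is_chart_inj[OF assms(2)]
    by (auto simp: inj_on_def)
  then show ?thesis
    unfolding chart_inv_def[of "prod_chart \<kappa> \<mu>"]
    using assms by (intro inv_into_f_eq) (auto simp: is_chart_inv)
qed

lemma is_chart_prod:
  assumes "is_chart \<kappa>" "is_chart \<mu>"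
  shows "is_chart (prod_chart \<kappa> \<mu>)"
proof -
  let ?p = "prod_chart \<kappa> \<mu>"
  note k = is_chart_open[OF assms(1)] is_chart_open[OF assms(2)]
  have im: "snd ?p ` fst ?p = snd \<kappa> ` fst \<kappa> \<times> snd \<mu> ` fst \<mu>" by (rule prod_chart_image)
  have c1: "continuous_on (fst ?p) (snd ?p)"
  proof -
    have "continuous_on (fst \<kappa> \<times> fst \<mu>) (\<lambda>x. (snd \<kappa> (fst x), snd \<mu> (snd x)))"
      by (intro continuous_on_Pair continuous_on_compose2[OF is_chart_cont[OF assms(1)]]
          continuous_on_compose2[OF is_chart_cont[OF assms(2)]] continuous_intros) auto
    then show ?thesis by (simp add: prod_chart_def map_prod_def case_prod_beta')
  qed
  have c2: "continuous_on (snd ?p ` fst ?p) (chart_inv ?p)"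
  proof -
    have "continuous_on (snd \<kappa> ` fst \<kappa> \<times> snd \<mu> ` fst \<mu>) (\<lambda>x. (chart_inv \<kappa> (fst x), chart_inv \<mu> (snd x)))"
      by (intro continuous_on_Pair continuous_on_compose2[OF is_chart_cont_inv[OF assms(1)]]
          continuous_on_compose2[OF is_chart_cont_inv[OF assms(2)]] continuous_intros) auto
    then show ?thesis unfolding im
      by (rule continuous_on_eq) (auto simp: prod_chart_inv[OF assms])
  qed
  have "homeomorphism (fst ?p) (snd ?p ` fst ?p) (snd ?p) (chart_inv ?p)"
  proof (rule homeomorphismI[OF c1 c2])
    show "chart_inv ?p ` snd ?p ` fst ?p \<subseteq> fst ?p"
      unfolding im using assms by (auto simp: prod_chart_inv is_chart_inv)
    show "chart_inv ?p (snd ?p x) = x" if "x \<in> fst ?p" for x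
      using that assms by (cases x) (auto simp: prod_chart_inv is_chart_inv)
    show "snd ?p (chart_inv ?p y) = y" if "y \<in> snd ?p ` fst ?p" for y
      using that assms unfolding im by (auto simp: prod_chart_inv is_chart_inv)
  qed auto
  then show ?thesis
    using k unfolding is_chart_def im by (simp add: open_Times)
qed

lemma charts_at_prod:
  "charts_at (prod_atlas A B) (p, q) = {prod_chart \<kappa> \<mu> | \<kappa> \<mu>. \<kappa> \<in> charts_at A p \<and> \<mu> \<in> charts_at B q}"
proof (intro set_eqI iffI)
  fix \<nu> assume "\<nu> \<in> charts_at (prod_atlas A B) (p, q)"
  then obtain \<kappa> \<mu> where "\<nu> = prod_chart \<kappa> \<mu>" "\<kappa> \<in> A" "\<mu> \<in> B" "(p, q) \<in> fst \<nu>"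
    unfolding charts_at_def prod_atlas_def by blast
  moreover from this have "p \<in> fst \<kappa>" "q \<in> fst \<mu>" by simp_all
  ultimately show "\<nu> \<in> {prod_chart \<kappa> \<mu> | \<kappa> \<mu>. \<kappa> \<in> charts_at A p \<and> \<mu> \<in> charts_at B q}"
    unfolding charts_at_def by blast
next
  fix \<nu> assume "\<nu> \<in> {prod_chart \<kappa> \<mu> | \<kappa> \<mu>. \<kappa> \<in> charts_at A p \<and> \<mu> \<in> charts_at B q}"
  then obtain \<kappa> \<mu> where "\<nu> = prod_chart \<kappa> \<mu>" "\<kappa> \<in> A" "\<mu> \<in> B" "p \<in> fst \<kappa>" "q \<in> fst \<mu>"
    unfolding charts_at_def by blast
  moreover from this have "(p, q) \<in> fst \<nu>" by simp
  ultimately show "\<nu> \<in> charts_at (prod_atlas A B) (p, q)"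
    unfolding charts_at_def prod_atlas_def by blast
qed

lemma prod_chart_in_charts_at:
  "\<kappa> \<in> charts_at A p \<Longrightarrow> \<mu> \<in> charts_at B q \<Longrightarrow> prod_chart \<kappa> \<mu> \<in> charts_at (prod_atlas A B) (p, q)"
  unfolding charts_at_prod by blast

lemma eventually_prod_chart_inv:
  assumes "is_chart \<kappa>" "p \<in> fst \<kappa>" "is_chart \<mu>" "q \<in> fst \<mu>"
  shows "\<forall>\<^sub>F x in nhds (snd \<kappa> p, snd \<mu> q). x \<in> snd \<kappa> ` fst \<kappa> \<times> snd \<mu> ` fst \<mu> \<and>
    chart_inv (prod_chart \<kappa> \<mu>) x = (chart_inv \<kappa> (fst x), chart_inv \<mu> (snd x))"
proof -
  have "\<forall>\<^sub>F x in nhds (snd \<kappa> p, snd \<mu> q). x \<in> snd \<kappa> ` fst \<kappa> \<times> snd \<mu> ` fst \<mu>"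
    using assms
    by (intro eventually_nhds_in_open open_Times is_chart_open(2)) auto
  then show ?thesis
    by eventually_elim (use assms in \<open>auto simp: prod_chart_inv\<close>)
qed

lemma diff_atlas_prod:
  assumes A: "diff_atlas A" and B: "diff_atlas B"
  shows "diff_atlas (prod_atlas A B)"
  unfolding diff_atlas_def
proof (intro conjI ballI)
  show "is_chart \<kappa>" if "\<kappa> \<in> prod_atlas A B" for \<kappa>
    using that A B by (auto simp: prod_atlas_def diff_atlas_def intro: is_chart_prod)
  show "(\<Union>\<kappa>\<in>prod_atlas A B. fst \<kappa>) = UNIV"
  proof -
    have "\<exists>\<kappa>\<in>prod_atlas A B. x \<in> fst \<kappa>" for x
    proof -
      obtain \<kappa> \<mu> where "\<kappa> \<in> charts_at A (fst x)" "\<mu> \<in> charts_at B (snd x)"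
        using charts_at_nonempty[OF A] charts_at_nonempty[OF B] by metis
      from prod_chart_in_charts_at[OF this]
      show ?thesis unfolding charts_at_def by (metis (lifting) mem_Collect_eq prod.collapse)
    qed
    then show ?thesis by auto
  qed
next
  fix \<kappa> \<mu> x assume h: "\<kappa> \<in> prod_atlas A B" "\<mu> \<in> prod_atlas A B" "x \<in> fst \<kappa> \<inter> fst \<mu>"
  obtain p q where x: "x = (p, q)" by (cases x)
  have "\<kappa> \<in> charts_at (prod_atlas A B) (p, q)" "\<mu> \<in> charts_at (prod_atlas A B) (p, q)"
    using h x by (auto simp: charts_at_def)
  then obtain \<kappa>1 \<kappa>2 \<mu>1 \<mu>2 where k: "\<kappa> = prod_chart \<kappa>1 \<kappa>2" "\<mu> = prod_chart \<mu>1 \<mu>2"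
    "\<kappa>1 \<in> charts_at A p" "\<mu>1 \<in> charts_at A p" "\<kappa>2 \<in> charts_at B q" "\<mu>2 \<in> charts_at B q"
    unfolding charts_at_prod mem_Collect_eq by blast
  note c = charts_at_chart[OF A k(3)] charts_at_chart[OF B k(5)]
  have "((\<lambda>x. ((snd \<mu>1 \<circ> chart_inv \<kappa>1) (fst x), (snd \<mu>2 \<circ> chart_inv \<kappa>2) (snd x))) has_derivative
    (\<lambda>v. (chart_change \<kappa>1 \<mu>1 p (fst v), chart_change \<kappa>2 \<mu>2 q (snd v)))) (at (snd \<kappa>1 p, snd \<kappa>2 q))"
    by (intro has_derivative_Pair has_derivative_compose[OF has_derivative_fst[OF has_derivative_ident]]
       has_derivative_compose[OF has_derivative_snd[OF has_derivative_ident]])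
      (use chart_change_derivative[OF A k(3,4)] chart_change_derivative[OF B k(5,6)] in \<open>simp_all add: o_def\<close>)
  moreover have "\<forall>\<^sub>F x in nhds (snd \<kappa>1 p, snd \<kappa>2 q).
     ((snd \<mu>1 \<circ> chart_inv \<kappa>1) (fst x), (snd \<mu>2 \<circ> chart_inv \<kappa>2) (snd x)) = (snd \<mu> \<circ> chart_inv \<kappa>) x"
    using eventually_prod_chart_inv[of \<kappa>1 p \<kappa>2 q] c
    by (auto elim!: eventually_mono simp: k)
  ultimately have "(snd \<mu> \<circ> chart_inv \<kappa> has_derivative
    (\<lambda>v. (chart_change \<kappa>1 \<mu>1 p (fst v), chart_change \<kappa>2 \<mu>2 q (snd v)))) (at (snd \<kappa>1 p, snd \<kappa>2 q))"
    by (rule has_derivative_nhds_cong)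
  then show "(snd \<mu> \<circ> chart_inv \<kappa>) differentiable (at (snd \<kappa> x))"
    by (auto simp: differentiable_def k x)
qed


section \<open>Inner product forms\<close>

text \<open>In use, \<open>B\<close> is the metric at one point written in a chart. The inner
  product of the type keeps its role for topology and derivatives, so the two norms have to be
  compared.\<close>

locale inner_form =
  fixes B :: "'e::finite_dim_inner \<Rightarrow> 'e \<Rightarrow> real"
  assumes ip: "inner_product_on UNIV B"
begin

definition n :: "'e \<Rightarrow> real" where "n a = sqrt (B a a)"

lemma add_left: "B (u + v) w = B u w + B v w"
  and scale_left: "B (r *\<^sub>R u) v = r * B u v"
  and sym: "B u v = B v u"
  and pos: "u \<noteq> 0 \<Longrightarrow> B u u > 0"
  using ip by (auto simp: inner_product_on_def)

lemma linear_left: "linear (\<lambda>a. B a b)"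
  by (rule linearI) (simp_all add: add_left scale_left)

lemma linear_right: "linear (\<lambda>a. B b a)"
  using linear_left[of b] by (simp add: sym[of b])

lemmas left_simps = linear_add[OF linear_left] linear_diff[OF linear_left] linear_0[OF linear_left]
  linear_neg[OF linear_left] linear_cmul[OF linear_left]
lemmas right_simps = linear_add[OF linear_right] linear_diff[OF linear_right] linear_0[OF linear_right]
  linear_neg[OF linear_right] linear_cmul[OF linear_right]

lemma nonneg: "0 \<le> B a a"
  using pos[of a] by (cases "a = 0") (auto simp: left_simps)

lemma n_nonneg: "0 \<le> n a" by (simp add: n_def nonneg)

lemma n_sq: "(n a)\<^sup>2 = B a a" by (simp add: n_def nonneg)

lemma n_0 [simp]: "n 0 = 0" by (simp add: n_def left_simps)

lemma n_eq_0 [simp]: "n a = 0 \<longleftrightarrow> a = 0"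
  using pos[of a] by (cases "a = 0") (auto simp: n_def left_simps)

lemma n_pos: "a \<noteq> 0 \<Longrightarrow> n a > 0"
  using n_nonneg[of a] n_eq_0[of a] by linarith

lemma n_scale: "n (r *\<^sub>R a) = \<bar>r\<bar> * n a"
  by (simp add: n_def left_simps right_simps real_sqrt_mult power2_eq_square[symmetric] mult.assoc[symmetric])

lemma n_minus: "n (- a) = n a"
  using n_scale[of "-1" a] by simp

lemma n_diff_commute: "n (a - b) = n (b - a)"
  using n_minus[of "a - b"] by simp

lemma cauchy_schwarz: "B a b \<le> n a * n b"
proof (cases "b = 0")
  case False
  then have nb: "n b > 0" by (rule n_pos)
  \<comment> \<open>The part of \<open>a\<close> orthogonal to \<open>b\<close>, multiplied by
    \<open>(n b)\<^sup>2\<close> to avoid a division.\<close>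
  have "0 \<le> B ((n b)\<^sup>2 *\<^sub>R a - B a b *\<^sub>R b) ((n b)\<^sup>2 *\<^sub>R a - B a b *\<^sub>R b)" by (rule nonneg)
  also have "\<dots> = (n b)\<^sup>2 * ((n a)\<^sup>2 * (n b)\<^sup>2 - (B a b)\<^sup>2)"
    unfolding n_sq by (simp add: left_simps right_simps sym[of b a] algebra_simps power2_eq_square)
  finally have "(B a b)\<^sup>2 \<le> (n a * n b)\<^sup>2"
    using nb False by (simp add: zero_le_mult_iff power_mult_distrib)
  then show ?thesis
    using n_nonneg by (metis abs_le_square_iff abs_of_nonneg abs_ge_self mult_nonneg_nonneg order_trans)
qed (simp add: right_simps)

lemma n_triangle: "n (a + b) \<le> n a + n b"
proof (rule power2_le_imp_le)
  show "(n (a + b))\<^sup>2 \<le> (n a + n b)\<^sup>2"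
    using cauchy_schwarz[of a b]
    by (simp add: n_sq power2_sum left_simps right_simps sym[of b a])
qed (simp add: n_nonneg)

lemma expand: "B a b = (\<Sum>i\<in>onb. \<Sum>j\<in>onb. (a \<bullet> i) * (b \<bullet> j) * B i j)"
proof -
  have "B a b = (\<Sum>i\<in>onb. (a \<bullet> i) * B i b)" using linear_onb[OF linear_left, of a b] by simp
  also have "\<dots> = (\<Sum>i\<in>onb. (a \<bullet> i) * (\<Sum>j\<in>onb. (b \<bullet> j) * B i j))"
    using linear_onb[OF linear_right, of _ b] by simp
  finally show ?thesis by (simp add: sum_distrib_left mult.assoc)
qed

lemma continuous_n: "continuous_on UNIV n"
  unfolding n_def by (subst expand) (intro continuous_intros)

lemma n_upper: obtains M where "M > 0" "\<And>a. n a \<le> M * norm a"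
proof -
  let ?M = "\<Sum>i\<in>onb. n i"
  have "n (\<Sum>i\<in>C. (a \<bullet> i) *\<^sub>R i) \<le> (\<Sum>i\<in>C. \<bar>a \<bullet> i\<bar> * n i)" if "finite C" for a and C :: "'e set"
    using that
  proof induction
    case (insert x C)
    then show ?case using n_triangle[of "(a \<bullet> x) *\<^sub>R x" "\<Sum>i\<in>C. (a \<bullet> i) *\<^sub>R i"] by (simp add: n_scale)
  qed simp
  then have "n a \<le> (\<Sum>i\<in>onb. \<bar>a \<bullet> i\<bar> * n i)" for a
    using onb_representation[of a] finite_onb by metis
  also have "(\<Sum>i\<in>onb. \<bar>a \<bullet> i\<bar> * n i) \<le> (\<Sum>i\<in>onb. norm a * n i)" for a
    by (intro sum_mono mult_right_mono n_nonneg)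
      (simp add: Cauchy_Schwarz_ineq2[THEN order_trans] norm_onb)
  finally have "n a \<le> ?M * norm a" for a by (simp add: sum_distrib_left mult.commute)
  \<comment> \<open>The summand 1 keeps the constant positive when the basis is empty.\<close>
  moreover have "?M * norm a \<le> (?M + 1) * norm a" for a by (simp add: algebra_simps)
  moreover have "?M \<ge> 0" by (simp add: sum_nonneg n_nonneg)
  ultimately show thesis by (intro that[of "?M + 1"]) (auto intro: order_trans)
qed

lemma n_lower: obtains m where "m > 0" "\<And>a. m * norm a \<le> n a"
proof (cases "sphere (0::'e) 1 = {}")
  \<comment> \<open>An empty unit sphere means the zero space, where any constant works.\<close>
  case True
  have zero: "a = 0" for a :: 'e
  proof (rule ccontr)
    assume "a \<noteq> 0"
    then have "a /\<^sub>R norm a \<in> sphere 0 1" by simp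
    then show False using True by blast
  qed
  have "1 * norm a \<le> n a" for a using zero[of a] by simp
  then show thesis using that zero_less_one by blast
next
  case False
  have "closed (sphere (0::'e) 1)"
    using closed_Collect_eq[of norm "\<lambda>_::'e. 1"] by (simp add: sphere_def continuous_on_norm)
  then have "compact (sphere (0::'e) 1)"
    unfolding compact_eq_bounded_closed using bounded_subset[OF bounded_cball sphere_cball] by blast
  then obtain u where u: "norm u = 1" "\<And>v. norm v = 1 \<Longrightarrow> n u \<le> n v"
    using False continuous_attains_inf[of "sphere (0::'e) 1" n] continuous_on_subset[OF continuous_n]
    by (auto simp: sphere_def)
  show thesis
  proof (rule that)
    have "u \<noteq> 0" using u(1) by auto
    then show "n u > 0" by (rule n_pos)
    show "n u * norm a \<le> n a" for a
    proof (cases "a = 0")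
      case False
      then have "n u \<le> n (a /\<^sub>R norm a)" by (intro u(2)) simp
      then show ?thesis using False by (simp add: n_scale field_simps)
    qed simp
  qed
qed

text \<open>For a basis \<open>C\<close> of \<open>K\<close>, the map \<open>T\<close> that sums
  \<open>B a c *\<^sub>R c\<close> over \<open>C\<close> has values in \<open>K\<close>, and its
  kernel is the \<open>B\<close>-orthogonal complement of \<open>K\<close>. Positivity makes it
  injective on \<open>K\<close>, and equal dimension makes it onto; following \<open>T\<close> by
  the inverse of its restriction to \<open>K\<close> gives the projection.\<close>

lemma orthogonal_projection:
  assumes K: "subspace K"
  obtains P where "linear P" "\<And>a. P a \<in> K" "\<And>k. k \<in> K \<Longrightarrow> P k = k"
    "\<And>a k. k \<in> K \<Longrightarrow> B (a - P a) k = 0"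
proof -
  obtain C where C: "C \<subseteq> K" "independent C" "K \<subseteq> span C"
    using maximal_independent_subset[of K] by blast
  have fC: "finite C"
    using independent_span_bound[OF finite_onb C(2)] by (simp add: span_onb)
  have spC: "span C = K" using C K by (simp add: span_minimal subset_antisym)
  define T where "T a = (\<Sum>c\<in>C. B a c *\<^sub>R c)" for a
  have T: "linear T"
    unfolding T_def
    by (rule linearI) (simp_all add: left_simps sum.distrib scaleR_add_left scaleR_sum_right)
  have TK: "T a \<in> K" for a
    unfolding T_def using K C(1) by (intro subspace_sum subspace_scale) auto
  have T0: "B a k = 0" if "T a = 0" "k \<in> K" for a k
  proof -
    have "B a c = 0" if "c \<in> C" for c
      using independentD[OF C(2) fC subset_refl] \<open>T a = 0\<close> that by (simp add: T_def)
    moreover have "k \<in> span C" using that spC by simp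
    ultimately show ?thesis
    proof -
      assume h: "\<And>c. c \<in> C \<Longrightarrow> B a c = 0" and k: "k \<in> span C"
      have "C \<subseteq> {k. B a k = 0}" using h by auto
      then have "span C \<subseteq> {k. B a k = 0}"
        by (intro span_minimal linear_subspace_kernel[OF linear_right])
      then show ?thesis using k by blast
    qed
  qed
  have inj: "inj_on T K"
  proof (rule inj_onI)
    fix x y assume h: "x \<in> K" "y \<in> K" "T x = T y"
    have "T (x - y) = 0" using h by (simp add: linear_diff[OF T])
    moreover have "x - y \<in> K" using h K by (simp add: subspace_diff)
    ultimately have "B (x - y) (x - y) = 0" by (rule T0)
    then show "x = y" using pos[of "x - y"] by auto
  qed
  have TKK: "T ` K = K"
  proof (rule subspace_eq_if_dim_eq)
    show "subspace (T ` K)" by (rule linear_subspace_image[OF T K])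
    show "dim (T ` K) = dim K" by (rule dim_linear_image[OF T K inj])
  qed (use K TK in auto)
  obtain h where h: "h \<in> UNIV \<rightarrow> K" "linear h" "\<forall>v\<in>K. h (T v) = v"
    using linear_exists_left_inverse_on[OF T K inj] by blast
  show thesis
  proof (rule that[of "h \<circ> T"])
    show "linear (h \<circ> T)" by (rule linear_compose[OF T h(2)])
    show "(h \<circ> T) a \<in> K" for a using h(1) by auto
    show "(h \<circ> T) k = k" if "k \<in> K" for k using h(3) that by simp
    show "B (a - (h \<circ> T) a) k = 0" if "k \<in> K" for a k
    proof -
      obtain k' where k': "k' \<in> K" "T a = T k'" using TK[of a] TKK by (metis imageE)
      then have "(h \<circ> T) a = k'" using h(3) by simp
      then have "T (a - (h \<circ> T) a) = 0" using k' by (simp add: linear_diff[OF T])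
      then show ?thesis using that by (rule T0)
    qed
  qed
qed

text \<open>Smoothness of a metric speaks of single coefficients; the finite sum of their changes
  gives a bound uniform in \<open>a\<close>.\<close>

lemma perturbation:
  assumes "inner_product_on UNIV B'"
  shows "\<bar>B' a a - B a a\<bar> \<le> (norm a)\<^sup>2 * (\<Sum>i\<in>onb. \<Sum>j\<in>onb. \<bar>B' i j - B i j\<bar>)"
proof -
  interpret B': inner_form B' by unfold_locales (rule assms)
  have "B' a a - B a a = (\<Sum>i\<in>onb. \<Sum>j\<in>onb. (a \<bullet> i) * (a \<bullet> j) * (B' i j - B i j))"
    by (simp add: B'.expand[of a a] expand[of a a] sum_subtractf right_diff_distrib)
  also have "\<bar>\<dots>\<bar> \<le> (\<Sum>i\<in>onb. \<Sum>j\<in>onb. \<bar>(a \<bullet> i) * (a \<bullet> j) * (B' i j - B i j)\<bar>)"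
    by (rule order_trans[OF sum_abs]) (intro sum_mono sum_abs)
  also have "\<dots> \<le> (\<Sum>i\<in>onb. \<Sum>j\<in>onb. (norm a)\<^sup>2 * \<bar>B' i j - B i j\<bar>)"
  proof (intro sum_mono)
    fix i j :: 'e assume ij: "i \<in> onb" "j \<in> onb"
    have "\<bar>a \<bullet> i\<bar> \<le> norm a" "\<bar>a \<bullet> j\<bar> \<le> norm a"
      using Cauchy_Schwarz_ineq2[of a i] Cauchy_Schwarz_ineq2[of a j] ij by (auto simp: norm_onb)
    then have "\<bar>a \<bullet> i\<bar> * \<bar>a \<bullet> j\<bar> \<le> (norm a)\<^sup>2"
      unfolding power2_eq_square by (intro mult_mono) auto
    then show "\<bar>(a \<bullet> i) * (a \<bullet> j) * (B' i j - B i j)\<bar> \<le> (norm a)\<^sup>2 * \<bar>B' i j - B i j\<bar>"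
      by (simp add: abs_mult mult_right_mono)
  qed
  finally show ?thesis by (simp add: sum_distrib_left)
qed

end


section \<open>Riemannian distance\<close>

text \<open>The coordinate expression of the metric, with the classical coefficients
  \<open>g_ij(s)\<close> as its values on basis vectors.\<close>

definition chart_form ::
    "('m, 'e::real_normed_vector) chart set \<Rightarrow> ('m, 'e) metric_tensor \<Rightarrow> ('m, 'e) chart \<Rightarrow> 'e \<Rightarrow> 'e \<Rightarrow> 'e \<Rightarrow> real" where
  "chart_form A g \<kappa> s a b =
     g (chart_inv \<kappa> s) (coord_vector A (chart_inv \<kappa> s) \<kappa> a) (coord_vector A (chart_inv \<kappa> s) \<kappa> b)"

lemma chart_form_at:
  "is_chart \<kappa> \<Longrightarrow> p \<in> fst \<kappa> \<Longrightarrow>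
    chart_form A g \<kappa> (snd \<kappa> p) a b = g p (coord_vector A p \<kappa> a) (coord_vector A p \<kappa> b)"
  by (simp add: chart_form_def is_chart_inv)

lemma inner_form_chart_form:
  fixes A :: "('m::t2_space, 'e::finite_dim_inner) chart set"
  assumes A: "diff_atlas A" and g: "riemannian_metric A g" and \<kappa>: "\<kappa> \<in> A" and s: "s \<in> snd \<kappa> ` fst \<kappa>"
  shows "inner_form (chart_form A g \<kappa> s)"
proof
  define p where "p = chart_inv \<kappa> s"
  have "is_chart \<kappa>" using A \<kappa> by (simp add: diff_atlas_def)
  then have c: "\<kappa> \<in> charts_at A p"
    using \<kappa> is_chart_inv_in[OF _ s] by (simp add: charts_at_def p_def)
  let ?c = "coord_vector A p \<kappa>"
  note lin = linear_coord_vector[OF A c]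
  have T: "?c a \<in> tangent_space A p" for a by (rule coord_vector_in_tangent_space[OF A c])
  have nz: "?c a \<noteq> 0" if "a \<noteq> 0" for a
    using coord_vector_same[OF A c, of a] that by (metis zero_fun_apply)
  have ip: "inner_product_on (tangent_space A p) (g p)" using g by (simp add: riemannian_metric_def)
  show "inner_product_on UNIV (chart_form A g \<kappa> s)"
    unfolding inner_product_on_def chart_form_def p_def[symmetric]
    using ip T nz unfolding inner_product_on_def
    by (simp add: linear_add[OF lin] linear_cmul[OF lin])
qed

lemma chart_form_comparison:
  fixes A :: "('m::t2_space, 'e::finite_dim_inner) chart set"
  assumes A: "diff_atlas A" and g: "riemannian_metric A g" and \<kappa>: "\<kappa> \<in> A" and s0: "s0 \<in> snd \<kappa> ` fst \<kappa>"
    and e: "0 < \<epsilon>" "\<epsilon> < 1"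
  shows "\<forall>\<^sub>F s in nhds s0. s \<in> snd \<kappa> ` fst \<kappa> \<and>
    (\<forall>a. (1 - \<epsilon>) * sqrt (chart_form A g \<kappa> s0 a a) \<le> sqrt (chart_form A g \<kappa> s a a) \<and>
         sqrt (chart_form A g \<kappa> s a a) \<le> (1 + \<epsilon>) * sqrt (chart_form A g \<kappa> s0 a a))"
proof -
  let ?B = "chart_form A g \<kappa>"
  have ch: "is_chart \<kappa>" using A \<kappa> by (simp add: diff_atlas_def)
  have op: "open (snd \<kappa> ` fst \<kappa>)" by (rule is_chart_open(2)[OF ch])
  interpret inner_form "?B s0" by (rule inner_form_chart_form[OF A g \<kappa> s0])
  obtain m where m: "m > 0" "\<And>a. m * norm a \<le> n a" using n_lower by blast
  define \<sigma> where "\<sigma> s = (\<Sum>i\<in>onb. \<Sum>j\<in>onb. \<bar>?B s i j - ?B s0 i j\<bar>)" for s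
  have "isCont (\<lambda>s. ?B s a b) s0" for a b
  proof -
    have "smooth_on (snd \<kappa> ` fst \<kappa>) (\<lambda>s. ?B s a b)"
      using g \<kappa> by (simp add: riemannian_metric_def chart_form_def)
    then have "(\<lambda>s. ?B s a b) differentiable (at s0)" using s0 by (rule smooth_onD(1))
    then show ?thesis by (rule differentiable_imp_continuous_within)
  qed
  then have "isCont \<sigma> s0" unfolding \<sigma>_def by (intro continuous_intros)
  \<comment> \<open>With \<open>m * norm a \<le> n a\<close> the threshold
    \<open>\<epsilon> * m\<^sup>2\<close> turns the perturbation into at most
    \<open>\<epsilon> * (n a)\<^sup>2\<close>. Roots can be taken afterwards since
    \<open>1 + \<epsilon> \<le> (1 + \<epsilon>)\<^sup>2\<close> and
    \<open>(1 - \<epsilon>)\<^sup>2 \<le> 1 - \<epsilon>\<close>.\<close>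
  moreover have "\<sigma> s0 < \<epsilon> * m\<^sup>2" using e m by (simp add: \<sigma>_def)
  then have "\<forall>\<^sub>F x in nhds (\<sigma> s0). x < \<epsilon> * m\<^sup>2"
    using eventually_nhds_in_open[OF open_lessThan, of "\<sigma> s0" "\<epsilon> * m\<^sup>2"] by simp
  ultimately have "\<forall>\<^sub>F s in nhds s0. \<sigma> s < \<epsilon> * m\<^sup>2" by (rule isCont_eventually_nhds)
  moreover have "\<forall>\<^sub>F s in nhds s0. s \<in> snd \<kappa> ` fst \<kappa>" by (rule eventually_nhds_in_open[OF op s0])
  ultimately show ?thesis
  proof eventually_elim
    case (elim s)
    have "inner_form (?B s)" by (rule inner_form_chart_form[OF A g \<kappa> elim(2)])
    then have ip': "inner_product_on UNIV (?B s)" by (simp add: inner_form_def)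
    have "(1 - \<epsilon>) * n a \<le> sqrt (?B s a a) \<and> sqrt (?B s a a) \<le> (1 + \<epsilon>) * n a" for a
    proof -
      have "\<bar>?B s a a - ?B s0 a a\<bar> \<le> (norm a)\<^sup>2 * \<sigma> s" unfolding \<sigma>_def by (rule perturbation[OF ip'])
      also have "\<dots> \<le> (norm a)\<^sup>2 * (\<epsilon> * m\<^sup>2)" using elim(1) by (intro mult_left_mono) auto
      also have "\<dots> = \<epsilon> * (m * norm a)\<^sup>2" by (simp add: power_mult_distrib)
      also have "\<dots> \<le> \<epsilon> * (n a)\<^sup>2" using e m by (intro mult_left_mono power_mono) auto
      finally have *: "\<bar>?B s a a - (n a)\<^sup>2\<bar> \<le> \<epsilon> * (n a)\<^sup>2" by (simp add: n_sq)
      have sq: "(n a)\<^sup>2 \<ge> 0" by simp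
      have "(1 + \<epsilon>) * (n a)\<^sup>2 \<le> (1 + \<epsilon>)\<^sup>2 * (n a)\<^sup>2"
        using e sq by (intro mult_right_mono) (auto simp: power2_eq_square)
      moreover have "?B s a a \<le> (1 + \<epsilon>) * (n a)\<^sup>2" using * by (simp add: distrib_right)
      ultimately have 1: "?B s a a \<le> ((1 + \<epsilon>) * n a)\<^sup>2" by (simp add: power_mult_distrib)
      have "(1 - \<epsilon>)\<^sup>2 * (n a)\<^sup>2 \<le> (1 - \<epsilon>) * (n a)\<^sup>2"
        using e sq by (intro mult_right_mono) (auto simp: power2_eq_square mult_left_le)
      moreover have "(1 - \<epsilon>) * (n a)\<^sup>2 \<le> ?B s a a" using * by (simp add: left_diff_distrib)
      ultimately have 2: "((1 - \<epsilon>) * n a)\<^sup>2 \<le> ?B s a a" by (simp add: power_mult_distrib)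
      show ?thesis using real_le_rsqrt[OF 2] real_le_lsqrt[OF _ 1] e n_nonneg[of a] by simp
    qed
    then show ?case using elim(2) by (simp add: n_def)
  qed
qed

section \<open>Curves, speed and length\<close>

lemma velocity_coord:
  assumes A: "diff_atlas A" and \<gamma>: "isCont \<gamma> t" and \<kappa>: "\<kappa> \<in> charts_at A (\<gamma> t)"
    and d: "(snd \<kappa> \<circ> \<gamma> has_vector_derivative d) (at t)"
  shows "velocity A \<gamma> t = coord_vector A (\<gamma> t) \<kappa> d"
proof -
  note k = charts_at_chart[OF A \<kappa>]
  have "vector_derivative (snd \<mu> \<circ> \<gamma>) (at t) = chart_change \<kappa> \<mu> (\<gamma> t) d"
    if \<mu>: "\<mu> \<in> charts_at A (\<gamma> t)" for \<mu>
  proof -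
    have "((\<lambda>t. (snd \<mu> \<circ> chart_inv \<kappa>) ((snd \<kappa> \<circ> \<gamma>) t)) has_derivative
        (\<lambda>h. chart_change \<kappa> \<mu> (\<gamma> t) (h *\<^sub>R d))) (at t)"
      by (rule has_derivative_compose[OF d[unfolded has_vector_derivative_def]])
        (use chart_change_derivative[OF A \<kappa> \<mu>] in \<open>simp add: o_def\<close>)
    moreover have "\<forall>\<^sub>F t in nhds t. \<gamma> t \<in> fst \<kappa>"
      using k by (intro isCont_eventually_nhds[OF \<gamma>] eventually_in_chart) auto
    then have "\<forall>\<^sub>F t in nhds t. (snd \<mu> \<circ> chart_inv \<kappa>) ((snd \<kappa> \<circ> \<gamma>) t) = (snd \<mu> \<circ> \<gamma>) t"
      by eventually_elim (use k in \<open>simp add: is_chart_inv\<close>)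
    ultimately have "(snd \<mu> \<circ> \<gamma> has_derivative (\<lambda>h. chart_change \<kappa> \<mu> (\<gamma> t) (h *\<^sub>R d))) (at t)"
      by (rule has_derivative_nhds_cong)
    then have "(snd \<mu> \<circ> \<gamma> has_vector_derivative chart_change \<kappa> \<mu> (\<gamma> t) d) (at t)"
      by (simp add: has_vector_derivative_def linear_cmul[OF linear_chart_change[OF A \<kappa> \<mu>]])
    then show ?thesis by (rule vector_derivative_at)
  qed
  then show ?thesis by (auto simp: velocity_def coord_vector_def)
qed

lemma riem_norm_velocity:
  assumes A: "diff_atlas A" and "isCont \<gamma> t" and \<kappa>: "\<kappa> \<in> charts_at A (\<gamma> t)"
    and "(snd \<kappa> \<circ> \<gamma> has_vector_derivative d) (at t)"
  shows "riem_norm g (\<gamma> t) (velocity A \<gamma> t) = sqrt (chart_form A g \<kappa> (snd \<kappa> (\<gamma> t)) d d)"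
  using velocity_coord[OF assms] charts_at_chart[OF A \<kappa>] by (simp add: riem_norm_def chart_form_at)

lemma open_interval_diff_eq: "{0..1::real} - (S \<union> {0, 1}) = {0<..<1} - S"
  by auto

text \<open>Derivatives in \<open>C1_differentiable_on\<close> are two-sided, so at 0 and 1 they
  would involve values of the curve outside \<open>{0..1}\<close>. Putting the end points into the
  exceptional set avoids this.\<close>

lemma piecewise_C1_curveI:
  assumes "continuous_on {0..1} \<gamma>" "finite S"
    "\<And>\<kappa>. \<kappa> \<in> A \<Longrightarrow> (snd \<kappa> \<circ> \<gamma>) C1_differentiable_on (({0<..<1} - S) \<inter> \<gamma> -` fst \<kappa>)"
  shows "piecewise_C1_curve A \<gamma>"
  unfolding piecewise_C1_curve_def
proof (intro conjI exI[of _ "S \<union> {0, 1}"] ballI)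
  show "(snd \<kappa> \<circ> \<gamma>) C1_differentiable_on (({0..1} - (S \<union> {0, 1})) \<inter> \<gamma> -` fst \<kappa>)" if "\<kappa> \<in> A" for \<kappa>
    unfolding open_interval_diff_eq by (rule assms(3)[OF that])
qed (use assms in auto)

lemma piecewise_C1_curveE:
  fixes \<gamma> :: "real \<Rightarrow> 'm::t2_space"
  assumes "piecewise_C1_curve A \<gamma>"
  obtains S where "continuous_on {0..1} \<gamma>" "finite S"
    "\<And>\<kappa>. \<kappa> \<in> A \<Longrightarrow> (snd \<kappa> \<circ> \<gamma>) C1_differentiable_on (({0<..<1} - S) \<inter> \<gamma> -` fst \<kappa>)"
    "\<And>t. t \<in> {0<..<1} \<Longrightarrow> isCont \<gamma> t"
proof -
  obtain S where S: "continuous_on {0..1} \<gamma>" "finite S"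
    "\<And>\<kappa>. \<kappa> \<in> A \<Longrightarrow> (snd \<kappa> \<circ> \<gamma>) C1_differentiable_on (({0..1} - S) \<inter> \<gamma> -` fst \<kappa>)"
    using assms unfolding piecewise_C1_curve_def by blast
  show thesis
  proof (rule that[OF S(1,2)])
    show "(snd \<kappa> \<circ> \<gamma>) C1_differentiable_on (({0<..<1} - S) \<inter> \<gamma> -` fst \<kappa>)" if "\<kappa> \<in> A" for \<kappa>
      by (rule C1_differentiable_on_subset[OF S(3)[OF that]]) auto
    show "isCont \<gamma> t" if "t \<in> {0<..<1}" for t
      using continuous_on_interior[OF S(1)] that by simp
  qed
qed

text \<open>Measurability of the speed of a curve is never established, so lengths are treated
  through the definition of the integral as a supremum over simple functions: each simple function
  below \<open>f\<close> is measurable and can be split at \<open>E\<close>.\<close>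

lemma nn_integral_split_le:
  assumes E: "E \<in> sets M"
  shows "(\<integral>\<^sup>+x. f x \<partial>M) \<le> (\<integral>\<^sup>+x. f x * indicator E x \<partial>M) + (\<integral>\<^sup>+x. f x * indicator (- E) x \<partial>M)"
  unfolding nn_integral_def[of M f]
proof (rule SUP_least)
  fix h assume "h \<in> {g. simple_function M g \<and> g \<le> f}"
  then have h: "simple_function M h" "h \<le> f" by auto
  have hm[measurable]: "h \<in> borel_measurable M" using h(1) by (rule borel_measurable_simple_function)
  have nE: "(\<lambda>x. h x * indicator (- E) x) \<in> borel_measurable M"
  proof -
    have "(\<lambda>x. h x * indicator (space M - E) x) \<in> borel_measurable M" using E by measurable
    then show ?thesis by (rule measurable_cong[THEN iffD1, rotated]) (simp add: indicator_def)
  qed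
  have "integral\<^sup>S M h = (\<integral>\<^sup>+x. h x \<partial>M)" by (rule nn_integral_eq_simple_integral[OF h(1), symmetric])
  also have "\<dots> = (\<integral>\<^sup>+x. h x * indicator E x + h x * indicator (- E) x \<partial>M)"
    by (intro nn_integral_cong) (auto simp: indicator_def)
  also have "\<dots> = (\<integral>\<^sup>+x. h x * indicator E x \<partial>M) + (\<integral>\<^sup>+x. h x * indicator (- E) x \<partial>M)"
    using E nE by (intro nn_integral_add) auto
  also have "\<dots> \<le> (\<integral>\<^sup>+x. f x * indicator E x \<partial>M) + (\<integral>\<^sup>+x. f x * indicator (- E) x \<partial>M)"
    using h(2) by (intro add_mono nn_integral_mono mult_right_mono) (auto simp: le_fun_def)
  finally show "integral\<^sup>S M h \<le> (\<integral>\<^sup>+x. f x * indicator E x \<partial>M) + (\<integral>\<^sup>+x. f x * indicator (- E) x \<partial>M)" .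
qed

text \<open>The substitution is applied to a simple function \<open>h\<close> below the integrand,
  since \<open>f\<close> itself may fail to be measurable; the transformed function
  \<open>h'\<close> lies below \<open>f\<close>.\<close>

lemma nn_integral_affine_le:
  assumes c: "c > 0"
  shows "(\<integral>\<^sup>+x. ennreal c * f (b + c * x) \<partial>lborel) \<le> (\<integral>\<^sup>+x. f x \<partial>lborel)"
  unfolding nn_integral_def[of lborel "\<lambda>x. ennreal c * f (b + c * x)"]
proof (rule SUP_least)
  fix h assume "h \<in> {g. simple_function lborel g \<and> g \<le> (\<lambda>x. ennreal c * f (b + c * x))}"
  then have h: "simple_function lborel h" "\<And>x. h x \<le> ennreal c * f (b + c * x)"
    by (auto simp: le_fun_def)
  have hm[measurable]: "h \<in> borel_measurable borel"
    using borel_measurable_simple_function[OF h(1)] by simp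
  have cc: "ennreal (1 / c) * ennreal c = 1" using c by (simp add: ennreal_mult[symmetric])
  define h' where "h' u = ennreal (1 / c) * h ((u - b) / c)" for u
  have h'm: "h' \<in> borel_measurable borel" unfolding h'_def by measurable
  have "integral\<^sup>S lborel h = (\<integral>\<^sup>+x. h x \<partial>lborel)"
    by (rule nn_integral_eq_simple_integral[OF h(1), symmetric])
  also have "\<dots> = ennreal c * (\<integral>\<^sup>+x. h' (b + c * x) \<partial>lborel)"
    using c cc by (simp add: h'_def nn_integral_cmult mult.assoc[symmetric] mult.commute[of "ennreal c"])
  also have "\<dots> = (\<integral>\<^sup>+x. h' x \<partial>lborel)"
    using nn_integral_real_affine[OF h'm, of c b] c by simp
  also have "\<dots> \<le> (\<integral>\<^sup>+x. f x \<partial>lborel)"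
  proof (rule nn_integral_mono)
    fix u
    have "h' u \<le> ennreal (1 / c) * (ennreal c * f (b + c * ((u - b) / c)))"
      unfolding h'_def by (intro mult_left_mono h(2)) auto
    also have "\<dots> = f u" using c by (simp add: mult.assoc[symmetric] cc)
    finally show "h' u \<le> f u" .
  qed
  finally show "integral\<^sup>S lborel h \<le> (\<integral>\<^sup>+x. f x \<partial>lborel)" .
qed

text \<open>\<open>w\<close> is only a pointwise bound, so the estimate passes through the
  measurable function \<open>h\<close>. If the integral of its absolute value is infinite there is
  nothing to show; otherwise its Lebesgue integral agrees with the gauge integral from the
  fundamental theorem of calculus, which tolerates finitely many exceptional points.\<close>

lemma nn_integral_ge_increment:
  fixes \<phi> :: "real \<Rightarrow> real"
  assumes T: "0 \<le> T" and S: "finite S" and cont: "continuous_on {0..T} \<phi>"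
    and der: "\<And>t. t \<in> {0<..<T} - S \<Longrightarrow> (\<phi> has_vector_derivative \<psi> t) (at t)"
    and c\<psi>: "continuous_on ({0<..<T} - S) \<psi>"
    and w: "\<And>t. t \<in> {0<..<T} - S \<Longrightarrow> ennreal \<bar>\<psi> t\<bar> \<le> w t"
  shows "ennreal (\<phi> T - \<phi> 0) \<le> (\<integral>\<^sup>+t\<in>{0..T}. w t \<partial>lborel)"
proof -
  define h where "h t = indicator ({0<..<T} - S) t *\<^sub>R \<psi> t" for t
  have op: "open ({0<..<T} - S)" using S by (intro open_Diff finite_imp_closed) auto
  have hm: "h \<in> borel_measurable lborel"
    unfolding h_def using borel_measurable_continuous_on_indicator[OF _ c\<psi>] op by auto
  have "(h has_integral (\<phi> T - \<phi> 0)) {0..T}"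
    by (rule fundamental_theorem_of_calculus_interior_strong[OF S T _ cont])
      (use der in \<open>auto simp: h_def\<close>)
  then have hi: "(h has_integral (\<phi> T - \<phi> 0)) UNIV"
    by (rule has_integral_on_superset) (auto simp: h_def)
  have "ennreal (\<phi> T - \<phi> 0) \<le> (\<integral>\<^sup>+t. ennreal \<bar>h t\<bar> \<partial>lborel)"
  proof (cases "(\<integral>\<^sup>+t. ennreal \<bar>h t\<bar> \<partial>lborel) = \<infinity>")
    case False
    then have int: "integrable lborel h"
      using hm by (intro integrableI_bounded) (auto simp: less_top)
    have "\<phi> T - \<phi> 0 = integral\<^sup>L lborel h"
      using has_integral_unique[OF hi has_integral_integral_lborel[OF int]] .
    also have "\<dots> \<le> integral\<^sup>L lborel (\<lambda>t. \<bar>h t\<bar>)"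
      using int by (intro integral_mono) auto
    finally show ?thesis
      using int by (simp add: nn_integral_eq_integral ennreal_leI)
  qed simp
  also have "\<dots> \<le> (\<integral>\<^sup>+t\<in>{0..T}. w t \<partial>lborel)"
    using w by (intro nn_integral_mono) (auto simp: h_def indicator_def)
  finally show ?thesis .
qed

section \<open>Concatenation of curves and the triangle inequality\<close>

lemma riem_dist_le_curve_length:
  "piecewise_C1_curve A \<gamma> \<Longrightarrow> \<gamma> 0 = p \<Longrightarrow> \<gamma> 1 = q \<Longrightarrow> riem_dist A g p q \<le> curve_length A g \<gamma>"
  unfolding riem_dist_def by (rule INF_lower) simp

lemma curve_derivative_obtain:
  fixes \<gamma> :: "real \<Rightarrow> 'm::t2_space"
  assumes A: "diff_atlas A" and S: "\<And>\<kappa>. \<kappa> \<in> A \<Longrightarrow> (snd \<kappa> \<circ> \<gamma>) C1_differentiable_on (({0<..<1} - S) \<inter> \<gamma> -` fst \<kappa>)"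
    and t: "t \<in> {0<..<1} - S"
  obtains \<kappa> d where "\<kappa> \<in> charts_at A (\<gamma> t)" "(snd \<kappa> \<circ> \<gamma> has_vector_derivative d) (at t)"
proof -
  obtain \<kappa> where \<kappa>: "\<kappa> \<in> charts_at A (\<gamma> t)" using charts_at_nonempty[OF A] by blast
  then have "\<kappa> \<in> A" "\<gamma> t \<in> fst \<kappa>" by (auto simp: charts_at_def)
  then obtain D where "(snd \<kappa> \<circ> \<gamma> has_vector_derivative D t) (at t)"
    using S[of \<kappa>] t unfolding C1_differentiable_on_def by blast
  then show thesis by (rule that[OF \<kappa>])
qed

text \<open>The affine map \<open>2 * t + b\<close> covers both halves of a joined path, with
  \<open>b = 0\<close> and \<open>b = -1\<close>.\<close>

lemma has_vector_derivative_reparam: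
  fixes t b :: real
  assumes d: "(\<phi> has_vector_derivative d) (at (2 * t + b))"
    and eq: "\<forall>\<^sub>F s in nhds t. \<phi> (2 * s + b) = \<psi> s"
  shows "(\<psi> has_vector_derivative 2 *\<^sub>R d) (at t)"
proof -
  have "((\<lambda>s. \<phi> (2 * s + b)) has_derivative (\<lambda>h. (2 * h) *\<^sub>R d)) (at t)"
    by (rule has_derivative_compose[where f = "\<lambda>s. 2 * s + b", OF _ d[unfolded has_vector_derivative_def]])
      (auto intro!: derivative_eq_intros)
  then have "(\<psi> has_derivative (\<lambda>h. (2 * h) *\<^sub>R d)) (at t)"
    using eq by (rule has_derivative_nhds_cong)
  then show ?thesis by (simp add: has_vector_derivative_def mult.commute)
qed

lemma speed_reparam:
  fixes \<gamma> \<gamma>1 :: "real \<Rightarrow> 'm::t2_space" and A :: "('m, 'e::finite_dim_inner) chart set"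
  assumes A: "diff_atlas A" and g: "riemannian_metric A g"
    and c1: "isCont \<gamma>1 (2 * t + b)" and eq: "\<forall>\<^sub>F s in nhds t. \<gamma> s = \<gamma>1 (2 * s + b)"
    and \<kappa>: "\<kappa> \<in> charts_at A (\<gamma>1 (2 * t + b))"
    and d: "(snd \<kappa> \<circ> \<gamma>1 has_vector_derivative d) (at (2 * t + b))"
  shows "riem_norm g (\<gamma> t) (velocity A \<gamma> t) =
    2 * riem_norm g (\<gamma>1 (2 * t + b)) (velocity A \<gamma>1 (2 * t + b))"
proof -
  have \<gamma>t: "\<gamma> t = \<gamma>1 (2 * t + b)" using eventually_nhds_x_imp_x[OF eq] .
  have "isCont (\<lambda>s. \<gamma>1 (2 * s + b)) t"
    by (rule isCont_o2[where f = "\<lambda>s. 2 * s + b", OF _ c1]) (intro continuous_intros)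
  moreover have "\<forall>\<^sub>F s in nhds t. \<gamma>1 (2 * s + b) = \<gamma> s"
    using eq by eventually_elim simp
  ultimately have c: "isCont \<gamma> t" by (simp add: isCont_cong)
  have d2: "(snd \<kappa> \<circ> \<gamma> has_vector_derivative 2 *\<^sub>R d) (at t)"
    by (rule has_vector_derivative_reparam[OF d]) (use eq in \<open>auto elim!: eventually_mono\<close>)
  have "\<kappa> \<in> A" "snd \<kappa> (\<gamma> t) \<in> snd \<kappa> ` fst \<kappa>" using \<kappa> \<gamma>t by (auto simp: charts_at_def)
  then interpret inner_form "chart_form A g \<kappa> (snd \<kappa> (\<gamma> t))"
    by (rule inner_form_chart_form[OF A g])
  show ?thesis
    using riem_norm_velocity[OF A c _ d2, of g] riem_norm_velocity[OF A c1 \<kappa> d, of g] \<kappa> n_scale[of 2 d, unfolded n_def]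
    by (simp add: \<gamma>t)
qed

lemma ennreal_less_add_pos:
  assumes "x < top" "0 < e"
  shows "x < x + ennreal e"
proof -
  obtain r where r: "0 \<le> r" "x = ennreal r" using assms(1) by (cases x) auto
  have "ennreal r < ennreal (r + e)" using r assms by (intro ennreal_lessI) auto
  then show ?thesis using r assms by (simp add: ennreal_plus)
qed

text \<open>Together with the local upper bound this makes the distance to a base point Lipschitz in
  coordinates, hence continuous on compact sets of candidates.\<close>

lemma riem_dist_triangle:
  fixes A :: "('m::t2_space, 'e::finite_dim_inner) chart set"
  assumes A: "diff_atlas A" and g: "riemannian_metric A g"
  shows "riem_dist A g p r \<le> riem_dist A g p q + riem_dist A g q r"
proof -
  have join: "riem_dist A g p r \<le> curve_length A g \<gamma>1 + curve_length A g \<gamma>2"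
    if \<gamma>1: "piecewise_C1_curve A \<gamma>1" "\<gamma>1 0 = p" "\<gamma>1 1 = q"
      and \<gamma>2: "piecewise_C1_curve A \<gamma>2" "\<gamma>2 0 = q" "\<gamma>2 1 = r" for \<gamma>1 \<gamma>2
  proof -
    obtain S1 where S1: "continuous_on {0..1} \<gamma>1" "finite S1"
      "\<And>\<kappa>. \<kappa> \<in> A \<Longrightarrow> (snd \<kappa> \<circ> \<gamma>1) C1_differentiable_on (({0<..<1} - S1) \<inter> \<gamma>1 -` fst \<kappa>)"
      "\<And>t. t \<in> {0<..<1} \<Longrightarrow> isCont \<gamma>1 t"
      using piecewise_C1_curveE[OF \<gamma>1(1)] by metis
    obtain S2 where S2: "continuous_on {0..1} \<gamma>2" "finite S2"
      "\<And>\<kappa>. \<kappa> \<in> A \<Longrightarrow> (snd \<kappa> \<circ> \<gamma>2) C1_differentiable_on (({0<..<1} - S2) \<inter> \<gamma>2 -` fst \<kappa>)"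
      "\<And>t. t \<in> {0<..<1} \<Longrightarrow> isCont \<gamma>2 t"
      using piecewise_C1_curveE[OF \<gamma>2(1)] by metis
    define \<gamma> where "\<gamma> = \<gamma>1 +++ \<gamma>2"
    have \<gamma>_simps: "\<gamma> t = (if t \<le> 1/2 then \<gamma>1 (2 * t + 0) else \<gamma>2 (2 * t + (-1)))" for t
      by (simp add: \<gamma>_def joinpaths_def)
    have cont: "continuous_on {0..1} \<gamma>"
      using S1(1) S2(1) \<gamma>1 \<gamma>2 path_join_imp[of \<gamma>1 \<gamma>2]
      by (simp add: path_def pathstart_def pathfinish_def \<gamma>_def)
    \<comment> \<open>The junction 1/2 and the exceptional times of both curves, moved back through
      the two affine maps.\<close>
    define S where "S = insert (1/2) ((\<lambda>s. (s - 0) / 2) ` S1 \<union> (\<lambda>s. (s - (-1)) / 2) ` S2)"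
    have finS: "finite S" using S1(2) S2(2) by (simp add: S_def)
    have left: "2 * t + 0 \<in> {0<..<1} - S1" "\<forall>\<^sub>F s in nhds t. \<gamma> s = \<gamma>1 (2 * s + 0)"
      if "t \<in> {0<..<1} - S" "t < 1/2" for t
    proof -
      have "t \<in> S" if "2 * t + 0 \<in> S1"
        unfolding S_def using that by (intro insertI2 UnI1 image_eqI[of _ _ "2 * t + 0"]) auto
      then show "2 * t + 0 \<in> {0<..<1} - S1" using that by auto
      have "\<forall>\<^sub>F s in nhds t. s < 1/2"
        using eventually_nhds_in_open[OF open_lessThan, of t "1/2"] that by simp
      then show "\<forall>\<^sub>F s in nhds t. \<gamma> s = \<gamma>1 (2 * s + 0)"
        by eventually_elim (simp add: \<gamma>_simps)
    qed
    have right: "2 * t + (-1) \<in> {0<..<1} - S2" "\<forall>\<^sub>F s in nhds t. \<gamma> s = \<gamma>2 (2 * s + (-1))"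
      if "t \<in> {0<..<1} - S" "t > 1/2" for t
    proof -
      have "t \<in> S" if "2 * t + (-1) \<in> S2"
        unfolding S_def using that by (intro insertI2 UnI2 image_eqI[of _ _ "2 * t + (-1)"]) auto
      then show "2 * t + (-1) \<in> {0<..<1} - S2" using that by auto
      have "\<forall>\<^sub>F s in nhds t. s > 1/2"
        using eventually_nhds_in_open[OF open_greaterThan, of t "1/2"] that by simp
      then show "\<forall>\<^sub>F s in nhds t. \<gamma> s = \<gamma>2 (2 * s + (-1))"
        by eventually_elim (simp add: \<gamma>_simps)
    qed
    have "1/2 \<in> S" by (simp add: S_def)
    then have half: "t < 1/2 \<or> t > 1/2" if "t \<in> {0<..<1} - S" for t
      using that by (metis DiffD2 linorder_neqE)
    have pw: "piecewise_C1_curve A \<gamma>"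
    proof (rule piecewise_C1_curveI[OF cont finS])
      fix \<kappa> assume \<kappa>: "\<kappa> \<in> A"
      have ch: "is_chart \<kappa>" using A \<kappa> by (simp add: diff_atlas_def)
      define E where "E = ({0<..<1} - S) \<inter> \<gamma> -` fst \<kappa>"
      have "open ({0<..<1} - S)" using finS by (intro open_Diff finite_imp_closed) auto
      moreover have "continuous_on ({0<..<1} - S) \<gamma>" by (rule continuous_on_subset[OF cont]) auto
      ultimately have opE: "open E"
        unfolding E_def using is_chart_open(1)[OF ch] by (intro continuous_open_preimage)
      obtain D1 where D1: "\<And>t. t \<in> ({0<..<1} - S1) \<inter> \<gamma>1 -` fst \<kappa> \<Longrightarrow> (snd \<kappa> \<circ> \<gamma>1 has_vector_derivative D1 t) (at t)"
        "continuous_on (({0<..<1} - S1) \<inter> \<gamma>1 -` fst \<kappa>) D1"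
        using S1(3)[OF \<kappa>] unfolding C1_differentiable_on_def by blast
      obtain D2 where D2: "\<And>t. t \<in> ({0<..<1} - S2) \<inter> \<gamma>2 -` fst \<kappa> \<Longrightarrow> (snd \<kappa> \<circ> \<gamma>2 has_vector_derivative D2 t) (at t)"
        "continuous_on (({0<..<1} - S2) \<inter> \<gamma>2 -` fst \<kappa>) D2"
        using S2(3)[OF \<kappa>] unfolding C1_differentiable_on_def by blast
      define D where "D t = (if t < 1/2 then 2 *\<^sub>R D1 (2 * t + 0) else 2 *\<^sub>R D2 (2 * t + (-1)))" for t
      have lE: "2 * t + 0 \<in> ({0<..<1} - S1) \<inter> \<gamma>1 -` fst \<kappa>" if "t \<in> E \<inter> {..<1/2}" for t
        using left(1)[of t] that by (auto simp: E_def \<gamma>_simps)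
      have rE: "2 * t + (-1) \<in> ({0<..<1} - S2) \<inter> \<gamma>2 -` fst \<kappa>" if "t \<in> E \<inter> {1/2<..}" for t
        using right(1)[of t] that by (auto simp: E_def \<gamma>_simps)
      have aff: "(snd \<kappa> \<circ> \<gamma> has_vector_derivative 2 *\<^sub>R d) (at t)"
        if d: "(snd \<kappa> \<circ> \<gamma>' has_vector_derivative d) (at (2 * t + b))"
          and eq: "\<forall>\<^sub>F s in nhds t. \<gamma> s = \<gamma>' (2 * s + b)" for \<gamma>' d t b
        by (rule has_vector_derivative_reparam[OF d]) (use eq in \<open>auto elim!: eventually_mono\<close>)
      have "(snd \<kappa> \<circ> \<gamma> has_vector_derivative D t) (at t)" if t: "t \<in> E" for t
      proof (cases "t < 1/2")
        case True
        then show ?thesis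
          using aff[OF D1(1)[OF lE] left(2)] t by (simp add: D_def E_def)
      next
        case False
        then have "t > 1/2" using half[of t] t by (auto simp: E_def)
        then show ?thesis
          using aff[OF D2(1)[OF rE] right(2)] t by (simp add: D_def E_def)
      qed
      moreover have "continuous_on E D"
      proof -
        have "continuous_on (E \<inter> {..<1/2}) (\<lambda>t. 2 *\<^sub>R D1 (2 * t + 0))"
          by (intro continuous_intros continuous_on_compose2[OF D1(2)]) (use lE in blast)
        then have 1: "continuous_on (E \<inter> {..<1/2}) D"
          by (rule continuous_on_eq) (simp add: D_def)
        have "continuous_on (E \<inter> {1/2<..}) (\<lambda>t. 2 *\<^sub>R D2 (2 * t + (-1)))"
          by (intro continuous_intros continuous_on_compose2[OF D2(2)]) (use rE in blast)
        then have 2: "continuous_on (E \<inter> {1/2<..}) D"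
          by (rule continuous_on_eq) (simp add: D_def)
        have "continuous_on ((E \<inter> {..<1/2}) \<union> (E \<inter> {1/2<..})) D"
          using opE 1 2 by (intro continuous_on_open_Un open_Int) auto
        moreover have "(E \<inter> {..<1/2}) \<union> (E \<inter> {1/2<..}) = E"
        proof -
          have "E \<subseteq> {..<1/2} \<union> {1/2<..}" 
          proof
            fix t assume "t \<in> E"
            then have "t \<in> {0<..<1} - S" unfolding E_def by blast
            then show "t \<in> {..<1/2} \<union> {1/2<..}" using half unfolding Un_iff lessThan_iff greaterThan_iff by blast
          qed
          then show ?thesis by blast
        qed
        ultimately show ?thesis by simp
      qed
      ultimately show "(snd \<kappa> \<circ> \<gamma>) C1_differentiable_on (({0<..<1} - S) \<inter> \<gamma> -` fst \<kappa>)"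
        unfolding C1_differentiable_on_def E_def by blast
    qed
    define f where "f t = ennreal (riem_norm g (\<gamma> t) (velocity A \<gamma> t)) * indicator {0..1} t" for t
    define h1 where "h1 t = ennreal (riem_norm g (\<gamma>1 t) (velocity A \<gamma>1 t)) * indicator {0..1} t" for t
    define h2 where "h2 t = ennreal (riem_norm g (\<gamma>2 t) (velocity A \<gamma>2 t)) * indicator {0..1} t" for t
    have fin: "finite (S \<union> {0, 1})" using finS by simp
    have AE: "AE t in lborel. t \<notin> S \<union> {0, 1}"
      by (rule AE_not_in[OF finite_imp_null_set_lborel[OF fin]])
    have f1: "f t = ennreal 2 * h1 (0 + 2 * t)" if "t \<notin> S \<union> {0, 1}" "t \<in> {0..<1/2}" for t
    proof -
      have t: "t \<in> {0<..<1} - S" "t < 1/2" using that by auto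
      note l = left[OF t]
      obtain \<kappa> d where kd: "\<kappa> \<in> charts_at A (\<gamma>1 (2 * t + 0))" "(snd \<kappa> \<circ> \<gamma>1 has_vector_derivative d) (at (2 * t + 0))"
        using curve_derivative_obtain[OF A S1(3) l(1)] by blast
      have "isCont \<gamma>1 (2 * t + 0)" using l(1) by (intro S1(4)) auto
      from speed_reparam[OF A g this l(2) kd] show ?thesis
        using t by (simp add: f_def h1_def ennreal_mult')
    qed
    have f2: "f t = ennreal 2 * h2 (-1 + 2 * t)" if "t \<notin> S \<union> {0, 1}" "t \<in> {1/2<..1}" for t
    proof -
      have t: "t \<in> {0<..<1} - S" "t > 1/2" using that by auto
      note l = right[OF t]
      obtain \<kappa> d where kd: "\<kappa> \<in> charts_at A (\<gamma>2 (2 * t + (-1)))" "(snd \<kappa> \<circ> \<gamma>2 has_vector_derivative d) (at (2 * t + (-1)))"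
        using curve_derivative_obtain[OF A S2(3) l(1)] by blast
      have "isCont \<gamma>2 (2 * t + (-1))" using l(1) by (intro S2(4)) auto
      from speed_reparam[OF A g this l(2) kd] show ?thesis
        using t by (simp add: f_def h2_def ennreal_mult' add.commute)
    qed
    have "riem_dist A g p r \<le> curve_length A g \<gamma>"
      using \<gamma>1 \<gamma>2 by (intro riem_dist_le_curve_length[OF pw]) (auto simp: \<gamma>_simps)
    also have "\<dots> = (\<integral>\<^sup>+t. f t \<partial>lborel)" by (simp add: curve_length_def f_def)
    also have "\<dots> \<le> (\<integral>\<^sup>+t. f t * indicator {..1/2} t \<partial>lborel) + (\<integral>\<^sup>+t. f t * indicator (- {..1/2}) t \<partial>lborel)"
      by (rule nn_integral_split_le) simp
    also have "(\<integral>\<^sup>+t. f t * indicator {..1/2} t \<partial>lborel) \<le> (\<integral>\<^sup>+t. ennreal 2 * h1 (0 + 2 * t) \<partial>lborel)"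
    proof (rule nn_integral_mono_AE, use AE in eventually_elim)
      fix t assume t: "t \<notin> S \<union> {0, 1}"
      have "t \<noteq> 1/2" using t \<open>1/2 \<in> S\<close> by blast
      then show "f t * indicator {..1/2} t \<le> ennreal 2 * h1 (0 + 2 * t)"
        using f1[OF t] by (cases "t \<in> {0..<1/2}") (auto simp: f_def indicator_def)
    qed
    also have "\<dots> \<le> (\<integral>\<^sup>+t. h1 t \<partial>lborel)" by (rule nn_integral_affine_le) simp
    also have "(\<integral>\<^sup>+t. f t * indicator (- {..1/2}) t \<partial>lborel) \<le> (\<integral>\<^sup>+t. ennreal 2 * h2 (-1 + 2 * t) \<partial>lborel)"
    proof (rule nn_integral_mono_AE, use AE in eventually_elim)
      fix t assume t: "t \<notin> S \<union> {0, 1}"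
      show "f t * indicator (- {..1/2}) t \<le> ennreal 2 * h2 (-1 + 2 * t)"
        using f2[OF t] by (cases "t \<in> {1/2<..1}") (auto simp: f_def indicator_def)
    qed
    also have "\<dots> \<le> (\<integral>\<^sup>+t. h2 t \<partial>lborel)" by (rule nn_integral_affine_le) simp
    finally show ?thesis by (simp add: curve_length_def h1_def h2_def add_mono)
  qed
  show ?thesis
  proof (rule ennreal_le_epsilon)
    fix e :: real assume fin: "riem_dist A g p q + riem_dist A g q r < top" and e: "0 < e"
    have "riem_dist A g p q < riem_dist A g p q + ennreal (e/2)"
      using fin e by (intro ennreal_less_add_pos) auto
    then obtain \<gamma>1 where 1: "piecewise_C1_curve A \<gamma>1" "\<gamma>1 0 = p" "\<gamma>1 1 = q"
      "curve_length A g \<gamma>1 < riem_dist A g p q + ennreal (e/2)"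
      unfolding riem_dist_def[of A g p q] INF_less_iff by blast
    have "riem_dist A g q r < riem_dist A g q r + ennreal (e/2)"
      using fin e by (intro ennreal_less_add_pos) auto
    then obtain \<gamma>2 where 2: "piecewise_C1_curve A \<gamma>2" "\<gamma>2 0 = q" "\<gamma>2 1 = r"
      "curve_length A g \<gamma>2 < riem_dist A g q r + ennreal (e/2)"
      unfolding riem_dist_def[of A g q r] INF_less_iff by blast
    have "riem_dist A g p r \<le> curve_length A g \<gamma>1 + curve_length A g \<gamma>2"
      by (rule join[OF 1(1-3) 2(1-3)])
    also have "\<dots> \<le> (riem_dist A g p q + ennreal (e/2)) + (riem_dist A g q r + ennreal (e/2))"
      using 1(4) 2(4) by (intro add_mono) auto
    also have "\<dots> = riem_dist A g p q + riem_dist A g q r + (ennreal (e/2) + ennreal (e/2))"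
      by (simp add: ac_simps)
    also have "ennreal (e/2) + ennreal (e/2) = ennreal e"
      using e by (simp add: ennreal_plus[symmetric] del: ennreal_plus)
    finally show "riem_dist A g p r \<le> riem_dist A g p q + riem_dist A g q r + ennreal e" .
  qed
qed

text \<open>The straight segment in the chart is the competitor; its coordinate velocity is the
  constant \<open>s' - s\<close>.\<close>

lemma riem_dist_segment_le:
  fixes A :: "('m::{t2_space, second_countable_topology}, 'e::finite_dim_inner) chart set"
  assumes A: "smooth_manifold A" and \<kappa>: "\<kappa> \<in> A"
    and seg: "closed_segment s s' \<subseteq> snd \<kappa> ` fst \<kappa>"
    and bound: "\<And>x. x \<in> closed_segment s s' \<Longrightarrow> sqrt (chart_form A g \<kappa> x (s' - s) (s' - s)) \<le> M"
  shows "riem_dist A g (chart_inv \<kappa> s) (chart_inv \<kappa> s') \<le> ennreal M"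
proof -
  have D: "diff_atlas A" by (rule smooth_manifold_imp_diff_atlas[OF A])
  have ch: "is_chart \<kappa>" using D \<kappa> by (simp add: diff_atlas_def)
  define l where "l t = s + t *\<^sub>R (s' - s)" for t :: real
  have lseg: "l t \<in> closed_segment s s'" if "t \<in> {0..1}" for t
    unfolding closed_segment_def l_def using that
    by (intro CollectI exI[of _ t]) (auto simp: algebra_simps)
  then have lim: "l t \<in> snd \<kappa> ` fst \<kappa>" if "t \<in> {0..1}" for t using seg that by blast
  have dl: "(l has_derivative (\<lambda>h. h *\<^sub>R (s' - s))) (at t)" for t
    unfolding l_def by (auto intro!: derivative_eq_intros)
  have cl: "continuous_on X l" for X unfolding l_def by (intro continuous_intros)
  define \<gamma> where "\<gamma> t = chart_inv \<kappa> (l t)" for t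
  have \<gamma>in: "\<gamma> t \<in> fst \<kappa>" "snd \<kappa> (\<gamma> t) = l t" if "t \<in> {0..1}" for t
    using is_chart_inv_in[OF ch lim[OF that]] is_chart_inv_right[OF ch lim[OF that]] by (auto simp: \<gamma>_def)
  have cont: "continuous_on {0..1} \<gamma>"
    unfolding \<gamma>_def
    by (rule continuous_on_compose2[OF is_chart_cont_inv[OF ch] cl]) (use lim in blast)
  have pw: "piecewise_C1_curve A \<gamma>"
  proof (rule piecewise_C1_curveI[OF cont, of "{}"])
    \<comment> \<open>The C1 condition is required in every chart, so the segment is composed with
      the transition map, whose derivative is continuous by smoothness of the atlas.\<close>
    fix \<mu> assume \<mu>: "\<mu> \<in> A"
    define E where "E = ({0<..<1} - {}) \<inter> \<gamma> -` fst \<mu>"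
    let ?f = "snd \<mu> \<circ> chart_inv \<kappa>"
    have sm: "smooth_on (snd \<kappa> ` (fst \<kappa> \<inter> fst \<mu>)) ?f"
      using A \<kappa> \<mu> by (simp add: smooth_manifold_def)
    have lE: "l t \<in> snd \<kappa> ` (fst \<kappa> \<inter> fst \<mu>)" if "t \<in> E" for t
    proof -
      have t: "t \<in> {0..1}" "\<gamma> t \<in> fst \<mu>" using that by (auto simp: E_def)
      then show ?thesis using \<gamma>in[OF t(1)] by (metis IntI imageI)
    qed
    have "(snd \<mu> \<circ> \<gamma> has_vector_derivative frechet_derivative ?f (at (l t)) (s' - s)) (at t)" if "t \<in> E" for t
    proof -
      have f: "(?f has_derivative frechet_derivative ?f (at (l t))) (at (l t))"
        using smooth_onD(1)[OF sm lE[OF that]] by (simp add: frechet_derivative_works)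
      have "((\<lambda>t. ?f (l t)) has_derivative (\<lambda>h. frechet_derivative ?f (at (l t)) (h *\<^sub>R (s' - s)))) (at t)"
        by (rule has_derivative_compose[OF dl f])
      then show ?thesis
        by (simp add: has_vector_derivative_def \<gamma>_def o_def linear_cmul[OF has_derivative_linear[OF f], unfolded o_def])
    qed
    moreover have "continuous_on E (\<lambda>t. frechet_derivative ?f (at (l t)) (s' - s))"
      by (rule continuous_on_compose2[OF smooth_onD(2)[OF sm] cl]) (use lE in blast)
    ultimately show "(snd \<mu> \<circ> \<gamma>) C1_differentiable_on (({0<..<1} - {}) \<inter> \<gamma> -` fst \<mu>)"
      unfolding C1_differentiable_on_def E_def by (intro exI conjI) auto
  qed simp
  have speed: "ennreal (riem_norm g (\<gamma> t) (velocity A \<gamma> t)) \<le> ennreal M" if t: "t \<in> {0<..<1}" for t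
  proof -
    have t': "t \<in> {0..1}" using t by simp
    have c: "isCont \<gamma> t" using continuous_on_interior[OF cont] t by simp
    have ca: "\<kappa> \<in> charts_at A (\<gamma> t)" using \<kappa> \<gamma>in[OF t'] by (simp add: charts_at_def)
    have "\<forall>\<^sub>F x in nhds t. x \<in> {0<..<1}" by (rule eventually_nhds_in_open[OF _ t]) simp
    then have "\<forall>\<^sub>F x in nhds t. l x = (snd \<kappa> \<circ> \<gamma>) x" by eventually_elim (simp add: \<gamma>in)
    with dl have "(snd \<kappa> \<circ> \<gamma> has_derivative (\<lambda>h. h *\<^sub>R (s' - s))) (at t)"
      by (rule has_derivative_nhds_cong)
    then have "(snd \<kappa> \<circ> \<gamma> has_vector_derivative (s' - s)) (at t)" by (simp add: has_vector_derivative_def)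
    from riem_norm_velocity[OF D c ca this, of g] bound[OF lseg[OF t']]
    show ?thesis by (simp add: \<gamma>in[OF t'] ennreal_leI)
  qed
  have "riem_dist A g (chart_inv \<kappa> s) (chart_inv \<kappa> s') \<le> curve_length A g \<gamma>"
    by (rule riem_dist_le_curve_length[OF pw]) (simp_all add: \<gamma>_def l_def)
  also have "\<dots> \<le> (\<integral>\<^sup>+t. ennreal M * indicator {0..1} (t::real) \<partial>lborel)"
    unfolding curve_length_def
  proof (rule nn_integral_mono_AE)
    have "AE t in lborel. t \<notin> {0, 1::real}"
      by (rule AE_not_in[OF finite_imp_null_set_lborel]) simp
    then show "AE t in lborel. ennreal (riem_norm g (\<gamma> t) (velocity A \<gamma> t)) * indicator {0..1} t \<le>
        ennreal M * indicator {0..1} t"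
    proof eventually_elim
      case (elim t)
      then show ?case using speed[of t] by (cases "t \<in> {0..1}") (auto simp: indicator_def)
    qed
  qed
  also have "\<dots> = ennreal M" by (simp add: nn_integral_cmult)
  finally show ?thesis .
qed

text \<open>Only the coordinate along the total displacement \<open>u\<close> is followed, rescaled.
  By Cauchy-Schwarz its rate of growth is at most \<open>C\<close> times the \<open>b\<close>-norm
  of the coordinate velocity, which is at most the speed, and its total increase is
  \<open>C * sqrt (b u u)\<close>. Stopping at \<open>T\<close> keeps the curve in the region where
  the metrics compare.\<close>

lemma curve_length_ge:
  fixes A :: "('m::t2_space, 'e::finite_dim_inner) chart set"
  assumes A: "diff_atlas A" and \<kappa>: "\<kappa> \<in> A" and form: "inner_form b"
    and \<gamma>: "piecewise_C1_curve A \<gamma>" and T: "0 \<le> T" "T \<le> 1"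
    and inU: "\<And>t. t \<in> {0..T} \<Longrightarrow> \<gamma> t \<in> fst \<kappa>"
    and low: "\<And>t a. t \<in> {0..T} \<Longrightarrow> C * sqrt (b a a) \<le> sqrt (chart_form A g \<kappa> (snd \<kappa> (\<gamma> t)) a a)"
    and C: "C > 0"
  shows "ennreal (C * sqrt (b (snd \<kappa> (\<gamma> T) - snd \<kappa> (\<gamma> 0)) (snd \<kappa> (\<gamma> T) - snd \<kappa> (\<gamma> 0)))) \<le> curve_length A g \<gamma>"
proof -
  interpret inner_form b by (rule form)
  have ch: "is_chart \<kappa>" using A \<kappa> by (simp add: diff_atlas_def)
  obtain S where S: "continuous_on {0..1} \<gamma>" "finite S"
      "\<And>\<kappa>. \<kappa> \<in> A \<Longrightarrow> (snd \<kappa> \<circ> \<gamma>) C1_differentiable_on (({0<..<1} - S) \<inter> \<gamma> -` fst \<kappa>)"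
      "\<And>t. t \<in> {0<..<1} \<Longrightarrow> isCont \<gamma> t"
    using piecewise_C1_curveE[OF \<gamma>] by metis
  obtain D where D: "\<And>t. t \<in> ({0<..<1} - S) \<inter> \<gamma> -` fst \<kappa> \<Longrightarrow> (snd \<kappa> \<circ> \<gamma> has_vector_derivative D t) (at t)"
    "continuous_on (({0<..<1} - S) \<inter> \<gamma> -` fst \<kappa>) D"
    using S(3)[OF \<kappa>] unfolding C1_differentiable_on_def by blast
  define u where "u = snd \<kappa> (\<gamma> T) - snd \<kappa> (\<gamma> 0)"
  show ?thesis
  proof (cases "u = 0")
    case True
    then show ?thesis by (simp add: u_def[symmetric] left_simps)
  next
    case False
    then have nu: "n u > 0" by (rule n_pos)
    have blu: "bounded_linear (\<lambda>a. b a u)" by (rule linear_imp_bounded_linear[OF linear_left])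
    \<comment> \<open>Gives the functional \<open>\<lambda>a. c * b a u\<close> the norm
      \<open>C\<close> with respect to \<open>n\<close>.\<close>
    define c where "c = C / n u"
    have c: "c > 0" using C nu by (simp add: c_def)
    define \<phi> where "\<phi> t = c * b (snd \<kappa> (\<gamma> t)) u" for t
    define \<psi> where "\<psi> t = c * b (D t) u" for t
    have sub: "{0<..<T} - S \<subseteq> ({0<..<1} - S) \<inter> \<gamma> -` fst \<kappa>" using T inU by auto
    have "ennreal (\<phi> T - \<phi> 0) \<le> (\<integral>\<^sup>+t\<in>{0..T}. ennreal (riem_norm g (\<gamma> t) (velocity A \<gamma> t)) \<partial>lborel)"
    proof (rule nn_integral_ge_increment[OF T(1) S(2)])
      have "continuous_on {0..T} \<gamma>" using T by (intro continuous_on_subset[OF S(1)]) auto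
      then have "continuous_on {0..T} (\<lambda>t. snd \<kappa> (\<gamma> t))"
        by (rule continuous_on_compose2[OF is_chart_cont[OF ch]]) (use inU in blast)
      then show "continuous_on {0..T} \<phi>"
        unfolding \<phi>_def by (intro continuous_intros bounded_linear.continuous_on[OF blu])
      show "continuous_on ({0<..<T} - S) \<psi>"
        unfolding \<psi>_def using continuous_on_subset[OF D(2) sub]
        by (intro continuous_intros bounded_linear.continuous_on[OF blu])
      fix t assume t: "t \<in> {0<..<T} - S"
      have d: "(snd \<kappa> \<circ> \<gamma> has_vector_derivative D t) (at t)" using D(1) sub t by blast
      have "((\<lambda>t. b ((snd \<kappa> \<circ> \<gamma>) t) u) has_vector_derivative b (D t) u) (at t)"
        by (rule bounded_linear.has_vector_derivative[OF blu d])
      from bounded_linear.has_vector_derivative[OF bounded_linear_mult_right[of c] this]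
      show "(\<phi> has_vector_derivative \<psi> t) (at t)" by (simp add: \<phi>_def[abs_def] \<psi>_def)
      have t': "t \<in> {0..T}" "t \<in> {0<..<1}" using t T by auto
      have ca: "\<kappa> \<in> charts_at A (\<gamma> t)" using \<kappa> inU[OF t'(1)] by (simp add: charts_at_def)
      have "\<bar>b (D t) u\<bar> \<le> n (D t) * n u"
        using cauchy_schwarz[of "D t" u] cauchy_schwarz[of "- D t" u]
        by (simp add: abs_le_iff left_simps n_minus)
      then have "\<bar>\<psi> t\<bar> \<le> c * (n (D t) * n u)"
        using c by (simp add: \<psi>_def abs_mult)
      also have "\<dots> = C * sqrt (b (D t) (D t))" using nu by (simp add: c_def n_def)
      also have "\<dots> \<le> riem_norm g (\<gamma> t) (velocity A \<gamma> t)"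
        using low[OF t'(1), of "D t"] riem_norm_velocity[OF A S(4)[OF t'(2)] ca d, of g] by simp
      finally show "ennreal \<bar>\<psi> t\<bar> \<le> ennreal (riem_norm g (\<gamma> t) (velocity A \<gamma> t))" by (rule ennreal_leI)
    qed
    also have "\<dots> \<le> curve_length A g \<gamma>"
      unfolding curve_length_def using T by (intro nn_integral_mono mult_left_mono) (auto simp: indicator_def)
    also have "\<phi> T - \<phi> 0 = c * b u u"
      by (simp add: \<phi>_def u_def left_simps right_diff_distrib)
    also have "\<dots> = C * n u" using nu by (simp add: c_def n_sq[symmetric] power2_eq_square)
    finally show ?thesis by (simp add: u_def n_def)
  qed
qed

text \<open>The lower bound speaks of all points outside a coordinate ball, including those outside
  the chart, because a minimiser could a priori lie anywhere on the manifold. It holds since every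
  curve from \<open>p\<close> to such a point has to leave the ball and is already long enough at
  its first exit.\<close>

lemma riem_dist_local:
  fixes A :: "('m::{t2_space, second_countable_topology}, 'e::finite_dim_inner) chart set"
  assumes A: "smooth_manifold A" and g: "riemannian_metric A g" and \<kappa>: "\<kappa> \<in> charts_at A p"
    and e: "0 < \<epsilon>" "\<epsilon> < 1"
  defines "n \<equiv> inner_form.n (chart_form A g \<kappa> (snd \<kappa> p))"
  obtains \<rho>0 where "\<rho>0 > 0" "\<And>s. n (s - snd \<kappa> p) \<le> \<rho>0 \<Longrightarrow> s \<in> snd \<kappa> ` fst \<kappa>"
    "\<And>s s'. n (s - snd \<kappa> p) \<le> \<rho>0 \<Longrightarrow> n (s' - snd \<kappa> p) \<le> \<rho>0 \<Longrightarrow>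
       riem_dist A g (chart_inv \<kappa> s) (chart_inv \<kappa> s') \<le> ennreal ((1 + \<epsilon>) * n (s' - s))"
    "\<And>q \<rho>. 0 \<le> \<rho> \<Longrightarrow> \<rho> \<le> \<rho>0 \<Longrightarrow> q \<in> fst \<kappa> \<longrightarrow> \<rho> \<le> n (snd \<kappa> q - snd \<kappa> p) \<Longrightarrow>
       ennreal ((1 - \<epsilon>) * \<rho>) \<le> riem_dist A g p q"
proof -
  have D: "diff_atlas A" by (rule smooth_manifold_imp_diff_atlas[OF A])
  note k = charts_at_chart[OF D \<kappa>]
  have ch: "is_chart \<kappa>" and p: "p \<in> fst \<kappa>" using k by auto
  have \<kappa>A: "\<kappa> \<in> A" using \<kappa> by (simp add: charts_at_def)
  define s0 where "s0 = snd \<kappa> p"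
  have s0: "s0 \<in> snd \<kappa> ` fst \<kappa>" using p by (simp add: s0_def)
  let ?B = "chart_form A g \<kappa>"
  have form: "inner_form (?B s0)" by (rule inner_form_chart_form[OF D g \<kappa>A s0])
  interpret F: inner_form "?B s0" by (rule form)
  have n_eq: "n = F.n" by (simp add: n_def s0_def)
  have n_sqrt: "sqrt (?B s0 a a) = n a" for a by (simp add: n_eq F.n_def)
  obtain m where m: "m > 0" "\<And>a. m * norm a \<le> n a" using F.n_lower unfolding n_eq by blast
  obtain \<delta> where \<delta>: "\<delta> > 0" "\<And>s. dist s s0 < \<delta> \<Longrightarrow> s \<in> snd \<kappa> ` fst \<kappa> \<and>
    (\<forall>a. (1 - \<epsilon>) * n a \<le> sqrt (?B s a a) \<and> sqrt (?B s a a) \<le> (1 + \<epsilon>) * n a)"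
    using chart_form_comparison[OF D g \<kappa>A s0 e] unfolding eventually_nhds_metric n_sqrt by blast
  \<comment> \<open>By \<open>m * norm a \<le> n a\<close>, the radius \<open>\<rho>0\<close> in the
    metric norm stays within \<open>\<delta> / 2\<close> in the norm of the type.\<close>
  define \<rho>0 where "\<rho>0 = m * \<delta> / 2"
  have \<rho>0: "\<rho>0 > 0" using m \<delta> by (simp add: \<rho>0_def)
  have near: "dist s s0 < \<delta>" if "n (s - s0) \<le> \<rho>0" for s
  proof -
    have "m * norm (s - s0) \<le> m * (\<delta> / 2)" using m(2)[of "s - s0"] that by (simp add: \<rho>0_def)
    then have "norm (s - s0) \<le> \<delta> / 2" using m(1) by simp
    then show ?thesis using \<delta>(1) by (simp add: dist_norm)
  qed
  have img: "s \<in> snd \<kappa> ` fst \<kappa>"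
    and cmp: "(1 - \<epsilon>) * n a \<le> sqrt (?B s a a)" "sqrt (?B s a a) \<le> (1 + \<epsilon>) * n a"
    if "n (s - s0) \<le> \<rho>0" for s a
    using \<delta>(2)[OF near[OF that]] by auto
  have cvx: "n (x - s0) \<le> \<rho>" if x: "x \<in> closed_segment s s'" and "n (s - s0) \<le> \<rho>" "n (s' - s0) \<le> \<rho>" for x s s' \<rho>
  proof -
    obtain u where u: "0 \<le> u" "u \<le> 1" "x = (1 - u) *\<^sub>R s + u *\<^sub>R s'" using x by (auto simp: closed_segment_def)
    have "x - s0 = (1 - u) *\<^sub>R (s - s0) + u *\<^sub>R (s' - s0)" using u by (simp add: algebra_simps)
    then have "n (x - s0) \<le> (1 - u) * n (s - s0) + u * n (s' - s0)"
      using F.n_triangle[of "(1 - u) *\<^sub>R (s - s0)" "u *\<^sub>R (s' - s0)"] u by (simp add: n_eq F.n_scale)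
    also have "\<dots> \<le> (1 - u) * \<rho> + u * \<rho>" using that u by (intro add_mono mult_left_mono) auto
    finally show ?thesis by (simp add: algebra_simps)
  qed
  show thesis
  proof (rule that[OF \<rho>0])
    show "s \<in> snd \<kappa> ` fst \<kappa>" if "n (s - snd \<kappa> p) \<le> \<rho>0" for s using img that by (simp add: s0_def)
    show "riem_dist A g (chart_inv \<kappa> s) (chart_inv \<kappa> s') \<le> ennreal ((1 + \<epsilon>) * n (s' - s))"
      if "n (s - snd \<kappa> p) \<le> \<rho>0" "n (s' - snd \<kappa> p) \<le> \<rho>0" for s s'
    proof (rule riem_dist_segment_le[OF A \<kappa>A])
      show "closed_segment s s' \<subseteq> snd \<kappa> ` fst \<kappa>"
        using cvx[of _ s s' \<rho>0] img that by (auto simp: s0_def)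
      show "sqrt (?B x (s' - s) (s' - s)) \<le> (1 + \<epsilon>) * n (s' - s)" if "x \<in> closed_segment s s'" for x
        using cvx[OF that, of \<rho>0] cmp(2) \<open>n (s - snd \<kappa> p) \<le> \<rho>0\<close> \<open>n (s' - snd \<kappa> p) \<le> \<rho>0\<close> by (simp add: s0_def)
    qed
    fix q \<rho> assume \<rho>: "0 \<le> \<rho>" "\<rho> \<le> \<rho>0" and q: "q \<in> fst \<kappa> \<longrightarrow> \<rho> \<le> n (snd \<kappa> q - snd \<kappa> p)"
    show "ennreal ((1 - \<epsilon>) * \<rho>) \<le> riem_dist A g p q"
      unfolding riem_dist_def
    proof (rule INF_greatest)
      fix \<gamma> assume "\<gamma> \<in> {\<gamma>. piecewise_C1_curve A \<gamma> \<and> \<gamma> 0 = p \<and> \<gamma> 1 = q}"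
      then have \<gamma>: "piecewise_C1_curve A \<gamma>" "\<gamma> 0 = p" "\<gamma> 1 = q" by auto
      have cont: "continuous_on {0..1} \<gamma>" using \<gamma>(1) by (simp add: piecewise_C1_curve_def)
      define U where "U = fst \<kappa> \<inter> (\<lambda>x. n (snd \<kappa> x - s0)) -` {..<\<rho>}"
      define K where "K = chart_inv \<kappa> ` {s. n (s - s0) \<le> \<rho>}"
      have cn: "continuous_on X (\<lambda>s. n (s - s0))" for X
        unfolding n_eq by (rule continuous_on_compose2[OF F.continuous_n]) (auto intro!: continuous_intros)
      have "open U" unfolding U_def
        by (rule continuous_open_preimage[OF continuous_on_compose2[OF cn is_chart_cont[OF ch]] is_chart_open(1)[OF ch]]) auto
      have "compact {s. n (s - s0) \<le> \<rho>}"
        unfolding compact_eq_bounded_closed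
      proof
        have "{s. n (s - s0) \<le> \<rho>} \<subseteq> ball s0 \<delta>" using near \<rho> by (auto simp: dist_commute)
        then show "bounded {s. n (s - s0) \<le> \<rho>}" by (rule bounded_subset[OF bounded_ball])
        show "closed {s. n (s - s0) \<le> \<rho>}" by (rule closed_Collect_le[OF cn]) simp
      qed
      \<comment> \<open>Compactness makes \<open>K\<close> closed in the whole Hausdorff manifold,
        not merely in the chart domain. So the curve is still in the chart at the exit time
        itself.\<close>
      then have "compact K" unfolding K_def
        by (intro compact_continuous_image continuous_on_subset[OF is_chart_cont_inv[OF ch]]) (use img \<rho> in auto)
      then have "closed K" by (rule compact_imp_closed)
      have UK: "U \<subseteq> K"
      proof
        fix x assume "x \<in> U"
        then have "x = chart_inv \<kappa> (snd \<kappa> x)" "snd \<kappa> x \<in> {s. n (s - s0) \<le> \<rho>}"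
          using is_chart_inv[OF ch, of x] by (auto simp: U_def)
        then show "x \<in> K" unfolding K_def by (rule image_eqI)
      qed
      have qU: "q \<notin> U" using q by (auto simp: U_def s0_def)
      \<comment> \<open>\<open>E\<close> is closed and contains 1, so its infimum is attained: the
        first time at which the curve is outside the open ball \<open>U\<close>.\<close>
      define E where "E = {0..1} \<inter> \<gamma> -` (- U)"
      have "closed E" unfolding E_def using \<open>open U\<close> by (intro continuous_closed_preimage[OF cont]) auto
      moreover have "1 \<in> E" using qU \<gamma> by (simp add: E_def)
      moreover have bdd: "bdd_below E" by (rule bdd_belowI[of _ 0]) (simp add: E_def)
      ultimately have "Inf E \<in> E" by (intro closed_contains_Inf) auto
      define T where "T = Inf E"
      have T: "0 \<le> T" "T \<le> 1" "\<gamma> T \<notin> U" using \<open>Inf E \<in> E\<close> by (auto simp: E_def T_def)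
      have before: "\<gamma> t \<in> U" if "0 \<le> t" "t < T" for t
      proof (rule ccontr)
        assume "\<gamma> t \<notin> U"
        then have "t \<in> E" using that T by (simp add: E_def)
        then have "T \<le> t" unfolding T_def by (rule cInf_lower[OF _ bdd])
        then show False using that by simp
      qed
      have inK: "\<gamma> t \<in> K" if "t \<in> {0..T}" for t
      proof (cases "T = 0")
        case True
        have "s0 \<in> {s. n (s - s0) \<le> \<rho>}" using \<rho> by (simp add: n_eq)
        then have "chart_inv \<kappa> s0 \<in> K" unfolding K_def by blast
        moreover have "chart_inv \<kappa> s0 = p" using is_chart_inv[OF ch p] by (simp add: s0_def)
        ultimately show ?thesis using True that \<gamma> by simp
      next
        case False
        then have "0 < T" using T by simp
        have "closed ({0..T} \<inter> \<gamma> -` K)"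
          using \<open>closed K\<close> T by (intro continuous_closed_preimage[OF continuous_on_subset[OF cont]]) auto
        moreover have "{0..<T} \<subseteq> {0..T} \<inter> \<gamma> -` K" using subsetD[OF UK before] by auto
        ultimately have "closure {0..<T} \<subseteq> {0..T} \<inter> \<gamma> -` K" by (rule closure_minimal[rotated])
        then show ?thesis using that \<open>0 < T\<close> by auto
      qed
      have inB: "\<gamma> t \<in> fst \<kappa> \<and> n (snd \<kappa> (\<gamma> t) - s0) \<le> \<rho>" if "t \<in> {0..T}" for t
      proof -
        obtain s where s: "n (s - s0) \<le> \<rho>" "\<gamma> t = chart_inv \<kappa> s" using inK[OF \<open>t \<in> {0..T}\<close>] by (auto simp: K_def)
        then have "s \<in> snd \<kappa> ` fst \<kappa>" using img \<rho> by auto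
        then show ?thesis using s is_chart_inv_in[OF ch] is_chart_inv_right[OF ch] by simp
      qed
      have "n (snd \<kappa> (\<gamma> T) - s0) = \<rho>"
        using inB[of T] T by (auto simp: U_def)
      moreover have "ennreal ((1 - \<epsilon>) * sqrt (?B s0 (snd \<kappa> (\<gamma> T) - snd \<kappa> (\<gamma> 0)) (snd \<kappa> (\<gamma> T) - snd \<kappa> (\<gamma> 0))))
          \<le> curve_length A g \<gamma>"
      proof (rule curve_length_ge[OF D \<kappa>A form \<gamma>(1) T(1,2)])
        show "\<gamma> t \<in> fst \<kappa>" if "t \<in> {0..T}" for t using inB[OF that] by simp
        show "(1 - \<epsilon>) * sqrt (?B s0 a a) \<le> sqrt (?B (snd \<kappa> (\<gamma> t)) a a)" if "t \<in> {0..T}" for t a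
          using inB[OF that] cmp(1)[of "snd \<kappa> (\<gamma> t)" a] \<rho> by (simp add: n_sqrt)
      qed (use e in simp)
      ultimately show "ennreal ((1 - \<epsilon>) * \<rho>) \<le> curve_length A g \<gamma>"
        by (simp add: n_sqrt \<gamma>(2) s0_def[symmetric])
    qed
  qed
qed


section \<open>Minimisers on a graph\<close>

lemma has_derivative_eventually_le:
  assumes "(f has_derivative f') (at x)" "e > 0"
  shows "\<forall>\<^sub>F y in nhds x. norm (f y - f x - f' (y - x)) \<le> e * norm (y - x)"
  using assms unfolding has_derivative_at_alt eventually_nhds_metric dist_norm by blast

context inner_form
begin

lemma n_orthogonal_add:
  assumes "B x y = 0"
  shows "(n (x + y))\<^sup>2 = (n x)\<^sup>2 + (n y)\<^sup>2"
  using assms by (simp add: n_sq left_simps right_simps sym[of y x])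

lemma n_reverse_triangle: "n x - n y \<le> n (x - y)"
  using n_triangle[of "x - y" y] by simp

text \<open>Pythagoras makes the error of \<open>k\<close> a square root: a length excess
  \<open>\<sigma> * h\<close> allows \<open>(n k)\<^sup>2\<close> up to
  \<open>\<sigma> * (2 * \<Lambda> + 1) * h\<^sup>2\<close>. So \<open>\<sigma>\<close> has to be of
  the order \<open>\<tau>\<^sup>2\<close>.\<close>

lemma tangential_part_small:
  assumes orth: "B l k = 0" and "n (l + k) \<le> n l + \<sigma> * h" "n l \<le> \<Lambda> * h"
    and "0 \<le> h" "0 \<le> \<sigma>" "\<sigma> \<le> 1" "0 \<le> \<Lambda>" "0 \<le> \<tau>" "\<sigma> * (2 * \<Lambda> + 1) \<le> \<tau>\<^sup>2"
  shows "n k \<le> \<tau> * h"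
proof (rule power2_le_imp_le)
  have "(n l)\<^sup>2 + (n k)\<^sup>2 \<le> (n l + \<sigma> * h)\<^sup>2"
    unfolding n_orthogonal_add[OF orth, symmetric] using assms(2) n_nonneg by (intro power_mono)
  then have "(n k)\<^sup>2 \<le> 2 * (n l * (\<sigma> * h)) + (\<sigma> * h)\<^sup>2"
    by (simp add: power2_sum)
  also have "n l * (\<sigma> * h) \<le> \<Lambda> * h * (\<sigma> * h)" using assms by (intro mult_right_mono) auto
  also have "(\<sigma> * h)\<^sup>2 \<le> \<sigma> * h\<^sup>2"
    unfolding power_mult_distrib using assms(5,6)
    by (intro mult_right_mono) (auto simp: power2_eq_square mult_left_le)
  also have "2 * (\<Lambda> * h * (\<sigma> * h)) + \<sigma> * h\<^sup>2 = \<sigma> * (2 * \<Lambda> + 1) * h\<^sup>2"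
    by (simp add: power2_eq_square algebra_simps)
  also have "\<dots> \<le> \<tau>\<^sup>2 * h\<^sup>2" using assms by (intro mult_right_mono) auto
  finally show "(n k)\<^sup>2 \<le> (\<tau> * h)\<^sup>2" by (simp add: power_mult_distrib)
qed (use assms in simp)

text \<open>\<open>m a\<close> is almost as close to \<open>b0\<close> as \<open>\<Phi> (a, P b0)\<close>, whose displacement from \<open>b0\<close> is
  \<open>\<Phi>' (h, 0)\<close> to first order and orthogonal to \<open>P (m a - b0)\<close>. By Pythagoras the latter has to
  vanish to first order.\<close>

lemma minimiser_has_derivative:
  fixes \<Phi> :: "'a::finite_dim_inner \<times> 'e \<Rightarrow> 'e"
  assumes P: "linear P" "\<And>x. P (P x) = P x" and orth: "\<And>x k. P k = k \<Longrightarrow> B (x - P x) k = 0"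
    and \<Phi>0: "\<Phi> (a0, P b0) = b0" and d\<Phi>: "(\<Phi> has_derivative \<Phi>') (at (a0, P b0))"
    and \<Phi>'K: "\<And>k. P k = k \<Longrightarrow> \<Phi>' (0, k) = k" and \<Phi>'P: "\<And>h. P (\<Phi>' (h, 0)) = 0"
    and m: "\<forall>\<^sub>F a in nhds a0. m a = \<Phi> (a, P (m a))"
    and opt: "\<And>\<epsilon>. 0 < \<epsilon> \<Longrightarrow> \<epsilon> < 1 \<Longrightarrow> \<forall>\<^sub>F a in nhds a0. (1 - \<epsilon>) * n (m a - b0) \<le> (1 + \<epsilon>) * n (\<Phi> (a, P b0) - b0)"
  shows "m a0 = b0" "(m has_derivative (\<lambda>h. \<Phi>' (h, 0))) (at a0)"
proof -
  define L where "L h = \<Phi>' (h, 0)" for h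
  have lin\<Phi>': "linear \<Phi>'" using d\<Phi> by (rule has_derivative_linear)
  have "linear (\<lambda>h. (h, 0) :: 'a \<times> 'e)" by (rule linearI) auto
  from linear_compose[OF this lin\<Phi>'] have linL: "linear L" by (simp add: o_def L_def[abs_def])
  have blL: "bounded_linear L" by (rule linear_imp_bounded_linear[OF linL])
  have blP: "bounded_linear P" by (rule linear_imp_bounded_linear[OF P(1)])
  obtain Cl where Cl: "Cl > 0" "\<And>h. norm (L h) \<le> norm h * Cl"
    using bounded_linear.pos_bounded[OF blL] by blast
  obtain Cp where Cp: "Cp > 0" "\<And>h. norm (P h) \<le> norm h * Cp"
    using bounded_linear.pos_bounded[OF blP] by blast
  obtain ml where ml: "ml > 0" "\<And>x. ml * norm x \<le> n x" using n_lower by blast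
  obtain Mu where Mu: "Mu > 0" "\<And>x. n x \<le> Mu * norm x" using n_upper by blast
  define v where "v a = \<Phi> (a, P b0) - b0" for a
  have dv: "\<forall>\<^sub>F a in nhds a0. norm (v a - L (a - a0)) \<le> \<eta> * norm (a - a0)" if "\<eta> > 0" for \<eta>
  proof -
    have "((\<lambda>a. (a, P b0)) has_derivative (\<lambda>h. (h, 0))) (at a0)"
      by (auto intro!: derivative_eq_intros)
    then have "((\<lambda>a. \<Phi> (a, P b0)) has_derivative L) (at a0)"
      unfolding L_def by (rule has_derivative_compose[where f = "\<lambda>a. (a, P b0)", OF _ d\<Phi>])
    from has_derivative_eventually_le[OF this that] show ?thesis
      by eventually_elim (simp add: v_def \<Phi>0)
  qed
  show m0: "m a0 = b0"
  proof -
    have "(1 - 1/2) * n (m a0 - b0) \<le> (1 + 1/2) * n (\<Phi> (a0, P b0) - b0)"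
      by (rule eventually_nhds_x_imp_x[OF opt]) auto
    then show ?thesis using n_nonneg[of "m a0 - b0"] by (simp add: \<Phi>0)
  qed
  \<comment> \<open>With 1/2 for \<epsilon>, optimality gives
    \<open>n (m a - b0) \<le> 3 * n (v a)\<close>; the other factors pass between the two norms and
    bound \<open>norm (v a)\<close> by \<open>(Cl + 1) * norm (a - a0)\<close>.\<close>
  define A2 where "A2 = 3 * (Mu * (Cl + 1)) / ml"
  have A2: "A2 > 0" using Mu(1) Cl(1) ml(1) by (simp add: A2_def)
  have opt': "\<forall>\<^sub>F a in nhds a0. (1 - 1/2) * n (m a - b0) \<le> (1 + 1/2) * n (\<Phi> (a, P b0) - b0)"
    by (rule opt) auto
  have lip: "\<forall>\<^sub>F a in nhds a0. norm (m a - b0) \<le> A2 * norm (a - a0)"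
    using dv[OF zero_less_one] opt'
  proof eventually_elim
    case (elim a)
    let ?h = "norm (a - a0)"
    have "norm (v a) \<le> norm (v a - L (a - a0)) + norm (L (a - a0))"
      using norm_triangle_ineq[of "v a - L (a - a0)" "L (a - a0)"] by simp
    also have "\<dots> \<le> (Cl + 1) * ?h" using elim(1) Cl(2)[of "a - a0"] by (simp add: algebra_simps)
    finally have "Mu * norm (v a) \<le> Mu * ((Cl + 1) * ?h)" using Mu(1) by simp
    then have "n (v a) \<le> Mu * ((Cl + 1) * ?h)" using Mu(2)[of "v a"] by linarith
    moreover have "n (m a - b0) \<le> 3 * n (v a)" using elim(2) by (simp add: v_def)
    moreover have "ml * norm (m a - b0) \<le> n (m a - b0)" by (rule ml(2))
    ultimately have "ml * norm (m a - b0) \<le> 3 * (Mu * ((Cl + 1) * ?h))" by linarith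
    then show ?case using ml(1) by (simp add: A2_def field_simps)
  qed
  have "(m \<longlongrightarrow> b0) (nhds a0)"
  proof -
    have "((\<lambda>a. m a - b0) \<longlongrightarrow> 0) (nhds a0)"
    proof (rule Lim_null_comparison[OF lip])
      have "((\<lambda>a. A2 * norm (a - a0)) \<longlongrightarrow> A2 * norm (a0 - a0)) (nhds a0)"
        by (intro tendsto_intros filterlim_ident)
      then show "((\<lambda>a. A2 * norm (a - a0)) \<longlongrightarrow> 0) (nhds a0)" by simp
    qed
    then show ?thesis by (simp add: LIM_zero_iff)
  qed
  then have lim: "((\<lambda>a. (a, P (m a))) \<longlongrightarrow> (a0, P b0)) (nhds a0)"
    by (intro tendsto_Pair filterlim_ident bounded_linear.tendsto[OF blP])
  \<comment> \<open>Bounds the norm of the pair \<open>(a - a0, P (m a - b0))\<close>, the increment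
    at which \<open>\<Phi>\<close> is expanded, in terms of \<open>norm (a - a0)\<close>.\<close>
  define C1 where "C1 = 1 + Cp * A2"
  have C1: "C1 > 0" using Cp(1) A2 by (simp add: C1_def add_pos_pos)
  have dm: "\<forall>\<^sub>F a in nhds a0. norm (m a - b0 - (L (a - a0) + P (m a - b0))) \<le> \<eta> * (C1 * norm (a - a0))"
    if \<eta>: "\<eta> > 0" for \<eta>
  proof -
    have "\<forall>\<^sub>F a in nhds a0. norm (\<Phi> (a, P (m a)) - \<Phi> (a0, P b0) - \<Phi>' ((a, P (m a)) - (a0, P b0)))
       \<le> \<eta> * norm ((a, P (m a)) - (a0, P b0))"
      using lim has_derivative_eventually_le[OF d\<Phi> \<eta>] unfolding filterlim_iff by blast
    then show ?thesis using m lip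
    proof eventually_elim
      case (elim a)
      let ?k = "P (m a - b0)"
      have k: "P (m a) - P b0 = ?k" by (simp add: linear_diff[OF P(1)])
      have "\<Phi>' (a - a0, ?k) = \<Phi>' ((a - a0, 0) + (0, ?k))" by simp
      also have "\<dots> = L (a - a0) + ?k"
        unfolding linear_add[OF lin\<Phi>'] by (simp add: L_def \<Phi>'K P(2))
      finally have 1: "norm (m a - b0 - (L (a - a0) + ?k)) \<le> \<eta> * norm (a - a0, ?k)"
        using elim(1) elim(2) by (simp add: \<Phi>0 k)
      have "norm (a - a0, ?k) \<le> norm (a - a0) + norm ?k" by (rule norm_Pair_le)
      also have "\<dots> \<le> norm (a - a0) + A2 * norm (a - a0) * Cp"
        using Cp(2)[of "m a - b0"] mult_right_mono[OF elim(3), of Cp] Cp(1) by linarith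
      also have "\<dots> = C1 * norm (a - a0)" by (simp add: C1_def algebra_simps)
      finally have "\<eta> * norm (a - a0, ?k) \<le> \<eta> * (C1 * norm (a - a0))" using \<eta> by simp
      then show ?case using 1 by linarith
    qed
  qed
  define \<Lambda> where "\<Lambda> = Mu * Cl"
  have \<Lambda>: "\<Lambda> > 0" using Mu(1) Cl(1) by (simp add: \<Lambda>_def)
  show "(m has_derivative (\<lambda>h. \<Phi>' (h, 0))) (at a0)"
    unfolding L_def[symmetric] has_derivative_at_alt
  proof (intro conjI allI impI blL)
    fix e :: real assume e: "e > 0"
    \<comment> \<open>The constants are chosen backwards from \<open>e\<close>.
      \<open>\<tau>\<close> makes the part in the range of \<open>P\<close> at most half of the
      permitted error, after division by \<open>ml\<close>; \<open>\<sigma>\<close> is the excess of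
      length that \<open>tangential_part_small\<close> then permits; \<open>\<epsilon>\<close> and
      \<open>\<eta>\<close> each use up one half of \<open>\<sigma>\<close>, and
      \<open>\<eta>\<close> also keeps the remainder of \<open>\<Phi>\<close> below the other half
      of the error.\<close>
    define \<tau> where "\<tau> = ml * e / 2"
    define \<sigma> where "\<sigma> = min 1 (\<tau>\<^sup>2 / (2 * \<Lambda> + 1))"
    define \<epsilon> where "\<epsilon> = min (1/2) (\<sigma> / (8 * \<Lambda>))"
    define \<eta> where "\<eta> = min (e / (2 * C1)) (\<sigma> / (2 * (Mu * (3 + C1))))"
    have \<tau>: "\<tau> > 0" using ml(1) e by (simp add: \<tau>_def)
    have \<sigma>: "\<sigma> > 0" "\<sigma> \<le> 1" using \<tau> \<Lambda> by (auto simp: \<sigma>_def)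
    have \<sigma>\<tau>: "\<sigma> * (2 * \<Lambda> + 1) \<le> \<tau>\<^sup>2"
    proof -
      have "\<sigma> \<le> \<tau>\<^sup>2 / (2 * \<Lambda> + 1)" by (simp add: \<sigma>_def)
      then show ?thesis using \<Lambda> by (simp add: field_simps)
    qed
    have \<epsilon>: "\<epsilon> > 0" "\<epsilon> \<le> 1/2" using \<sigma> \<Lambda> by (auto simp: \<epsilon>_def)
    have \<epsilon>1: "\<epsilon> < 1" using \<epsilon> by simp
    have \<epsilon>\<sigma>: "4 * \<epsilon> * \<Lambda> \<le> \<sigma> / 2"
    proof -
      have "\<epsilon> \<le> \<sigma> / (8 * \<Lambda>)" by (simp add: \<epsilon>_def)
      then show ?thesis using \<Lambda> by (simp add: field_simps)
    qed
    have \<eta>: "\<eta> > 0" using e C1 \<sigma> Mu(1) by (simp add: \<eta>_def add_pos_pos)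
    have \<eta>e: "\<eta> * C1 \<le> e / 2"
    proof -
      have "\<eta> \<le> e / (2 * C1)" by (simp add: \<eta>_def)
      then show ?thesis using C1 by (simp add: field_simps)
    qed
    have \<eta>\<sigma>: "\<eta> * (Mu * (3 + C1)) \<le> \<sigma> / 2"
    proof -
      have "\<eta> \<le> \<sigma> / (2 * (Mu * (3 + C1)))" by (simp add: \<eta>_def)
      moreover have "Mu * (3 + C1) > 0" using Mu(1) C1 by simp
      ultimately show ?thesis by (simp add: field_simps)
    qed
    have "\<forall>\<^sub>F a in nhds a0. norm (m a - m a0 - L (a - a0)) \<le> e * norm (a - a0)"
      using dv[OF \<eta>] dm[OF \<eta>] opt[OF \<epsilon>(1) \<epsilon>1]
    proof eventually_elim
      case (elim a)
      let ?h = "norm (a - a0)" and ?k = "P (m a - b0)" and ?l = "L (a - a0)"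
      have nl: "n ?l \<le> \<Lambda> * ?h"
      proof -
        have "Mu * norm ?l \<le> Mu * (?h * Cl)" using Cl(2)[of "a - a0"] Mu(1) by simp
        then show ?thesis using Mu(2)[of ?l] by (simp add: \<Lambda>_def algebra_simps)
      qed
      have nv: "n (v a) \<le> n ?l + Mu * (\<eta> * ?h)"
      proof -
        have "n (v a) \<le> n (v a - ?l) + n ?l" using n_triangle[of "v a - ?l" ?l] by simp
        also have "n (v a - ?l) \<le> Mu * (\<eta> * ?h)"
          using Mu(2)[of "v a - ?l"] mult_left_mono[OF elim(1), of Mu] Mu(1) by linarith
        finally show ?thesis by simp
      qed
      \<comment> \<open>For \<open>\<epsilon> \<le> 1/2\<close> the quotient
        \<open>(1 + \<epsilon>) / (1 - \<epsilon>)\<close> is at most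
        \<open>1 + 4 * \<epsilon>\<close>, which is itself at most 3.\<close>
      have nw: "n (m a - b0) \<le> (1 + 4 * \<epsilon>) * n (v a)"
      proof -
        have "\<epsilon> * \<epsilon> \<le> (1/2) * \<epsilon>" using \<epsilon> by (intro mult_right_mono) auto
        then have "1 + \<epsilon> \<le> (1 - \<epsilon>) * (1 + 4 * \<epsilon>)" by (simp add: algebra_simps)
        then have "(1 + \<epsilon>) * n (v a) \<le> (1 - \<epsilon>) * (1 + 4 * \<epsilon>) * n (v a)"
          using n_nonneg by (intro mult_right_mono)
        then have "(1 - \<epsilon>) * n (m a - b0) \<le> (1 - \<epsilon>) * ((1 + 4 * \<epsilon>) * n (v a))"
          using elim(3) by (simp add: v_def mult.assoc)
        then show ?thesis using \<epsilon> by simp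
      qed
      have nr: "n (m a - b0 - (?l + ?k)) \<le> Mu * (\<eta> * (C1 * ?h))"
        using Mu(2)[of "m a - b0 - (?l + ?k)"] mult_left_mono[OF elim(2), of Mu] Mu(1) by linarith
      have "n (?l + ?k) \<le> n (m a - b0) + n (m a - b0 - (?l + ?k))"
        using n_triangle[of "m a - b0" "- (m a - b0 - (?l + ?k))"] n_minus[of "m a - b0 - (?l + ?k)"] by simp
      also have "\<dots> \<le> (1 + 4 * \<epsilon>) * (n ?l + Mu * (\<eta> * ?h)) + Mu * (\<eta> * (C1 * ?h))"
        using nw nr mult_left_mono[OF nv, of "1 + 4 * \<epsilon>"] \<epsilon> by linarith
      also have "\<dots> = n ?l + 4 * \<epsilon> * n ?l + (1 + 4 * \<epsilon>) * (Mu * (\<eta> * ?h)) + Mu * (\<eta> * (C1 * ?h))"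
        by (simp add: algebra_simps)
      also have "\<dots> \<le> n ?l + 4 * \<epsilon> * (\<Lambda> * ?h) + 3 * (Mu * (\<eta> * ?h)) + Mu * (\<eta> * (C1 * ?h))"
        using nl \<epsilon> Mu(1) \<eta> by (intro add_mono mult_left_mono mult_right_mono) auto
      also have "\<dots> = n ?l + (4 * \<epsilon> * \<Lambda>) * ?h + (\<eta> * (Mu * (3 + C1))) * ?h"
        by (simp add: algebra_simps)
      also have "\<dots> \<le> n ?l + (\<sigma> / 2) * ?h + (\<sigma> / 2) * ?h"
        using \<epsilon>\<sigma> \<eta>\<sigma> by (intro add_mono mult_right_mono) auto
      finally have nlk: "n (?l + ?k) \<le> n ?l + \<sigma> * ?h" by simp
      have "B ?l ?k = 0" using orth[of ?k ?l] P(2) \<Phi>'P[of "a - a0"] by (simp add: L_def)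
      from tangential_part_small[OF this nlk nl] have nk: "n ?k \<le> \<tau> * ?h"
        using \<sigma> \<Lambda> \<tau> \<sigma>\<tau> by simp
      have "norm ?k \<le> e / 2 * ?h"
      proof -
        have "ml * norm ?k \<le> ml * (e / 2 * ?h)" using ml(2)[of ?k] nk by (simp add: \<tau>_def)
        then show ?thesis using ml(1) by simp
      qed
      moreover have "norm (m a - b0 - ?l) \<le> norm (m a - b0 - (?l + ?k)) + norm ?k"
        using norm_triangle_ineq[of "m a - b0 - (?l + ?k)" ?k] by simp
      moreover have "norm (m a - b0 - (?l + ?k)) \<le> e / 2 * ?h"
        using elim(2) mult_right_mono[OF \<eta>e, of ?h] by (simp add: mult.assoc)
      ultimately show ?case by (simp add: m0)
    qed
    then show "\<exists>d>0. \<forall>y. norm (y - a0) < d \<longrightarrow> norm (m y - m a0 - L (y - a0)) \<le> e * norm (y - a0)"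
      unfolding eventually_nhds_metric dist_norm by blast
  qed
qed

end

section \<open>Quotients of distances near the base point\<close>

lemma riem_dist_sandwich:
  fixes A :: "('m::{t2_space, second_countable_topology}, 'e::finite_dim_inner) chart set"
  assumes A: "smooth_manifold A" and g: "riemannian_metric A g" and \<kappa>: "\<kappa> \<in> charts_at A p"
    and e: "0 < \<epsilon>" "\<epsilon> < 1"
  defines "n \<equiv> inner_form.n (chart_form A g \<kappa> (snd \<kappa> p))"
  shows "\<forall>\<^sub>F q in nhds p. q \<in> fst \<kappa> \<and>
     ennreal ((1 - \<epsilon>) * n (snd \<kappa> q - snd \<kappa> p)) \<le> riem_dist A g p q \<and>
     riem_dist A g p q \<le> ennreal ((1 + \<epsilon>) * n (snd \<kappa> q - snd \<kappa> p))"
proof -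
  have D: "diff_atlas A" by (rule smooth_manifold_imp_diff_atlas[OF A])
  note k = charts_at_chart[OF D \<kappa>]
  have "\<kappa> \<in> A" "snd \<kappa> p \<in> snd \<kappa> ` fst \<kappa>" using \<kappa> by (auto simp: charts_at_def)
  then interpret F: inner_form "chart_form A g \<kappa> (snd \<kappa> p)"
    by (rule inner_form_chart_form[OF D g])
  obtain \<rho>0 where \<rho>0: "\<rho>0 > 0"
    and up: "\<And>s s'. n (s - snd \<kappa> p) \<le> \<rho>0 \<Longrightarrow> n (s' - snd \<kappa> p) \<le> \<rho>0 \<Longrightarrow>
       riem_dist A g (chart_inv \<kappa> s) (chart_inv \<kappa> s') \<le> ennreal ((1 + \<epsilon>) * n (s' - s))"
    and lo: "\<And>q \<rho>. 0 \<le> \<rho> \<Longrightarrow> \<rho> \<le> \<rho>0 \<Longrightarrow> q \<in> fst \<kappa> \<longrightarrow> \<rho> \<le> n (snd \<kappa> q - snd \<kappa> p) \<Longrightarrow>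
       ennreal ((1 - \<epsilon>) * \<rho>) \<le> riem_dist A g p q"
    using riem_dist_local[OF A g \<kappa> e] unfolding n_def by metis
  have "isCont (\<lambda>s. F.n (s - snd \<kappa> p)) (snd \<kappa> p)"
  proof (rule isCont_o2[where f = "\<lambda>s. s - snd \<kappa> p" and g = F.n])
    show "isCont F.n (snd \<kappa> p - snd \<kappa> p)"
      using F.continuous_n unfolding continuous_on_eq_continuous_at[OF open_UNIV] by blast
  qed (intro continuous_intros)
  moreover have "\<forall>\<^sub>F r in nhds (F.n (snd \<kappa> p - snd \<kappa> p)). r < \<rho>0"
    using eventually_nhds_in_open[OF open_lessThan, of 0 \<rho>0] \<rho>0 by simp
  ultimately have "\<forall>\<^sub>F s in nhds (snd \<kappa> p). F.n (s - snd \<kappa> p) < \<rho>0" by (rule isCont_eventually_nhds)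
  from eventually_chart[OF k[THEN conjunct1] k[THEN conjunct2] this] show ?thesis
  proof eventually_elim
    case (elim q)
    have "n (snd \<kappa> q - snd \<kappa> p) \<le> \<rho>0" using elim by (simp add: n_def)
    then show ?case
      using up[of "snd \<kappa> p" "snd \<kappa> q"] lo[of "n (snd \<kappa> q - snd \<kappa> p)" q] elim k \<rho>0
      by (simp add: is_chart_inv n_def F.n_nonneg)
  qed
qed

lemma ennreal_inverse_antimono:
  fixes a b :: ennreal
  assumes "a \<le> b"
  shows "inverse b \<le> inverse a"
proof (cases b)
  case (real r')
  with assms obtain r where r: "0 \<le> r" "a = ennreal r" by (cases a) (auto simp: top_unique)
  show ?thesis
  proof (cases "r = 0")
    case False
    then show ?thesis using r real assms
      by (simp add: inverse_ennreal ennreal_leI le_imp_inverse_le)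
  qed (simp add: r)
qed simp

lemma ennreal_quotient_le:
  assumes "u \<le> ennreal p" "ennreal q \<le> v" "0 \<le> p" "0 < q"
  shows "u / v \<le> ennreal (p / q)"
proof -
  have "u / v \<le> ennreal p / v" using assms(1) by (rule divide_right_mono_ennreal)
  also have "\<dots> \<le> ennreal p / ennreal q"
    unfolding divide_ennreal_def using assms(2) by (intro mult_left_mono ennreal_inverse_antimono) auto
  also have "\<dots> = ennreal (p / q)" using assms by (simp add: divide_ennreal)
  finally show ?thesis .
qed

lemma ennreal_le_quotient:
  assumes "ennreal p \<le> u" "v \<le> ennreal q" "0 < q"
  shows "ennreal (p / q) \<le> u / v"
proof (cases "0 \<le> p")
  case True
  have "ennreal (p / q) = ennreal p / ennreal q" using assms True by (simp add: divide_ennreal)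
  also have "\<dots> \<le> ennreal p / v"
    unfolding divide_ennreal_def using assms(2) by (intro mult_left_mono ennreal_inverse_antimono) auto
  also have "\<dots> \<le> u / v" using assms(1) by (rule divide_right_mono_ennreal)
  finally show ?thesis .
next
  case False
  then have "p / q < 0" using assms(3) by (simp add: divide_less_0_iff)
  then show ?thesis by (simp add: ennreal_neg)
qed

lemma le_Limsup_frequently:
  fixes R :: "'a \<Rightarrow> ennreal"
  assumes "\<exists>\<^sub>F x in F. c \<le> R x"
  shows "c \<le> Limsup F R"
  unfolding Limsup_def
proof (rule INF_greatest)
  fix P assume "P \<in> {P. eventually P F}"
  then have "\<exists>\<^sub>F x in F. c \<le> R x \<and> P x" using assms by (intro frequently_eventually_frequently) auto
  then obtain x where "c \<le> R x" "P x" using frequently_ex by fastforce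
  then show "c \<le> Sup (R ` Collect P)" by (intro SUP_upper2[of x]) auto
qed

lemma (in inner_form) eventually_nhds_n:
  assumes "\<forall>\<^sub>F b in nhds b0. Q b"
  obtains \<rho> where "\<rho> > 0" "\<And>b. n (b - b0) \<le> \<rho> \<Longrightarrow> Q b"
proof -
  obtain m where m: "m > 0" "\<And>a. m * norm a \<le> n a" using n_lower by blast
  obtain d where d: "d > 0" "\<And>b. dist b b0 < d \<Longrightarrow> Q b"
    using assms unfolding eventually_nhds_metric by blast
  show thesis
  proof (rule that[of "m * d / 2"])
    show "m * d / 2 > 0" using m d by simp
    fix b assume "n (b - b0) \<le> m * d / 2"
    then have "m * norm (b - b0) \<le> m * (d / 2)" using m(2)[of "b - b0"] by simp
    then have "norm (b - b0) \<le> d / 2" using m(1) by simp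
    then show "Q b" using d by (simp add: dist_norm)
  qed
qed

lemma (in inner_form) isCont_n: "isCont n a"
  using continuous_n unfolding continuous_on_eq_continuous_at[OF open_UNIV] by blast

lemma (in inner_form) eventually_n_less:
  assumes "(f \<longlongrightarrow> b0) F" "0 < \<rho>"
  shows "\<forall>\<^sub>F x in F. n (f x - b0) < \<rho>"
proof -
  have "((\<lambda>x. f x - b0) \<longlongrightarrow> b0 - b0) F" using assms(1) by (intro tendsto_diff tendsto_const)
  then have "((\<lambda>x. n (f x - b0)) \<longlongrightarrow> n (b0 - b0)) F" by (rule isCont_tendsto_compose[OF isCont_n])
  then show ?thesis using assms(2) by (intro order_tendstoD(2)) auto
qed

text \<open>Let h be the coordinate displacement of \<open>x\<close>. Up to factors
  \<open>1 \<plusminus> \<epsilon>\<close> and an error \<epsilon> times the norm of h, the two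
  distances are the norms of h and of its image under \<open>L\<close>. The upper bound then holds
  for every \<open>x\<close> nearby. For the lower bound \<open>x\<close> approaches
  \<open>x0\<close> along a coordinate ray in direction \<open>a\<close>, on which the quotient of
  these norms is constant. The direction \<open>a = 0\<close> contributes \<open>0 / 0 = 0\<close>,
  which is also the limit superior when \<open>x0\<close> is isolated.\<close>

lemma Limsup_riem_dist_quotient:
  fixes X :: "('x::{t2_space, second_countable_topology}, 'a::finite_dim_inner) chart set"
    and Y :: "('y::{t2_space, second_countable_topology}, 'b::finite_dim_inner) chart set"
  assumes X: "smooth_manifold X" and gX: "riemannian_metric X gX" and \<kappa>: "\<kappa> \<in> charts_at X x0"
    and Y: "smooth_manifold Y" and gY: "riemannian_metric Y gY" and \<mu>: "\<mu> \<in> charts_at Y y0"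
    and C0: "C x0 = y0" and C: "isCont C x0"
    and L: "(snd \<mu> \<circ> C \<circ> chart_inv \<kappa> has_derivative L) (at (snd \<kappa> x0))"
  defines "nX \<equiv> inner_form.n (chart_form X gX \<kappa> (snd \<kappa> x0))"
    and "nY \<equiv> inner_form.n (chart_form Y gY \<mu> (snd \<mu> y0))"
  shows "Limsup (at x0) (\<lambda>x. riem_dist Y gY y0 (C x) / riem_dist X gX x0 x) =
    (SUP a. ennreal (nY (L a) / nX a))"
proof -
  have DX: "diff_atlas X" and DY: "diff_atlas Y"
    using X Y by (auto intro: smooth_manifold_imp_diff_atlas)
  note kx = charts_at_chart[OF DX \<kappa>] and my = charts_at_chart[OF DY \<mu>]
  have "\<kappa> \<in> X" "snd \<kappa> x0 \<in> snd \<kappa> ` fst \<kappa>" using \<kappa> by (auto simp: charts_at_def)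
  then interpret FX: inner_form "chart_form X gX \<kappa> (snd \<kappa> x0)"
    by (rule inner_form_chart_form[OF DX gX])
  have "\<mu> \<in> Y" "snd \<mu> y0 \<in> snd \<mu> ` fst \<mu>" using \<mu> by (auto simp: charts_at_def)
  then interpret FY: inner_form "chart_form Y gY \<mu> (snd \<mu> y0)"
    by (rule inner_form_chart_form[OF DY gY])
  note nX = nX_def and nY = nY_def
  define a0 where "a0 = snd \<kappa> x0"
  define b0 where "b0 = snd \<mu> y0"
  let ?dY = "\<lambda>x. riem_dist Y gY y0 (C x)" and ?dX = "\<lambda>x. riem_dist X gX x0 x"
  have linL: "linear L" using L by (rule has_derivative_linear)
  obtain mX where mX: "mX > 0" "\<And>x. mX * norm x \<le> nX x" using FX.n_lower unfolding nX by blast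
  obtain MY where MY: "MY > 0" "\<And>x. nY x \<le> MY * norm x" using FY.n_upper unfolding nY by blast
  obtain Cl where Cl: "Cl > 0" "\<And>h. norm (L h) \<le> norm h * Cl"
    using bounded_linear.pos_bounded[OF linear_imp_bounded_linear[OF linL]] by blast
  define E where "E \<epsilon> x \<longleftrightarrow> x \<in> fst \<kappa> \<and>
      ennreal ((1 - \<epsilon>) * nX (snd \<kappa> x - a0)) \<le> ?dX x \<and> ?dX x \<le> ennreal ((1 + \<epsilon>) * nX (snd \<kappa> x - a0)) \<and>
      ennreal ((1 - \<epsilon>) * (nY (L (snd \<kappa> x - a0)) - \<epsilon> * nX (snd \<kappa> x - a0))) \<le> ?dY x \<and>
      ?dY x \<le> ennreal ((1 + \<epsilon>) * (nY (L (snd \<kappa> x - a0)) + \<epsilon> * nX (snd \<kappa> x - a0)))" for \<epsilon> x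
  have est: "\<forall>\<^sub>F x in nhds x0. E \<epsilon> x"
    if \<epsilon>: "0 < \<epsilon>" "\<epsilon> < 1" for \<epsilon>
  proof -
    \<comment> \<open>Chosen so that
      \<open>MY * (\<eta> * norm h) = \<epsilon> * (mX * norm h)\<close>, which is at most
      \<open>\<epsilon> * nX h\<close>.\<close>
    define \<eta> where "\<eta> = \<epsilon> * mX / MY"
    have \<eta>: "\<eta> > 0" using \<epsilon> mX(1) MY(1) by (simp add: \<eta>_def)
    have "\<forall>\<^sub>F y in nhds (C x0). y \<in> fst \<mu> \<and>
       ennreal ((1 - \<epsilon>) * nY (snd \<mu> y - snd \<mu> y0)) \<le> riem_dist Y gY y0 y \<and>
       riem_dist Y gY y0 y \<le> ennreal ((1 + \<epsilon>) * nY (snd \<mu> y - snd \<mu> y0))"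
      using riem_dist_sandwich[OF Y gY \<mu> \<epsilon>] unfolding nY C0 .
    then have evY: "\<forall>\<^sub>F x in nhds x0. C x \<in> fst \<mu> \<and>
       ennreal ((1 - \<epsilon>) * nY (snd \<mu> (C x) - b0)) \<le> ?dY x \<and>
       ?dY x \<le> ennreal ((1 + \<epsilon>) * nY (snd \<mu> (C x) - b0))"
      unfolding b0_def by (rule isCont_eventually_nhds[OF C])
    note evX = riem_dist_sandwich[OF X gX \<kappa> \<epsilon>, folded nX a0_def]
    have evL: "\<forall>\<^sub>F x in nhds x0. x \<in> fst \<kappa> \<and>
       norm ((snd \<mu> \<circ> C \<circ> chart_inv \<kappa>) (snd \<kappa> x) - (snd \<mu> \<circ> C \<circ> chart_inv \<kappa>) (snd \<kappa> x0) - L (snd \<kappa> x - snd \<kappa> x0))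
         \<le> \<eta> * norm (snd \<kappa> x - snd \<kappa> x0)"
      by (rule eventually_chart[OF kx[THEN conjunct1] kx[THEN conjunct2] has_derivative_eventually_le[OF L \<eta>]])
    from evX evY evL show ?thesis
    proof eventually_elim
      case (elim x)
      let ?h = "snd \<kappa> x - a0" and ?w = "snd \<mu> (C x) - b0"
      have "norm (?w - L ?h) \<le> \<eta> * norm ?h"
        using elim(3) is_chart_inv[OF kx[THEN conjunct1], of x] is_chart_inv[OF kx[THEN conjunct1], of x0] kx
        by (simp add: C0 a0_def b0_def)
      then have "MY * norm (?w - L ?h) \<le> MY * (\<eta> * norm ?h)" using MY(1) by simp
      also have "\<dots> = \<epsilon> * (mX * norm ?h)" using MY(1) by (simp add: \<eta>_def)
      also have "\<dots> \<le> \<epsilon> * nX ?h" using mX(2) \<epsilon> by simp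
      finally have r: "nY (?w - L ?h) \<le> \<epsilon> * nX ?h" using MY(2)[of "?w - L ?h"] by linarith
      have "nY ?w \<le> nY (L ?h) + \<epsilon> * nX ?h"
        using FY.n_triangle[of "?w - L ?h" "L ?h"] r by (simp add: nY)
      moreover have "nY (L ?h) - \<epsilon> * nX ?h \<le> nY ?w"
        using FY.n_reverse_triangle[of "L ?h" ?w] FY.n_diff_commute[of "L ?h" ?w] r by (simp add: nY)
      ultimately have "ennreal ((1 + \<epsilon>) * nY ?w) \<le> ennreal ((1 + \<epsilon>) * (nY (L ?h) + \<epsilon> * nX ?h))"
        "ennreal ((1 - \<epsilon>) * (nY (L ?h) - \<epsilon> * nX ?h)) \<le> ennreal ((1 - \<epsilon>) * nY ?w)"
        using \<epsilon> by (auto intro!: ennreal_leI)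
      then show ?case unfolding E_def using elim(1,2) by (meson order_trans)
    qed
  qed
  define s where "s = enn2real (SUP a. ennreal (nY (L a) / nX a))"
  have bnd: "nY (L a) / nX a \<le> MY * Cl / mX" for a
  proof (cases "a = 0")
    case False
    then have "nX a > 0" unfolding nX by (rule FX.n_pos)
    moreover have "nY (L a) \<le> MY * Cl / mX * nX a"
    proof -
      have "nY (L a) \<le> MY * (norm a * Cl)" using MY Cl(2)[of a] by (meson less_imp_le mult_left_mono order_trans)
      also have "\<dots> = MY * Cl / mX * (mX * norm a)" using mX(1) by simp
      also have "\<dots> \<le> MY * Cl / mX * nX a" using mX MY(1) Cl(1) by (intro mult_left_mono) auto
      finally show ?thesis .
    qed
    ultimately show ?thesis by (simp add: divide_le_eq)
  qed (use mX MY Cl in \<open>simp add: nX nY linear_0[OF linL]\<close>)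
  have "(SUP a. ennreal (nY (L a) / nX a)) \<le> ennreal (MY * Cl / mX)"
    using bnd by (intro SUP_least ennreal_leI)
  then have "(SUP a. ennreal (nY (L a) / nX a)) < top"
    by (rule le_less_trans) simp
  then have S: "(SUP a. ennreal (nY (L a) / nX a)) = ennreal s"
    by (simp add: s_def less_top)
  have s0: "s \<ge> 0" by (simp add: s_def)
  have Ls: "nY (L a) \<le> s * nX a" for a
  proof (cases "a = 0")
    case False
    then have p: "nX a > 0" unfolding nX by (rule FX.n_pos)
    have "ennreal (nY (L a) / nX a) \<le> ennreal s" unfolding S[symmetric] by (rule SUP_upper) simp
    then have "nY (L a) / nX a \<le> s" using s0 by (simp add: ennreal_le_iff)
    then show ?thesis using p by (simp add: divide_le_eq)
  qed (simp add: nX nY linear_0[OF linL])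
  show ?thesis
  proof (rule antisym)
    show "Limsup (at x0) (\<lambda>x. ?dY x / ?dX x) \<le> (SUP a. ennreal (nY (L a) / nX a))"
      unfolding S
    proof (rule ennreal_le_epsilon)
      fix e :: real assume e: "0 < e"
      \<comment> \<open>Expanding the aim \<open>(1 + \<epsilon>) * (s + \<epsilon>) \<le> (s + e) *
        (1 - \<epsilon>)\<close> and using \<open>\<epsilon> * \<epsilon> \<le> \<epsilon>\<close>
        leaves \<open>\<epsilon> * (2 + 2 * s + e) \<le> e\<close>.\<close>
      define \<epsilon> where "\<epsilon> = min (1/2) (e / (2 + 2 * s + e))"
      have \<epsilon>: "0 < \<epsilon>" "\<epsilon> < 1" using e s0 by (auto simp: \<epsilon>_def)
      have "\<epsilon> \<le> e / (2 + 2 * s + e)" by (simp add: \<epsilon>_def)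
      then have "\<epsilon> * (2 + 2 * s + e) \<le> e" using e s0 by (simp add: pos_le_divide_eq)
      moreover have "\<epsilon> * \<epsilon> \<le> \<epsilon>" using \<epsilon> by (simp add: mult_left_le)
      ultimately have key: "(1 + \<epsilon>) * (s + \<epsilon>) \<le> (s + e) * (1 - \<epsilon>)" by (simp add: algebra_simps)
      have "\<forall>\<^sub>F x in at x0. ?dY x / ?dX x \<le> ennreal (s + e)"
        unfolding eventually_at_filter using est[OF \<epsilon>]
      proof eventually_elim
        case (elim x)
        note elim = elim[unfolded E_def]
        show ?case
        proof (intro impI)
          assume "x \<noteq> x0"
          let ?h = "snd \<kappa> x - a0"
          have "?h \<noteq> 0" using \<open>x \<noteq> x0\<close> elim kx is_chart_inv[of \<kappa>] unfolding a0_def by (metis right_minus_eq)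
          then have h: "nX ?h > 0" unfolding nX by (rule FX.n_pos)
          have "?dY x / ?dX x \<le> ennreal ((1 + \<epsilon>) * (nY (L ?h) + \<epsilon> * nX ?h) / ((1 - \<epsilon>) * nX ?h))"
          proof (rule ennreal_quotient_le)
            show "0 \<le> (1 + \<epsilon>) * (nY (L ?h) + \<epsilon> * nX ?h)"
              using \<epsilon> h FY.n_nonneg by (simp add: nY)
          qed (use elim h \<epsilon> in auto)
          also have "\<dots> \<le> ennreal (s + e)"
          proof (rule ennreal_leI)
            have "(1 + \<epsilon>) * (nY (L ?h) + \<epsilon> * nX ?h) \<le> (1 + \<epsilon>) * ((s + \<epsilon>) * nX ?h)"
              using Ls[of ?h] \<epsilon> by (intro mult_left_mono) (auto simp: algebra_simps)
            also have "\<dots> \<le> (s + e) * (1 - \<epsilon>) * nX ?h"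
              using mult_right_mono[OF key, of "nX ?h"] h by (simp add: mult.assoc)
            finally show "(1 + \<epsilon>) * (nY (L ?h) + \<epsilon> * nX ?h) / ((1 - \<epsilon>) * nX ?h) \<le> s + e"
              using h \<epsilon> by (simp add: divide_le_eq mult.assoc)
          qed
          finally show "?dY x / ?dX x \<le> ennreal (s + e)" .
        qed
      qed
      then have "Limsup (at x0) (\<lambda>x. ?dY x / ?dX x) \<le> ennreal (s + e)" by (rule Limsup_bounded)
      then show "Limsup (at x0) (\<lambda>x. ?dY x / ?dX x) \<le> ennreal s + ennreal e"
        using s0 e by (simp add: ennreal_plus)
    qed
    show "(SUP a. ennreal (nY (L a) / nX a)) \<le> Limsup (at x0) (\<lambda>x. ?dY x / ?dX x)"
    proof (rule SUP_least)
      fix a :: 'a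
      define q where "q = nY (L a) / nX a"
      show "ennreal q \<le> Limsup (at x0) (\<lambda>x. ?dY x / ?dX x)"
      proof (cases "a = 0")
        case True
        then show ?thesis by (simp add: q_def nX)
      next
        case False
        then have pa: "nX a > 0" unfolding nX by (rule FX.n_pos)
        have q0: "q \<ge> 0" using pa FY.n_nonneg by (simp add: q_def nY)
        have La: "nY (L a) = q * nX a" using pa by (simp add: q_def)
        show ?thesis
        proof (rule ennreal_le_epsilon)
          fix e :: real assume e: "0 < e"
          \<comment> \<open>The aim is \<open>(q - e) * (1 + \<epsilon>) \<le> (1 - \<epsilon>) * (q
            - \<epsilon>)\<close>; after expansion \<open>\<epsilon> * (1 + 2 * q) \<le> e\<close>
            suffices.\<close>
          define \<epsilon> where "\<epsilon> = min (1/2) (e / (1 + 2 * q))"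
          have \<epsilon>: "0 < \<epsilon>" "\<epsilon> < 1" using e q0 by (auto simp: \<epsilon>_def)
          have "\<epsilon> \<le> e / (1 + 2 * q)" by (simp add: \<epsilon>_def)
          then have "\<epsilon> * (1 + 2 * q) \<le> e" using q0 by (simp add: pos_le_divide_eq)
          moreover have "0 \<le> \<epsilon> * \<epsilon> + \<epsilon> * e" using \<epsilon> e by (intro add_nonneg_nonneg mult_nonneg_nonneg) auto
          ultimately have key: "(q - e) * (1 + \<epsilon>) \<le> (1 - \<epsilon>) * (q - \<epsilon>)" by (simp only: algebra_simps)
          define xt where "xt t = chart_inv \<kappa> (a0 + t *\<^sub>R a)" for t :: real
          have "((\<lambda>t. a0 + t *\<^sub>R a) \<longlongrightarrow> a0 + 0 *\<^sub>R a) (at_right 0)"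
            by (intro tendsto_intros)
          then have lim: "((\<lambda>t. a0 + t *\<^sub>R a) \<longlongrightarrow> snd \<kappa> x0) (at_right 0)" by (simp add: a0_def)
          have freq: "\<exists>\<^sub>F x in at x0. ennreal (q - e) \<le> ?dY x / ?dX x"
            unfolding frequently_def
          proof
            assume "\<forall>\<^sub>F x in at x0. \<not> ennreal (q - e) \<le> ?dY x / ?dX x"
            then have "\<forall>\<^sub>F x in nhds x0. x \<noteq> x0 \<longrightarrow> \<not> ennreal (q - e) \<le> ?dY x / ?dX x"
              by (simp add: eventually_at_filter)
            with est[OF \<epsilon>] have "\<forall>\<^sub>F x in nhds x0. E \<epsilon> x \<and>
                (x \<noteq> x0 \<longrightarrow> \<not> ennreal (q - e) \<le> ?dY x / ?dX x)"
              by (rule eventually_conj)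
            from eventually_compose_filterlim[OF eventually_chart_inv[OF kx[THEN conjunct1] kx[THEN conjunct2] this] lim]
            have "\<forall>\<^sub>F t in at_right 0. t > 0 \<and> a0 + t *\<^sub>R a \<in> snd \<kappa> ` fst \<kappa> \<and> E \<epsilon> (xt t) \<and>
                (xt t \<noteq> x0 \<longrightarrow> \<not> ennreal (q - e) \<le> ?dY (xt t) / ?dX (xt t))"
              unfolding xt_def by (rule eventually_conj[OF eventually_at_right_less])
            from eventually_happens'[OF _ this]
            obtain t where "t > 0 \<and> a0 + t *\<^sub>R a \<in> snd \<kappa> ` fst \<kappa> \<and> E \<epsilon> (xt t) \<and>
                (xt t \<noteq> x0 \<longrightarrow> \<not> ennreal (q - e) \<le> ?dY (xt t) / ?dX (xt t))"
              by (auto simp: trivial_limit_at_right_real)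
            then have t: "t > 0" "a0 + t *\<^sub>R a \<in> snd \<kappa> ` fst \<kappa>"
              "?dX (xt t) \<le> ennreal ((1 + \<epsilon>) * nX (snd \<kappa> (xt t) - a0))"
              "ennreal ((1 - \<epsilon>) * (nY (L (snd \<kappa> (xt t) - a0)) - \<epsilon> * nX (snd \<kappa> (xt t) - a0))) \<le> ?dY (xt t)"
              "xt t \<noteq> x0 \<Longrightarrow> \<not> ennreal (q - e) \<le> ?dY (xt t) / ?dX (xt t)"
              unfolding E_def by blast+
            have h: "snd \<kappa> (xt t) - a0 = t *\<^sub>R a"
              using is_chart_inv_right[OF kx[THEN conjunct1] t(2)] by (simp add: xt_def)
            have "xt t \<noteq> x0" using h t(1) False by (auto simp: a0_def)
            moreover have "ennreal (q - e) \<le> ?dY (xt t) / ?dX (xt t)"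
            proof -
              have "(q - e) \<le> (1 - \<epsilon>) * (nY (L (t *\<^sub>R a)) - \<epsilon> * nX (t *\<^sub>R a)) / ((1 + \<epsilon>) * nX (t *\<^sub>R a))"
              proof -
                have "nX (t *\<^sub>R a) = t * nX a" using t(1) by (simp add: nX FX.n_scale)
                moreover have "nY (L (t *\<^sub>R a)) = t * (q * nX a)"
                  using t(1) La by (simp add: nY FY.n_scale linear_cmul[OF linL])
                ultimately have "(1 - \<epsilon>) * (nY (L (t *\<^sub>R a)) - \<epsilon> * nX (t *\<^sub>R a)) / ((1 + \<epsilon>) * nX (t *\<^sub>R a)) =
                   ((1 - \<epsilon>) * (q - \<epsilon>)) * (t * nX a) / ((1 + \<epsilon>) * (t * nX a))"
                  by (simp add: algebra_simps)
                also have "\<dots> = ((1 - \<epsilon>) * (q - \<epsilon>)) / (1 + \<epsilon>)"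
                  using t(1) pa by (subst mult_divide_mult_cancel_right) auto
                also have "\<dots> \<ge> q - e" using key \<epsilon> by (simp add: le_divide_eq)
                finally show ?thesis .
              qed
              then have "ennreal (q - e) \<le> ennreal ((1 - \<epsilon>) * (nY (L (t *\<^sub>R a)) - \<epsilon> * nX (t *\<^sub>R a)) / ((1 + \<epsilon>) * nX (t *\<^sub>R a)))"
                by (rule ennreal_leI)
              also have "\<dots> \<le> ?dY (xt t) / ?dX (xt t)"
              proof (rule ennreal_le_quotient)
                show "0 < (1 + \<epsilon>) * nX (t *\<^sub>R a)" using pa t(1) \<epsilon> by (simp add: nX FX.n_scale)
              qed (use t h in auto)
              finally show ?thesis .
            qed
            ultimately show False using t(5) by blast
          qed
          \<comment> \<open>\<open>ennreal\<close> sends a negative \<open>q - e\<close> to 0, hence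
            the two cases.\<close>
          have "ennreal q \<le> ennreal (q - e) + ennreal e"
          proof (cases "e \<le> q")
            case True
            then show ?thesis using e by (simp add: ennreal_plus[symmetric] del: ennreal_plus)
          next
            case False
            then show ?thesis by (simp add: ennreal_neg ennreal_leI)
          qed
          also have "\<dots> \<le> Limsup (at x0) (\<lambda>x. ?dY x / ?dX x) + ennreal e"
            by (intro add_right_mono le_Limsup_frequently freq)
          finally show "ennreal q \<le> Limsup (at x0) (\<lambda>x. ?dY x / ?dX x) + ennreal e" .
        qed
      qed
    qed
  qed
qed

text \<open>\<open>Sol\<close> is the solution relation with the latent variable already projected
  away, so only a graph and a distance remain. Minimisers exist by compactness of the part of the
  graph in a small coordinate ball, since for \<open>x\<close> near \<open>x0\<close> all other
  solutions are farther from \<open>y0\<close> than one point of that part. Any minimiser then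
  satisfies the hypotheses of \<open>minimiser_has_derivative\<close>.\<close>

lemma minimiser_coordinates:
  fixes X :: "('x::{t2_space, second_countable_topology}, 'a::finite_dim_inner) chart set"
    and Y :: "('y::{t2_space, second_countable_topology}, 'b::finite_dim_inner) chart set"
    and \<Phi> :: "'a \<times> 'b \<Rightarrow> 'b" and Sol :: "'x \<Rightarrow> 'y \<Rightarrow> bool"
  assumes X: "smooth_manifold X" and \<kappa>: "\<kappa> \<in> charts_at X x0"
    and Y: "smooth_manifold Y" and gY: "riemannian_metric Y gY" and \<mu>: "\<mu> \<in> charts_at Y y0"
    and P: "linear P" "\<And>b. P (P b) = P b"
    and orth: "\<And>b k. P k = k \<Longrightarrow> chart_form Y gY \<mu> (snd \<mu> y0) (b - P b) k = 0"
    and J: "open J" "(snd \<kappa> x0, P (snd \<mu> y0)) \<in> J"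
    and \<Phi>J: "\<And>a k. (a, k) \<in> J \<Longrightarrow> P k = k \<Longrightarrow> isCont \<Phi> (a, k) \<and> P (\<Phi> (a, k)) = k"
    and \<Phi>0: "\<Phi> (snd \<kappa> x0, P (snd \<mu> y0)) = snd \<mu> y0"
    and d\<Phi>: "(\<Phi> has_derivative \<Phi>') (at (snd \<kappa> x0, P (snd \<mu> y0)))"
    and \<Phi>'K: "\<And>k. P k = k \<Longrightarrow> \<Phi>' (0, k) = k" and \<Phi>'P: "\<And>h. P (\<Phi>' (h, 0)) = 0"
    and Sol: "\<forall>\<^sub>F (a, b) in nhds (snd \<kappa> x0, snd \<mu> y0). Sol (chart_inv \<kappa> a) (chart_inv \<mu> b) \<longleftrightarrow> b = \<Phi> (a, P b)"
  defines "C \<equiv> \<lambda>x. arg_min (riem_dist Y gY y0) (Sol x)"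
  shows "\<forall>\<^sub>F x in nhds x0. is_arg_min (riem_dist Y gY y0) (Sol x) (C x)"
    and "C x0 = y0" and "isCont C x0"
    and "(snd \<mu> \<circ> C \<circ> chart_inv \<kappa> has_derivative (\<lambda>h. \<Phi>' (h, 0))) (at (snd \<kappa> x0))"
proof -
  have DX: "diff_atlas X" and DY: "diff_atlas Y"
    using X Y by (auto intro: smooth_manifold_imp_diff_atlas)
  have kx: "is_chart \<kappa>" "x0 \<in> fst \<kappa>" and my: "is_chart \<mu>" "y0 \<in> fst \<mu>"
    using charts_at_chart[OF DX \<kappa>] charts_at_chart[OF DY \<mu>] by auto
  have "\<mu> \<in> Y" "snd \<mu> y0 \<in> snd \<mu> ` fst \<mu>" using \<mu> by (auto simp: charts_at_def)
  then interpret F: inner_form "chart_form Y gY \<mu> (snd \<mu> y0)"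
    by (rule inner_form_chart_form[OF DY gY])
  define a0 where "a0 = snd \<kappa> x0"
  define b0 where "b0 = snd \<mu> y0"
  note \<Phi>0 = \<Phi>0[folded a0_def b0_def] and J = J[folded a0_def b0_def] and d\<Phi> = d\<Phi>[folded a0_def b0_def]
    and Sol = Sol[folded a0_def b0_def]
  let ?d = "riem_dist Y gY y0" and ?n = F.n
  have y0_inv: "chart_inv \<mu> b0 = y0" unfolding b0_def by (rule is_chart_inv[OF my])
  have blP: "bounded_linear P" by (rule linear_imp_bounded_linear[OF P(1)])
  obtain M where M: "M > 0" "\<And>b. ?n b \<le> M * norm b" using F.n_upper by blast
  \<comment> \<open>For the existence of minimisers the crude comparison constants 1/2 and 3/2 are
    good enough.\<close>
  have half: "0 < (1/2::real)" "(1/2::real) < 1" by auto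
  obtain \<rho>0 where \<rho>0: "\<rho>0 > 0" "\<And>s. ?n (s - b0) \<le> \<rho>0 \<Longrightarrow> s \<in> snd \<mu> ` fst \<mu>"
    "\<And>s s'. ?n (s - b0) \<le> \<rho>0 \<Longrightarrow> ?n (s' - b0) \<le> \<rho>0 \<Longrightarrow>
       riem_dist Y gY (chart_inv \<mu> s) (chart_inv \<mu> s') \<le> ennreal ((1 + 1/2) * ?n (s' - s))"
    "\<And>q \<rho>. 0 \<le> \<rho> \<Longrightarrow> \<rho> \<le> \<rho>0 \<Longrightarrow> q \<in> fst \<mu> \<longrightarrow> \<rho> \<le> ?n (snd \<mu> q - b0) \<Longrightarrow>
       ennreal ((1 - 1/2) * \<rho>) \<le> ?d q"
    using riem_dist_local[OF Y gY \<mu> half] unfolding b0_def by metis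
  have "isCont (\<lambda>x. (fst x, P (snd x))) (a0, b0)"
    by (intro continuous_intros bounded_linear.isCont[OF blP])
  moreover have "\<forall>\<^sub>F z in nhds ((\<lambda>x. (fst x, P (snd x))) (a0, b0)). z \<in> J"
    using J by (intro eventually_nhds_in_open) auto
  ultimately have evJ: "\<forall>\<^sub>F x in nhds (a0, b0). (fst x, P (snd x)) \<in> J"
    by (rule isCont_eventually_nhds)
  have "\<forall>\<^sub>F x in nhds (a0, b0). (fst x, P (snd x)) \<in> J \<and>
      (Sol (chart_inv \<kappa> (fst x)) (chart_inv \<mu> (snd x)) \<longleftrightarrow> snd x = \<Phi> (fst x, P (snd x)))"
    using evJ Sol by (simp add: eventually_conj case_prod_beta')
  then obtain Pa Pb where Pa: "eventually Pa (nhds a0)" and Pb: "eventually Pb (nhds b0)"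
    and PJ: "\<And>a b. Pa a \<Longrightarrow> Pb b \<Longrightarrow> (a, P b) \<in> J"
    and PS: "\<And>a b. Pa a \<Longrightarrow> Pb b \<Longrightarrow> Sol (chart_inv \<kappa> a) (chart_inv \<mu> b) \<longleftrightarrow> b = \<Phi> (a, P b)"
    unfolding nhds_prod eventually_prod_filter by auto
  obtain \<rho>1 where \<rho>1: "\<rho>1 > 0" "\<And>b. ?n (b - b0) \<le> \<rho>1 \<Longrightarrow> Pb b"
    using F.eventually_nhds_n[OF Pb] by blast
  define \<rho> where "\<rho> = min \<rho>0 \<rho>1"
  have \<rho>: "\<rho> > 0" "\<rho> \<le> \<rho>0" "\<rho> \<le> \<rho>1" using \<rho>0 \<rho>1 by (auto simp: \<rho>_def)
  have Pb0: "Pb b0" using \<rho>1(2)[of b0] \<rho>1(1) by simp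
  \<comment> \<open>The competitor: the point of the graph over \<open>a\<close> with the same
    \<open>P\<close>-part as \<open>b0\<close>.\<close>
  define \<beta> where "\<beta> a = \<Phi> (a, P b0)" for a
  have "isCont \<Phi> (a0, P b0)" using \<Phi>J[OF J(2) P(2)] by simp
  then have "isCont \<beta> a0"
    unfolding \<beta>_def by (intro isCont_o2[where f = "\<lambda>a. (a, P b0)" and g = \<Phi>] continuous_intros)
  then have \<beta>lim: "(\<beta> \<longlongrightarrow> b0) (nhds a0)"
    using tendsto_at_iff_tendsto_nhds[of \<beta> a0] by (simp add: isCont_def \<beta>_def \<Phi>0)
  have d\<beta>: "?d (chart_inv \<mu> (\<beta> a)) \<le> ennreal ((1 + 1/2) * ?n (\<beta> a - b0))" if "?n (\<beta> a - b0) < \<rho> / 4" for a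
    using \<rho>0(3)[of b0 "\<beta> a"] that \<rho> by (simp add: y0_inv)
  have Sol\<beta>: "Sol (chart_inv \<kappa> a) (chart_inv \<mu> (\<beta> a)) \<and> \<beta> a = \<Phi> (a, P (\<beta> a))"
    if "Pa a" "?n (\<beta> a - b0) < \<rho> / 4" for a
  proof -
    have "P (\<beta> a) = P b0" using \<Phi>J[OF PJ[OF that(1) Pb0] P(2)] by (simp add: \<beta>_def)
    then have eq: "\<beta> a = \<Phi> (a, P (\<beta> a))" by (simp add: \<beta>_def)
    moreover have "Pb (\<beta> a)" using \<rho>1(2) that(2) \<rho> by simp
    ultimately show ?thesis using PS[OF that(1), of "\<beta> a"] by blast
  qed
  \<comment> \<open>Since \<open>3/2 * (\<rho> / 4) < 1/2 * \<rho>\<close>, no solution outside the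
    ball, whether in the chart or not, is as close to \<open>y0\<close> as the competitor. Inside
    the ball \<open>Sol\<close> is the graph.\<close>
  have near: "y \<in> fst \<mu> \<and> ?n (snd \<mu> y - b0) < \<rho> \<and> snd \<mu> y = \<Phi> (a, P (snd \<mu> y))"
    if a: "Pa a" "?n (\<beta> a - b0) < \<rho> / 4" and y: "Sol (chart_inv \<kappa> a) y" "?d y \<le> ?d (chart_inv \<mu> (\<beta> a))" for a y
  proof -
    have in_ball: "y \<in> fst \<mu> \<and> ?n (snd \<mu> y - b0) < \<rho>"
    proof (rule ccontr)
      assume "\<not> ?thesis"
      then have "ennreal ((1 - 1/2) * \<rho>) \<le> ?d y" using \<rho> by (intro \<rho>0(4)) auto
      also have "\<dots> \<le> ennreal ((1 + 1/2) * ?n (\<beta> a - b0))" using y(2) d\<beta>[OF a(2)] by (rule order_trans)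
      finally have "(1 - 1/2) * \<rho> \<le> (1 + 1/2) * ?n (\<beta> a - b0)"
        using F.n_nonneg[of "\<beta> a - b0"] by (subst (asm) ennreal_le_iff) auto
      then show False using a(2) \<rho>(1) by simp
    qed
    moreover have "snd \<mu> y = \<Phi> (a, P (snd \<mu> y))"
      using PS[OF a(1) \<rho>1(2), of "snd \<mu> y"] in_ball y(1) \<rho> is_chart_inv[OF my(1), of y] by auto
    ultimately show ?thesis by simp
  qed
  have exmin: "\<exists>y. is_arg_min ?d (Sol (chart_inv \<kappa> a)) y" if a: "Pa a" "?n (\<beta> a - b0) < \<rho> / 4" for a
  proof -
    define Kc where "Kc = {b. ?n (b - b0) \<le> \<rho>}"
    define Q where "Q = {b \<in> Kc. \<Phi> (a, P b) - b = 0}"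
    have PbK: "Pb b" if "b \<in> Kc" for b using that \<rho> \<rho>1(2) by (simp add: Kc_def)
    have clK: "closed Kc"
      unfolding Kc_def by (intro closed_Collect_le continuous_on_compose2[OF F.continuous_n] continuous_intros) auto
    have bK: "bounded Kc"
    proof -
      obtain m where m: "m > 0" "\<And>a. m * norm a \<le> ?n a" using F.n_lower by blast
      have "Kc \<subseteq> cball b0 (\<rho> / m)"
      proof
        fix b assume "b \<in> Kc"
        then have "m * norm (b - b0) \<le> \<rho>" using m(2)[of "b - b0"] by (simp add: Kc_def)
        then show "b \<in> cball b0 (\<rho> / m)" using m(1) by (simp add: dist_norm norm_minus_commute field_simps)
      qed
      then show ?thesis by (rule bounded_subset[OF bounded_cball])
    qed
    have "continuous_on Kc (\<lambda>b. \<Phi> (a, P b) - b)"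
    proof (intro continuous_at_imp_continuous_on ballI)
      fix b assume "b \<in> Kc"
      then have "isCont \<Phi> (a, P b)" using \<Phi>J[OF PJ[OF a(1) PbK] P(2)] by blast
      then have "isCont (\<lambda>b. \<Phi> (a, P b)) b"
        by (intro isCont_o2[where f = "\<lambda>b. (a, P b)" and g = \<Phi>] continuous_intros bounded_linear.isCont[OF blP])
      then show "isCont (\<lambda>b. \<Phi> (a, P b) - b) b" by (intro continuous_intros)
    qed
    from continuous_closed_preimage_constant[OF this clK, of 0] have "closed Q" by (simp add: Q_def)
    then have cQ: "compact Q"
      unfolding compact_eq_bounded_closed using bounded_subset[OF bK] by (auto simp: Q_def)
    have \<beta>Q: "\<beta> a \<in> Q" using Sol\<beta>[OF a] a(2) \<rho>(1) by (simp add: Q_def Kc_def)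
    \<comment> \<open>The distance is finite on \<open>Kc\<close>; as a real function it is
      Lipschitz there, by the triangle inequality and the local upper bound.\<close>
    define \<delta> where "\<delta> b = enn2real (?d (chart_inv \<mu> b))" for b
    have dd: "?d (chart_inv \<mu> b) = ennreal (\<delta> b)" if "b \<in> Kc" for b
    proof -
      have "?d (chart_inv \<mu> b) \<le> ennreal ((1 + 1/2) * ?n (b - b0))"
        using \<rho>0(3)[of b0 b] that \<rho> by (simp add: y0_inv Kc_def)
      then have "?d (chart_inv \<mu> b) < top" by (rule le_less_trans) simp
      then show ?thesis by (simp add: \<delta>_def)
    qed
    have lip1: "\<delta> b' \<le> \<delta> b + 3/2 * M * dist b b'" if "b \<in> Kc" "b' \<in> Kc" for b b'
    proof -
      have "ennreal (\<delta> b') \<le> ennreal (\<delta> b) + riem_dist Y gY (chart_inv \<mu> b) (chart_inv \<mu> b')"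
        using riem_dist_triangle[OF DY gY, of y0 "chart_inv \<mu> b'" "chart_inv \<mu> b"] dd that by simp
      also have "\<dots> \<le> ennreal (\<delta> b) + ennreal ((1 + 1/2) * ?n (b' - b))"
        using \<rho>0(3)[of b b'] that \<rho> by (intro add_left_mono) (simp add: Kc_def)
      also have "\<dots> = ennreal (\<delta> b + (1 + 1/2) * ?n (b' - b))"
        using F.n_nonneg by (simp add: \<delta>_def ennreal_plus)
      finally have "\<delta> b' \<le> \<delta> b + (1 + 1/2) * ?n (b' - b)"
        using F.n_nonneg[of "b' - b"] by (subst (asm) ennreal_le_iff) (auto simp: \<delta>_def)
      also have "?n (b' - b) \<le> M * dist b b'" using M(2)[of "b' - b"] by (simp add: dist_norm norm_minus_commute)
      finally show ?thesis by simp
    qed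
    have "(3/2 * M)-lipschitz_on Kc \<delta>"
    proof (rule lipschitz_onI)
      show "dist (\<delta> b) (\<delta> b') \<le> 3/2 * M * dist b b'" if "b \<in> Kc" "b' \<in> Kc" for b b'
        using lip1[OF that] lip1[OF that(2,1)] unfolding dist_real_def dist_commute[of b' b] by linarith
    qed (use M in simp)
    then have "continuous_on Q \<delta>"
      by (rule continuous_on_subset[OF lipschitz_on_continuous_on]) (auto simp: Q_def)
    then obtain b where b: "b \<in> Q" "\<And>b'. b' \<in> Q \<Longrightarrow> \<delta> b \<le> \<delta> b'"
      using continuous_attains_inf[OF cQ] \<beta>Q by blast
    have bK': "b \<in> Kc" "b = \<Phi> (a, P b)" using b(1) by (auto simp: Q_def)
    have "is_arg_min ?d (Sol (chart_inv \<kappa> a)) (chart_inv \<mu> b)"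
      unfolding is_arg_min_def
    proof (intro conjI notI)
      show "Sol (chart_inv \<kappa> a) (chart_inv \<mu> b)" using PS[OF a(1) PbK[OF bK'(1)]] bK'(2) by simp
      assume "\<exists>y. Sol (chart_inv \<kappa> a) y \<and> ?d y < ?d (chart_inv \<mu> b)"
      then obtain y where y: "Sol (chart_inv \<kappa> a) y" "?d y < ?d (chart_inv \<mu> b)" by blast
      have "?d (chart_inv \<mu> b) \<le> ?d (chart_inv \<mu> (\<beta> a))"
        using b(2)[OF \<beta>Q] \<beta>Q bK' dd by (simp add: Q_def ennreal_leI)
      then have "?d y \<le> ?d (chart_inv \<mu> (\<beta> a))" using y(2) by simp
      from near[OF a y(1) this] have "snd \<mu> y \<in> Q" "chart_inv \<mu> (snd \<mu> y) = y"
        using is_chart_inv[OF my(1)] by (auto simp: Q_def Kc_def)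
      then have "?d (chart_inv \<mu> b) \<le> ?d y"
        using b(2)[of "snd \<mu> y"] dd[of "snd \<mu> y"] dd[OF bK'(1)] by (simp add: Q_def ennreal_leI)
      then show False using y(2) by simp
    qed
    then show ?thesis by blast
  qed
  have good: "\<forall>\<^sub>F a in nhds a0. Pa a \<and> ?n (\<beta> a - b0) < \<rho> / 4"
    using \<rho>(1) by (intro eventually_conj Pa F.eventually_n_less[OF \<beta>lim]) simp
  \<comment> \<open>From here on only the minimising property of the point chosen by
    \<open>arg_min\<close> is used, so the estimates hold whichever minimiser is chosen.\<close>
  have argmin: "is_arg_min ?d (Sol (chart_inv \<kappa> a)) (C (chart_inv \<kappa> a))"
    if "Pa a \<and> ?n (\<beta> a - b0) < \<rho> / 4" for a
    unfolding C_def arg_min_def by (rule someI_ex) (use exmin that in blast)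
  define m where "m = snd \<mu> \<circ> C \<circ> chart_inv \<kappa>"
  have le\<beta>: "?d (C (chart_inv \<kappa> a)) \<le> ?d (chart_inv \<mu> (\<beta> a))" and solC: "Sol (chart_inv \<kappa> a) (C (chart_inv \<kappa> a))"
    if "Pa a \<and> ?n (\<beta> a - b0) < \<rho> / 4" for a
    using argmin[OF that] Sol\<beta> that unfolding is_arg_min_def by (auto simp: not_less)
  have m: "C (chart_inv \<kappa> a) \<in> fst \<mu> \<and> m a = \<Phi> (a, P (m a))" if "Pa a \<and> ?n (\<beta> a - b0) < \<rho> / 4" for a
    using near[OF _ _ solC[OF that] le\<beta>[OF that]] that by (simp add: m_def)
  have opt: "\<forall>\<^sub>F a in nhds a0. (1 - \<epsilon>) * ?n (m a - b0) \<le> (1 + \<epsilon>) * ?n (\<Phi> (a, P b0) - b0)"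
    if \<epsilon>: "0 < \<epsilon>" "\<epsilon> < 1" for \<epsilon>
  proof -
    obtain r where r: "r > 0"
      "\<And>s s'. ?n (s - b0) \<le> r \<Longrightarrow> ?n (s' - b0) \<le> r \<Longrightarrow>
         riem_dist Y gY (chart_inv \<mu> s) (chart_inv \<mu> s') \<le> ennreal ((1 + \<epsilon>) * ?n (s' - s))"
      "\<And>q \<rho>. 0 \<le> \<rho> \<Longrightarrow> \<rho> \<le> r \<Longrightarrow> q \<in> fst \<mu> \<longrightarrow> \<rho> \<le> ?n (snd \<mu> q - b0) \<Longrightarrow>
         ennreal ((1 - \<epsilon>) * \<rho>) \<le> ?d q"
      using riem_dist_local[OF Y gY \<mu> \<epsilon>] unfolding b0_def by metis
    \<comment> \<open>Keeps the distance of the competitor below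
      \<open>(1 - \<epsilon>) * r\<close>. The lower bound covers radii up to \<open>r\<close> only,
      so it is applied to the truncated radius \<open>t\<close>; the competitor then forces
      \<open>t < r\<close>, which means that nothing was truncated.\<close>
    define r' where "r' = min r ((1 - \<epsilon>) * r / (1 + \<epsilon>))"
    have r': "r' > 0" using r(1) \<epsilon> by (simp add: r'_def)
    from good F.eventually_n_less[OF \<beta>lim r'] show ?thesis
    proof eventually_elim
      case (elim a)
      have 1: "?n (\<beta> a - b0) \<le> r" using elim(2) by (simp add: r'_def)
      have "?n (\<beta> a - b0) < (1 - \<epsilon>) * r / (1 + \<epsilon>)" using elim(2) by (simp add: r'_def)
      then have 2: "(1 + \<epsilon>) * ?n (\<beta> a - b0) < (1 - \<epsilon>) * r" using \<epsilon> by (simp add: field_simps)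
      define t where "t = min r (?n (m a - b0))"
      have "ennreal ((1 - \<epsilon>) * t) \<le> ?d (C (chart_inv \<kappa> a))"
        using r(1) F.n_nonneg by (intro r(3)) (auto simp: t_def m_def)
      also have "\<dots> \<le> ?d (chart_inv \<mu> (\<beta> a))" by (rule le\<beta>[OF elim(1)])
      also have "\<dots> \<le> ennreal ((1 + \<epsilon>) * ?n (\<beta> a - b0))" using r(2)[of b0 "\<beta> a"] 1 r(1) by (simp add: y0_inv)
      finally have 3: "(1 - \<epsilon>) * t \<le> (1 + \<epsilon>) * ?n (\<beta> a - b0)"
        using F.n_nonneg[of "\<beta> a - b0"] \<epsilon> by (subst (asm) ennreal_le_iff) auto
      then have "(1 - \<epsilon>) * t < (1 - \<epsilon>) * r" using 2 by simp
      then have "t < r" using \<epsilon> by simp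
      then have "t = ?n (m a - b0)" by (simp add: t_def)
      then show ?case using 3 by (simp add: \<beta>_def)
    qed
  qed
  have mev: "\<forall>\<^sub>F a in nhds a0. m a = \<Phi> (a, P (m a))" using good by eventually_elim (use m in blast)
  have orth': "chart_form Y gY \<mu> (snd \<mu> y0) (b - P b) k = 0" if "P k = k" for b k by (rule orth[OF that])
  note md = F.minimiser_has_derivative[OF P orth' \<Phi>0 d\<Phi> \<Phi>'K \<Phi>'P mev opt]
  show der: "(snd \<mu> \<circ> C \<circ> chart_inv \<kappa> has_derivative (\<lambda>h. \<Phi>' (h, 0))) (at (snd \<kappa> x0))"
    using md(2) unfolding m_def a0_def .
  have x0_inv: "chart_inv \<kappa> a0 = x0" unfolding a0_def by (rule is_chart_inv[OF kx])
  show C0: "C x0 = y0"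
  proof -
    have "C x0 \<in> fst \<mu>" using m[OF eventually_nhds_x_imp_x[OF good]] by (simp add: x0_inv)
    moreover have "snd \<mu> (C x0) = snd \<mu> y0" using md(1) by (simp add: m_def x0_inv b0_def)
    ultimately show ?thesis using is_chart_inv[OF my(1)] my(2) by metis
  qed
  have evx: "\<forall>\<^sub>F x in nhds x0. x \<in> fst \<kappa> \<and> (Pa (snd \<kappa> x) \<and> ?n (\<beta> (snd \<kappa> x) - b0) < \<rho> / 4)"
    using eventually_chart[OF kx good[unfolded a0_def]] .
  show "\<forall>\<^sub>F x in nhds x0. is_arg_min ?d (Sol x) (C x)"
    using evx
  proof eventually_elim
    case (elim x)
    then show ?case using argmin[of "snd \<kappa> x"] is_chart_inv[OF kx(1), of x] by simp
  qed
  have "\<forall>\<^sub>F x in nhds x0. chart_inv \<mu> (m (snd \<kappa> x)) = C x"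
    using evx
  proof eventually_elim
    case (elim x)
    then show ?case using m[of "snd \<kappa> x"] is_chart_inv[OF kx(1), of x] is_chart_inv[OF my(1), of "C x"]
      by (simp add: m_def)
  qed
  moreover have "isCont (\<lambda>x. chart_inv \<mu> (m (snd \<kappa> x))) x0"
  proof (rule isCont_o2[where f = "\<lambda>x. m (snd \<kappa> x)"])
    have "isCont m a0" using md(2) has_derivative_continuous by blast
    then show "isCont (\<lambda>x. m (snd \<kappa> x)) x0"
      using is_chart_isCont(1)[OF kx] unfolding a0_def by (intro isCont_o2[where f = "snd \<kappa>" and g = m])
    have "m (snd \<kappa> x0) = snd \<mu> y0" using md(1) by (simp add: a0_def b0_def)
    then show "isCont (chart_inv \<mu>) (m (snd \<kappa> x0))" using is_chart_isCont(2)[OF my] by simp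
  qed
  ultimately show "isCont C x0" by (simp add: isCont_cong)
qed


section \<open>Constant-rank elimination problems in charts\<close>

lemma chart_image_open:
  assumes \<kappa>: "is_chart \<kappa>" and U: "open U"
  shows "open (snd \<kappa> ` (fst \<kappa> \<inter> U))"
proof -
  have "snd \<kappa> ` (fst \<kappa> \<inter> U) = snd \<kappa> ` fst \<kappa> \<inter> chart_inv \<kappa> -` U"
  proof (intro set_eqI iffI)
    fix s assume "s \<in> snd \<kappa> ` fst \<kappa> \<inter> chart_inv \<kappa> -` U"
    then show "s \<in> snd \<kappa> ` (fst \<kappa> \<inter> U)"
      using is_chart_inv_in[OF \<kappa>, of s] is_chart_inv_right[OF \<kappa>, of s] by (intro image_eqI[of _ _ "chart_inv \<kappa> s"]) auto
  qed (auto simp: is_chart_inv[OF \<kappa>])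
  then show ?thesis
    using continuous_open_preimage[OF is_chart_cont_inv[OF \<kappa>] is_chart_open(2)[OF \<kappa>] U] by simp
qed

section \<open>Derivatives of slices and projections\<close>

lemma slice_derivative:
  assumes \<kappa>: "is_chart \<kappa>" "p \<in> fst \<kappa>" and \<mu>: "is_chart \<mu>" "q \<in> fst \<mu>"
    and L: "(snd \<omega> \<circ> f \<circ> chart_inv (prod_chart \<kappa> \<mu>) has_derivative L) (at (snd \<kappa> p, snd \<mu> q))"
  shows "(snd \<omega> \<circ> (\<lambda>y. f (p, y)) \<circ> chart_inv \<mu> has_derivative (\<lambda>u. L (0, u))) (at (snd \<mu> q))"
proof -
  have "((\<lambda>u. (snd \<kappa> p, u)) has_derivative (\<lambda>u. (0, u))) (at (snd \<mu> q))"
    by (auto intro!: derivative_eq_intros)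
  then have "((\<lambda>u. (snd \<omega> \<circ> f \<circ> chart_inv (prod_chart \<kappa> \<mu>)) (snd \<kappa> p, u)) has_derivative (\<lambda>u. L (0, u))) (at (snd \<mu> q))"
    by (rule has_derivative_compose[where f = "\<lambda>u. (snd \<kappa> p, u)", OF _ L])
  moreover have "\<forall>\<^sub>F u in nhds (snd \<mu> q). (snd \<omega> \<circ> f \<circ> chart_inv (prod_chart \<kappa> \<mu>)) (snd \<kappa> p, u) =
      (snd \<omega> \<circ> (\<lambda>y. f (p, y)) \<circ> chart_inv \<mu>) u"
    using eventually_in_chart_image[OF \<mu>]
    by eventually_elim (use \<kappa> \<mu> in \<open>simp add: prod_chart_inv is_chart_inv[OF \<kappa>]\<close>)
  ultimately show ?thesis by (rule has_derivative_nhds_cong)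
qed

lemma fst_projection_derivative:
  assumes "is_chart \<kappa>" "p \<in> fst \<kappa>" "is_chart \<mu>" "q \<in> fst \<mu>"
  shows "(snd \<kappa> \<circ> fst \<circ> chart_inv (prod_chart \<kappa> \<mu>) has_derivative fst) (at (snd \<kappa> p, snd \<mu> q))"
proof (rule has_derivative_nhds_cong[OF has_derivative_fst[OF has_derivative_ident]])
  show "\<forall>\<^sub>F s in nhds (snd \<kappa> p, snd \<mu> q). fst s = (snd \<kappa> \<circ> fst \<circ> chart_inv (prod_chart \<kappa> \<mu>)) s"
    using eventually_prod_chart_inv[OF assms]
    by eventually_elim (use is_chart_inv_right[OF assms(1)] in auto)
qed

lemma middle_projection_derivative:
  assumes "is_chart \<kappa>" "p \<in> fst \<kappa>" and \<mu>: "is_chart \<mu>" "q \<in> fst \<mu>" and \<nu>: "is_chart \<nu>" "r \<in> fst \<nu>"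
  shows "(snd \<mu> \<circ> (\<lambda>x. fst (snd x)) \<circ> chart_inv (prod_chart \<kappa> (prod_chart \<mu> \<nu>)) has_derivative (\<lambda>v. fst (snd v)))
    (at (snd \<kappa> p, snd \<mu> q, snd \<nu> r))"
proof (rule has_derivative_nhds_cong[OF has_derivative_fst[OF has_derivative_snd[OF has_derivative_ident]]])
  have pc: "is_chart (prod_chart \<mu> \<nu>)" "(q, r) \<in> fst (prod_chart \<mu> \<nu>)"
    using is_chart_prod[OF \<mu>(1) \<nu>(1)] \<mu> \<nu> by auto
  show "\<forall>\<^sub>F s in nhds (snd \<kappa> p, snd \<mu> q, snd \<nu> r). fst (snd s) =
      (snd \<mu> \<circ> (\<lambda>x. fst (snd x)) \<circ> chart_inv (prod_chart \<kappa> (prod_chart \<mu> \<nu>))) s"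
    using eventually_prod_chart_inv[OF assms(1,2) pc] unfolding prod_chart_simps prod_chart_image
    by eventually_elim (use is_chart_inv_right[OF \<mu>(1)] in \<open>auto simp: prod_chart_inv[OF \<mu>(1) \<nu>(1)]\<close>)
qed

lemma coord_vector_eq_0_iff:
  fixes A :: "('m::t2_space, 'e::real_normed_vector) chart set"
  assumes "diff_atlas A" "\<kappa> \<in> charts_at A p"
  shows "coord_vector A p \<kappa> a = 0 \<longleftrightarrow> a = 0"
proof
  assume "coord_vector A p \<kappa> a = 0"
  then have "coord_vector A p \<kappa> a \<kappa> = 0" by simp
  then show "a = 0" by (simp add: coord_vector_same[OF assms])
qed (simp add: linear_0[OF linear_coord_vector[OF assms]])

locale crep_charts =
  fixes X :: "('x::{t2_space, second_countable_topology}, 'a::finite_dim_inner) chart set"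
    and Y :: "('y::{t2_space, second_countable_topology}, 'b::finite_dim_inner) chart set"
    and Z :: "('z::{t2_space, second_countable_topology}, 'c::finite_dim_inner) chart set"
    and W :: "('w::{t2_space, second_countable_topology}, 'd::finite_dim_inner) chart set"
    and F :: "'x \<times> 'y \<times> 'z \<Rightarrow> 'w" and c :: 'w and r k :: nat
    and x0 :: 'x and y0 :: 'y and z0 :: 'z
    and \<kappa> \<mu> \<nu> \<omega>
  assumes crep: "CREP X Y Z W F c r k"
    and solution: "F (x0, y0, z0) = c"
    and \<kappa>: "\<kappa> \<in> charts_at X x0" and \<mu>: "\<mu> \<in> charts_at Y y0"
    and \<nu>: "\<nu> \<in> charts_at Z z0" and \<omega>: "\<omega> \<in> charts_at W c"
begin

lemma manifolds: "smooth_manifold X" "smooth_manifold Y" "smooth_manifold Z" "smooth_manifold W"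
  using crep by (auto simp: CREP_def)

lemma diff_X: "diff_atlas X" and diff_Y: "diff_atlas Y" and diff_Z: "diff_atlas Z" and diff_W: "diff_atlas W"
  using manifolds by (auto intro: smooth_manifold_imp_diff_atlas)

abbreviation XYZ where "XYZ \<equiv> prod_atlas X (prod_atlas Y Z)"

lemma diff_YZ: "diff_atlas (prod_atlas Y Z)" and diff_XYZ: "diff_atlas XYZ"
  by (intro diff_atlas_prod diff_X diff_Y diff_Z)+

lemma chart_\<kappa>: "is_chart \<kappa>" "x0 \<in> fst \<kappa>" and chart_\<mu>: "is_chart \<mu>" "y0 \<in> fst \<mu>"
  and chart_\<nu>: "is_chart \<nu>" "z0 \<in> fst \<nu>" and chart_\<omega>: "is_chart \<omega>" "c \<in> fst \<omega>"
  using charts_at_chart[OF diff_X \<kappa>] charts_at_chart[OF diff_Y \<mu>] charts_at_chart[OF diff_Z \<nu>]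
    charts_at_chart[OF diff_W \<omega>] by auto

definition "pc = prod_chart \<kappa> (prod_chart \<mu> \<nu>)"

definition "f = snd \<omega> \<circ> F \<circ> chart_inv pc"

definition "f' p = frechet_derivative f (at p)"

text \<open>The set where \<open>f\<close> represents \<open>F\<close>; elsewhere its values carry
  no meaning, because chart maps matter on their domains only.\<close>

definition "G = snd pc ` (fst pc \<inter> F -` fst \<omega>)"

abbreviation "a0 \<equiv> snd \<kappa> x0"
abbreviation "b0 \<equiv> snd \<mu> y0"
abbreviation "c0 \<equiv> snd \<nu> z0"

lemma chart_YZ: "is_chart (prod_chart \<mu> \<nu>)" "(y0, z0) \<in> fst (prod_chart \<mu> \<nu>)"
  using is_chart_prod[OF chart_\<mu>(1) chart_\<nu>(1)] chart_\<mu> chart_\<nu> by auto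

lemma chart_pc: "is_chart pc"
  unfolding pc_def by (intro is_chart_prod chart_\<kappa> chart_YZ)

lemma pc_at: "pc \<in> charts_at XYZ (x0, y0, z0)"
  unfolding pc_def by (intro prod_chart_in_charts_at \<kappa> \<mu> \<nu>)

lemma YZ_at: "prod_chart \<mu> \<nu> \<in> charts_at (prod_atlas Y Z) (y0, z0)"
  by (intro prod_chart_in_charts_at \<mu> \<nu>)

lemma pc_in_XYZ: "pc \<in> XYZ" using pc_at by (simp add: charts_at_def)

lemma \<omega>_at: "\<omega> \<in> charts_at W (F (x0, y0, z0))" using \<omega> solution by simp

lemma F_smooth: "smooth_map XYZ W F" using crep by (simp add: CREP_def)

lemma F_cont: "isCont F p"
  using F_smooth unfolding smooth_map_def continuous_on_eq_continuous_at[OF open_UNIV] by blast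

lemma f_smooth: "smooth_on G f"
proof -
  have "\<omega> \<in> W" using \<omega> by (simp add: charts_at_def)
  then show ?thesis using F_smooth pc_in_XYZ by (simp add: smooth_map_def f_def G_def)
qed

lemma open_G: "open G"
proof -
  have "open (F -` fst \<omega>)"
    using F_smooth is_chart_open(1)[OF chart_\<omega>(1)] by (intro open_vimage) (auto simp: smooth_map_def)
  then show ?thesis unfolding G_def by (rule chart_image_open[OF chart_pc])
qed

lemma pc_p0: "snd pc (x0, y0, z0) = (a0, b0, c0)" by (simp add: pc_def)

lemma p0_in_G: "(a0, b0, c0) \<in> G"
proof -
  have "(x0, y0, z0) \<in> fst pc \<inter> F -` fst \<omega>"
    using chart_\<kappa> chart_\<mu> chart_\<nu> chart_\<omega> solution by (simp add: pc_def)
  then show ?thesis unfolding G_def using pc_p0 by (metis imageI)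
qed

lemma f_derivative: "p \<in> G \<Longrightarrow> (f has_derivative f' p) (at p)"
  unfolding f'_def using smooth_onD(1)[OF f_smooth] by (simp add: frechet_derivative_works)

lemma f'_cont: "isCont (\<lambda>p. f' p v) (a0, b0, c0)"
  using smooth_onD(2)[OF f_smooth, of v] open_G p0_in_G
  unfolding f'_def by (simp add: continuous_on_eq_continuous_at)

lemma point_of_G:
  assumes "p \<in> G"
  obtains x y z where "p = (snd \<kappa> x, snd \<mu> y, snd \<nu> z)" "p = snd pc (x, y, z)" "x \<in> fst \<kappa>" "y \<in> fst \<mu>" "z \<in> fst \<nu>"
    "F (x, y, z) \<in> fst \<omega>"
  using assms unfolding G_def by (auto simp: pc_def)

lemma f'_slices:
  assumes "p \<in> G" and p: "p = (snd \<kappa> x, snd \<mu> y, snd \<nu> z)" and x: "x \<in> fst \<kappa>" "y \<in> fst \<mu>" "z \<in> fst \<nu>"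
  shows "(snd \<omega> \<circ> F \<circ> chart_inv pc has_derivative f' p) (at (snd pc (x, y, z)))"
    and "(snd \<omega> \<circ> (\<lambda>v. F (x, v)) \<circ> chart_inv (prod_chart \<mu> \<nu>) has_derivative (\<lambda>u. f' p (0, u)))
      (at (snd (prod_chart \<mu> \<nu>) (y, z)))"
    and "(snd \<omega> \<circ> (\<lambda>z. F (x, y, z)) \<circ> chart_inv \<nu> has_derivative (\<lambda>\<zeta>. f' p (0, 0, \<zeta>))) (at (snd \<nu> z))"
proof -
  have eq: "snd pc (x, y, z) = p" by (simp add: p pc_def)
  show 1: "(snd \<omega> \<circ> F \<circ> chart_inv pc has_derivative f' p) (at (snd pc (x, y, z)))"
    unfolding eq using f_derivative[OF assms(1)] by (simp add: f_def)
  have yz: "(y, z) \<in> fst (prod_chart \<mu> \<nu>)" using x by simp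
  have "(snd \<omega> \<circ> F \<circ> chart_inv (prod_chart \<kappa> (prod_chart \<mu> \<nu>)) has_derivative f' p)
      (at (snd \<kappa> x, snd (prod_chart \<mu> \<nu>) (y, z)))"
    using 1 unfolding pc_def prod_chart_simps .
  from slice_derivative[OF chart_\<kappa>(1) x(1) chart_YZ(1) yz this]
  show 2: "(snd \<omega> \<circ> (\<lambda>v. F (x, v)) \<circ> chart_inv (prod_chart \<mu> \<nu>) has_derivative (\<lambda>u. f' p (0, u)))
      (at (snd (prod_chart \<mu> \<nu>) (y, z)))" .
  from slice_derivative[OF chart_\<mu>(1) x(2) chart_\<nu>(1) x(3) 2[unfolded prod_chart_simps]]
  show "(snd \<omega> \<circ> (\<lambda>z. F (x, y, z)) \<circ> chart_inv \<nu> has_derivative (\<lambda>\<zeta>. f' p (0, 0, \<zeta>))) (at (snd \<nu> z))" .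
qed

lemma slice_cont: "isCont (\<lambda>v. F (x, v)) v" "isCont (\<lambda>z. F (x, y, z)) z"
  by (rule isCont_o2[where f = "\<lambda>v. (x, v)" and g = F, OF _ F_cont], intro continuous_intros,
      rule isCont_o2[where f = "\<lambda>z. (x, y, z)" and g = F, OF _ F_cont], intro continuous_intros)

lemma slice_eq: "(\<lambda>(y', z'). F (x, y', z')) = (\<lambda>v. F (x, v))" by auto

lemma ranks:
  assumes "p \<in> G"
  shows "dim (range (f' p)) = r" "dim (range (\<lambda>u. f' p (0, u))) = r" "dim (range (\<lambda>\<zeta>. f' p (0, 0, \<zeta>))) = k"
proof -
  obtain x y z where p: "p = (snd \<kappa> x, snd \<mu> y, snd \<nu> z)" and x: "x \<in> fst \<kappa>" "y \<in> fst \<mu>" "z \<in> fst \<nu>"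
    and Fx: "F (x, y, z) \<in> fst \<omega>" using assms by (rule point_of_G) blast
  note d = f'_slices[OF assms p x]
  have \<kappa>x: "\<kappa> \<in> charts_at X x" and \<mu>y: "\<mu> \<in> charts_at Y y" and \<nu>z: "\<nu> \<in> charts_at Z z"
    and \<omega>F: "\<omega> \<in> charts_at W (F (x, y, z))"
    using \<kappa> \<mu> \<nu> \<omega> x Fx by (auto simp: charts_at_def)
  have pcx: "pc \<in> charts_at XYZ (x, y, z)"
    unfolding pc_def by (intro prod_chart_in_charts_at \<kappa>x \<mu>y \<nu>z)
  show "dim (range (f' p)) = r"
    using rank_at_coord[OF diff_XYZ diff_W F_cont pcx \<omega>F d(1)] crep by (simp add: CREP_def)
  show "dim (range (\<lambda>u. f' p (0, u))) = r"
    using rank_at_coord[OF diff_YZ diff_W slice_cont(1) prod_chart_in_charts_at[OF \<mu>y \<nu>z] \<omega>F d(2)] crep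
    by (simp add: CREP_def slice_eq)
  show "dim (range (\<lambda>\<zeta>. f' p (0, 0, \<zeta>))) = k"
    using rank_at_coord[OF diff_Z diff_W slice_cont(2) \<nu>z \<omega>F d(3)] crep by (simp add: CREP_def)
qed

definition "D = f' (a0, b0, c0)"

lemma linear_D: "linear D"
  unfolding D_def using f_derivative[OF p0_in_G] by (rule has_derivative_linear)

lemmas p0_slices = f'_slices[OF p0_in_G refl chart_\<kappa>(2) chart_\<mu>(2) chart_\<nu>(2), folded D_def]

lemma projX_eq: "(\<lambda>(x, y, z). x) = (fst :: 'x \<times> 'y \<times> 'z \<Rightarrow> 'x)"
  and projY_eq: "(\<lambda>(x, y, z). y) = (\<lambda>x :: 'x \<times> 'y \<times> 'z. fst (snd x))"
  and projYZ_eq: "(\<lambda>(y, z). y) = (fst :: 'y \<times> 'z \<Rightarrow> 'y)"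
  by auto

lemma differential_XYZ:
  assumes v: "v \<in> tangent_space XYZ (x0, y0, z0)"
  shows "differential XYZ X (\<lambda>(x, y, z). x) (x0, y0, z0) v = coord_vector X x0 \<kappa> (fst (v pc))"
    and "differential XYZ Y (\<lambda>(x, y, z). y) (x0, y0, z0) v = coord_vector Y y0 \<mu> (fst (snd (v pc)))"
    and "differential XYZ W F (x0, y0, z0) v = 0 \<longleftrightarrow> D (v pc) = 0"
proof -
  have "(snd \<kappa> \<circ> fst \<circ> chart_inv pc has_derivative fst) (at (snd pc (x0, y0, z0)))"
    unfolding pc_p0 using fst_projection_derivative[OF chart_\<kappa> chart_YZ] by (simp add: pc_def)
  from differential_coord(2)[OF diff_XYZ diff_X _ pc_at _ this v] \<kappa>
  show "differential XYZ X (\<lambda>(x, y, z). x) (x0, y0, z0) v = coord_vector X x0 \<kappa> (fst (v pc))"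
    unfolding projX_eq by simp
  have "(snd \<mu> \<circ> (\<lambda>x. fst (snd x)) \<circ> chart_inv pc has_derivative (\<lambda>v. fst (snd v))) (at (snd pc (x0, y0, z0)))"
    unfolding pc_p0 using middle_projection_derivative[OF chart_\<kappa> chart_\<mu> chart_\<nu>] by (simp add: pc_def)
  from differential_coord(2)[OF diff_XYZ diff_Y _ pc_at _ this v] \<mu>
  show "differential XYZ Y (\<lambda>(x, y, z). y) (x0, y0, z0) v = coord_vector Y y0 \<mu> (fst (snd (v pc)))"
    unfolding projY_eq by simp
  show "differential XYZ W F (x0, y0, z0) v = 0 \<longleftrightarrow> D (v pc) = 0"
    using differential_coord(2)[OF diff_XYZ diff_W F_cont pc_at \<omega>_at p0_slices(1) v]
      coord_vector_eq_0_iff[OF diff_W \<omega>_at] by simp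
qed

lemma differential_YZ:
  assumes v: "v \<in> tangent_space (prod_atlas Y Z) (y0, z0)"
  shows "differential (prod_atlas Y Z) Y (\<lambda>(y, z). y) (y0, z0) v = coord_vector Y y0 \<mu> (fst (v (prod_chart \<mu> \<nu>)))"
    and "differential (prod_atlas Y Z) W (\<lambda>(y, z). F (x0, y, z)) (y0, z0) v = 0 \<longleftrightarrow> D (0, v (prod_chart \<mu> \<nu>)) = 0"
proof -
  have "(snd \<mu> \<circ> fst \<circ> chart_inv (prod_chart \<mu> \<nu>) has_derivative fst) (at (snd (prod_chart \<mu> \<nu>) (y0, z0)))"
    using fst_projection_derivative[OF chart_\<mu> chart_\<nu>] by simp
  from differential_coord(2)[OF diff_YZ diff_Y _ YZ_at _ this v] \<mu>
  show "differential (prod_atlas Y Z) Y (\<lambda>(y, z). y) (y0, z0) v = coord_vector Y y0 \<mu> (fst (v (prod_chart \<mu> \<nu>)))"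
    unfolding projYZ_eq by simp
  show "differential (prod_atlas Y Z) W (\<lambda>(y, z). F (x0, y, z)) (y0, z0) v = 0 \<longleftrightarrow> D (0, v (prod_chart \<mu> \<nu>)) = 0"
    using differential_coord(2)[OF diff_YZ diff_W slice_cont(1) YZ_at \<omega>_at p0_slices(2) v]
      coord_vector_eq_0_iff[OF diff_W \<omega>_at] unfolding slice_eq by simp
qed

text \<open>Moves the constraint of the minimisation, in the form in which
  \<open>proposition12\<close> states it, into charts. Every triple of coordinates comes from a
  tangent vector of the product manifold through \<open>coord_vector\<close>, so the latent
  component becomes a plain vector \<open>\<zeta>\<close>.\<close>

lemma feasible_iff:
  "(\<exists>u\<in>tangent_space XYZ (x0, y0, z0).
      differential XYZ X (\<lambda>(x, y, z). x) (x0, y0, z0) u = \<xi> \<and>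
      differential XYZ Y (\<lambda>(x, y, z). y) (x0, y0, z0) u = \<eta> \<and>
      differential XYZ W F (x0, y0, z0) u = 0) \<longleftrightarrow>
   \<xi> \<in> tangent_space X x0 \<and> \<eta> \<in> tangent_space Y y0 \<and> (\<exists>\<zeta>. D (\<xi> \<kappa>, \<eta> \<mu>, \<zeta>) = 0)" (is "?L \<longleftrightarrow> ?R")
proof
  assume ?L
  then obtain u where u: "u \<in> tangent_space XYZ (x0, y0, z0)" "\<xi> = coord_vector X x0 \<kappa> (fst (u pc))"
    "\<eta> = coord_vector Y y0 \<mu> (fst (snd (u pc)))" "D (u pc) = 0"
    using differential_XYZ by metis
  have "(\<xi> \<kappa>, \<eta> \<mu>, snd (snd (u pc))) = u pc"
    using u(2,3) by (simp add: coord_vector_same[OF diff_X \<kappa>] coord_vector_same[OF diff_Y \<mu>])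
  then have "D (\<xi> \<kappa>, \<eta> \<mu>, snd (snd (u pc))) = 0" using u(4) by simp
  then show ?R using u(2,3) coord_vector_in_tangent_space[OF diff_X \<kappa>] coord_vector_in_tangent_space[OF diff_Y \<mu>]
    by blast
next
  assume R: ?R
  then obtain \<zeta> where \<zeta>: "D (\<xi> \<kappa>, \<eta> \<mu>, \<zeta>) = 0" by blast
  define u where "u = coord_vector XYZ (x0, y0, z0) pc (\<xi> \<kappa>, \<eta> \<mu>, \<zeta>)"
  have uT: "u \<in> tangent_space XYZ (x0, y0, z0)" unfolding u_def by (rule coord_vector_in_tangent_space[OF diff_XYZ pc_at])
  have upc: "u pc = (\<xi> \<kappa>, \<eta> \<mu>, \<zeta>)" unfolding u_def by (rule coord_vector_same[OF diff_XYZ pc_at])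
  show ?L
    using differential_XYZ[OF uT] \<zeta> R uT
    by (intro bexI[of _ u]) (auto simp: upc tangent_space_coord[OF \<kappa>] tangent_space_coord[OF \<mu>])
qed

lemma proj_ker_xy_iff:
  "(\<xi>, \<eta>) \<in> proj_ker_xy X Y Z W F (x0, y0, z0) \<longleftrightarrow>
   \<xi> \<in> tangent_space X x0 \<and> \<eta> \<in> tangent_space Y y0 \<and> (\<exists>\<zeta>. D (\<xi> \<kappa>, \<eta> \<mu>, \<zeta>) = 0)"
  unfolding feasible_iff[symmetric] proj_ker_xy_def ker_differential_def by blast

lemma proj_ker_y_iff:
  "\<eta> \<in> proj_ker_y Y Z W F (x0, y0, z0) \<longleftrightarrow> \<eta> \<in> tangent_space Y y0 \<and> (\<exists>\<zeta>. D (0, \<eta> \<mu>, \<zeta>) = 0)" (is "?L \<longleftrightarrow> ?R")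
proof
  assume ?L
  then obtain u where u: "u \<in> tangent_space (prod_atlas Y Z) (y0, z0)"
    "\<eta> = coord_vector Y y0 \<mu> (fst (u (prod_chart \<mu> \<nu>)))" "D (0, u (prod_chart \<mu> \<nu>)) = 0"
    using differential_YZ unfolding proj_ker_y_def ker_differential_def fst_conv snd_conv by blast
  have "(\<eta> \<mu>, snd (u (prod_chart \<mu> \<nu>))) = u (prod_chart \<mu> \<nu>)"
    using u(2) by (simp add: coord_vector_same[OF diff_Y \<mu>])
  then have "D (0, \<eta> \<mu>, snd (u (prod_chart \<mu> \<nu>))) = 0" using u(3) by simp
  then show ?R using u(2) coord_vector_in_tangent_space[OF diff_Y \<mu>] by blast
next
  assume R: ?R
  then obtain \<zeta> where \<zeta>: "D (0, \<eta> \<mu>, \<zeta>) = 0" by blast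
  define u where "u = coord_vector (prod_atlas Y Z) (y0, z0) (prod_chart \<mu> \<nu>) (\<eta> \<mu>, \<zeta>)"
  have uT: "u \<in> tangent_space (prod_atlas Y Z) (y0, z0)"
    unfolding u_def by (rule coord_vector_in_tangent_space[OF diff_YZ YZ_at])
  have upc: "u (prod_chart \<mu> \<nu>) = (\<eta> \<mu>, \<zeta>)" unfolding u_def by (rule coord_vector_same[OF diff_YZ YZ_at])
  have "\<eta> = differential (prod_atlas Y Z) Y (\<lambda>(y, z). y) (y0, z0) u"
    using differential_YZ(1)[OF uT] R by (simp add: upc tangent_space_coord[OF \<mu>])
  moreover have "u \<in> ker_differential (prod_atlas Y Z) W (\<lambda>(y, z). F (x0, y, z)) (y0, z0)"
    using differential_YZ(2)[OF uT] \<zeta> uT by (simp add: upc ker_differential_def)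
  ultimately show ?L unfolding proj_ker_y_def fst_conv snd_conv by blast
qed

end

section \<open>The linear system and its shortest solution\<close>

locale riemannian_crep = crep_charts X Y Z W F c r k x0 y0 z0 \<kappa> \<mu> \<nu> \<omega> +
  fm: inner_form "chart_form Y gY \<mu> (snd \<mu> y0)"
  for X :: "('x::{t2_space, second_countable_topology}, 'a::finite_dim_inner) chart set"
    and Y :: "('y::{t2_space, second_countable_topology}, 'b::finite_dim_inner) chart set"
    and Z :: "('z::{t2_space, second_countable_topology}, 'c::finite_dim_inner) chart set"
    and W :: "('w::{t2_space, second_countable_topology}, 'd::finite_dim_inner) chart set"
    and F c r k x0 y0 z0 \<kappa> \<mu> \<nu> \<omega> gY +
  assumes metric_Y: "riemannian_metric Y gY"
begin

abbreviation "B \<equiv> chart_form Y gY \<mu> (snd \<mu> y0)"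

lemma gY_coord:
  assumes "\<eta> \<in> tangent_space Y y0" "\<eta>' \<in> tangent_space Y y0"
  shows "gY y0 \<eta> \<eta>' = B (\<eta> \<mu>) (\<eta>' \<mu>)"
  using assms by (simp add: chart_form_at[OF chart_\<mu>] tangent_space_coord[OF \<mu>])

lemma riem_norm_coord: "\<eta> \<in> tangent_space Y y0 \<Longrightarrow> riem_norm gY y0 \<eta> = fm.n (\<eta> \<mu>)"
  by (simp add: riem_norm_def fm.n_def gY_coord)

text \<open>The subspace \<open>D\<pi>\<^sub>Y[ker \<partial>F/\<partial>(y,z)]\<close> in the
  chart: output directions in which solutions can move while the input rests.\<close>

definition "K = {\<eta>. \<exists>\<zeta>. D (0, \<eta>, \<zeta>) = 0}"

lemma D_add: "D (u + v) = D u + D v" and D_scale: "D (t *\<^sub>R u) = t *\<^sub>R D u" and D_diff: "D (u - v) = D u - D v"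
  using linear_D by (auto simp: linear_add linear_cmul linear_diff)

lemma subspace_K: "subspace K"
  unfolding subspace_def
proof (intro conjI ballI allI)
  have "D (0, 0, 0) = 0" using linear_0[OF linear_D] by (simp add: zero_prod_def)
  then show "0 \<in> K" by (auto simp: K_def)
  show "x + y \<in> K" if xy: "x \<in> K" "y \<in> K" for x y
  proof -
    obtain \<zeta> \<zeta>' where z: "D (0, x, \<zeta>) = 0" "D (0, y, \<zeta>') = 0" using xy by (auto simp: K_def)
    then have "D (0, x + y, \<zeta> + \<zeta>') = 0" using D_add[of "(0, x, \<zeta>)" "(0, y, \<zeta>')"] by simp
    then show ?thesis by (auto simp: K_def)
  qed
  show "t *\<^sub>R x \<in> K" if x: "x \<in> K" for t x
  proof -
    obtain \<zeta> where z: "D (0, x, \<zeta>) = 0" using x by (auto simp: K_def)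
    then have "D (0, t *\<^sub>R x, t *\<^sub>R \<zeta>) = 0" using D_scale[of t "(0, x, \<zeta>)"] by simp
    then show ?thesis by (auto simp: K_def)
  qed
qed

text \<open>Feasible outputs for one input direction form a coset of \<open>K\<close>; this is
  behind both uniqueness and minimality.\<close>

lemma horizontal_difference:
  assumes "D (a, b, \<zeta>) = 0" "D (a, b', \<zeta>') = 0"
  shows "b - b' \<in> K"
  using D_diff[of "(a, b, \<zeta>)" "(a, b', \<zeta>')"] assms by (auto simp: K_def)

lemma solves_system_iff:
  assumes L: "linear L" "\<And>a. \<exists>\<zeta>. D (a, L a, \<zeta>) = 0" "\<And>a k. k \<in> K \<Longrightarrow> B (L a) k = 0"
  shows "solves_system X Y Z W gY F x0 y0 z0 DH \<longleftrightarrow>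
    DH = (\<lambda>\<xi>\<in>tangent_space X x0. coord_vector Y y0 \<mu> (L (\<xi> \<kappa>)))" (is "?S \<longleftrightarrow> DH = ?M")
proof
  assume S: ?S
  then have ext: "DH \<in> tangent_space X x0 \<rightarrow>\<^sub>E tangent_space Y y0"
    and ker: "\<And>\<xi>. \<xi> \<in> tangent_space X x0 \<Longrightarrow> (\<xi>, DH \<xi>) \<in> proj_ker_xy X Y Z W F (x0, y0, z0)"
    and orth: "\<And>\<xi> \<eta>. \<xi> \<in> tangent_space X x0 \<Longrightarrow> \<eta> \<in> proj_ker_y Y Z W F (x0, y0, z0) \<Longrightarrow> gY y0 (DH \<xi>) \<eta> = 0"
    by (auto simp: solves_system_def linear_maps_def)
  have eq: "DH \<xi> = coord_vector Y y0 \<mu> (L (\<xi> \<kappa>))" if \<xi>: "\<xi> \<in> tangent_space X x0" for \<xi>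
  proof -
    define d where "d = DH \<xi> \<mu> - L (\<xi> \<kappa>)"
    have T: "DH \<xi> \<in> tangent_space Y y0" using ext \<xi> by auto
    obtain \<zeta> where "D (\<xi> \<kappa>, DH \<xi> \<mu>, \<zeta>) = 0" using ker[OF \<xi>] by (auto simp: proj_ker_xy_iff)
    moreover obtain \<zeta>' where "D (\<xi> \<kappa>, L (\<xi> \<kappa>), \<zeta>') = 0" using L(2) by blast
    ultimately have dK: "d \<in> K" unfolding d_def by (rule horizontal_difference)
    define \<eta> where "\<eta> = coord_vector Y y0 \<mu> d"
    have \<eta>: "\<eta> \<in> tangent_space Y y0" "\<eta> \<mu> = d"
      unfolding \<eta>_def by (rule coord_vector_in_tangent_space[OF diff_Y \<mu>], rule coord_vector_same[OF diff_Y \<mu>])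
    then have "\<eta> \<in> proj_ker_y Y Z W F (x0, y0, z0)" using dK by (simp add: proj_ker_y_iff K_def)
    then have "B (DH \<xi> \<mu>) d = 0" using orth[OF \<xi>] gY_coord[OF T \<eta>(1)] \<eta>(2) by simp
    \<comment> \<open>\<open>d\<close> lies in \<open>K\<close> and is a difference of two vectors
      orthogonal to \<open>K\<close>.\<close>
    then have "B d d = 0" using L(3)[OF dK] by (simp add: d_def fm.left_simps)
    then have "d = 0" using fm.pos[of d] by auto
    then show ?thesis using tangent_space_coord[OF \<mu> T] by (simp add: d_def)
  qed
  show "DH = ?M"
  proof
    show "DH \<xi> = ?M \<xi>" for \<xi>
      using eq[of \<xi>] ext by (cases "\<xi> \<in> tangent_space X x0") (auto simp: PiE_def extensional_def)
  qed
next
  assume DH: "DH = ?M"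
  let ?c = "coord_vector Y y0 \<mu>"
  have T: "?c b \<in> tangent_space Y y0" for b by (rule coord_vector_in_tangent_space[OF diff_Y \<mu>])
  have same: "?c b \<mu> = b" for b by (rule coord_vector_same[OF diff_Y \<mu>])
  note sub = subspace_tangent_space[OF diff_X, of x0]
  have lin: "linear (\<lambda>\<xi>. ?c (L (\<xi> \<kappa>)))"
    using linear_coord_vector[OF diff_Y \<mu>]
    by (intro linearI) (simp_all add: linear_add[OF L(1)] linear_cmul[OF L(1)] linear_add linear_cmul scaleR_fun_def[of _ "_ :: ('x, 'a) tangent"])
  show ?S
    unfolding solves_system_def linear_maps_def DH
  proof (intro conjI ballI CollectI allI)
    show "?M \<in> tangent_space X x0 \<rightarrow>\<^sub>E tangent_space Y y0" using T by auto
    show "?M (u + v) = ?M u + ?M v" if "u \<in> tangent_space X x0" "v \<in> tangent_space X x0" for u v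
      using that subspace_add[OF sub that] linear_add[OF lin, of u v] by simp
    show "?M (t *\<^sub>R u) = t *\<^sub>R ?M u" if "u \<in> tangent_space X x0" for t u
      using that subspace_scale[OF sub that, of t] linear_cmul[OF lin, of t u] by simp
    show "(\<xi>, ?M \<xi>) \<in> proj_ker_xy X Y Z W F (x0, y0, z0)" if "\<xi> \<in> tangent_space X x0" for \<xi>
      using that T same L(2) by (simp add: proj_ker_xy_iff)
    show "gY y0 (?M \<xi>) \<eta> = 0" if "\<xi> \<in> tangent_space X x0" "\<eta> \<in> proj_ker_y Y Z W F (x0, y0, z0)" for \<xi> \<eta>
    proof -
      have \<eta>: "\<eta> \<in> tangent_space Y y0" "\<eta> \<mu> \<in> K" using that(2) by (auto simp: proj_ker_y_iff K_def)
      then show ?thesis using that(1) L(3)[OF \<eta>(2)] by (simp add: gY_coord[OF T] same)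
    qed
  qed
qed

text \<open>Feasible vectors differ from \<open>L (\<xi> \<kappa>)\<close> by some \<open>d\<close>
  in \<open>K\<close>, and by Pythagoras the inequality of norms is strict unless
  \<open>d = 0\<close>; this strictness is what makes the set of minimisers a singleton.\<close>

lemma arg_min_feasible:
  assumes L: "\<And>a. \<exists>\<zeta>. D (a, L a, \<zeta>) = 0" "\<And>a k. k \<in> K \<Longrightarrow> B (L a) k = 0"
    and \<xi>: "\<xi> \<in> tangent_space X x0"
  shows "{\<eta>. is_arg_min (riem_norm gY y0)
    (\<lambda>\<eta>. \<xi> \<in> tangent_space X x0 \<and> \<eta> \<in> tangent_space Y y0 \<and> (\<exists>\<zeta>. D (\<xi> \<kappa>, \<eta> \<mu>, \<zeta>) = 0)) \<eta>} =
    {coord_vector Y y0 \<mu> (L (\<xi> \<kappa>))}"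
proof -
  let ?l = "L (\<xi> \<kappa>)"
  let ?\<eta> = "coord_vector Y y0 \<mu> ?l"
  let ?P = "\<lambda>\<eta>. \<xi> \<in> tangent_space X x0 \<and> \<eta> \<in> tangent_space Y y0 \<and> (\<exists>\<zeta>. D (\<xi> \<kappa>, \<eta> \<mu>, \<zeta>) = 0)"
  have T: "?\<eta> \<in> tangent_space Y y0" and same: "?\<eta> \<mu> = ?l"
    by (rule coord_vector_in_tangent_space[OF diff_Y \<mu>], rule coord_vector_same[OF diff_Y \<mu>])
  have P: "?P ?\<eta>" using \<xi> T same L(1) by simp
  have less: "riem_norm gY y0 ?\<eta> < riem_norm gY y0 \<eta>" if \<eta>: "?P \<eta>" "\<eta> \<noteq> ?\<eta>" for \<eta>
  proof -
    define d where "d = \<eta> \<mu> - ?l"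
    have dK: "d \<in> K" using \<eta>(1) L(1)[of "\<xi> \<kappa>"] horizontal_difference unfolding d_def by blast
    have "d \<noteq> 0" using \<eta> tangent_space_coord[OF \<mu>, of \<eta>] by (auto simp: d_def)
    then have "0 < fm.n d" by (rule fm.n_pos)
    moreover have "(fm.n (?l + d))\<^sup>2 = (fm.n ?l)\<^sup>2 + (fm.n d)\<^sup>2"
      by (rule fm.n_orthogonal_add[OF L(2)[OF dK]])
    ultimately have "(fm.n ?l)\<^sup>2 < (fm.n (?l + d))\<^sup>2" using \<open>d \<noteq> 0\<close> by simp
    then have "fm.n ?l < fm.n (?l + d)" using fm.n_nonneg by (rule power2_less_imp_less)
    moreover have "?l + d = \<eta> \<mu>" by (simp add: d_def)
    ultimately show ?thesis using \<eta>(1) T same by (simp add: riem_norm_coord)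
  qed
  have "is_arg_min (riem_norm gY y0) ?P \<eta> \<longleftrightarrow> \<eta> = ?\<eta>" for \<eta>
  proof
    assume "is_arg_min (riem_norm gY y0) ?P \<eta>"
    then show "\<eta> = ?\<eta>" using less[of \<eta>] P unfolding is_arg_min_def by blast
  next
    assume eq: "\<eta> = ?\<eta>"
    have "\<not> riem_norm gY y0 \<eta>' < riem_norm gY y0 ?\<eta>" if "?P \<eta>'" for \<eta>'
      using less[OF that] by (cases "\<eta>' = ?\<eta>") auto
    then show "is_arg_min (riem_norm gY y0) ?P \<eta>" using P unfolding is_arg_min_def eq by blast
  qed
  then show ?thesis by blast
qed

text \<open>The two restrictions on \<open>Zh\<close> serve one inclusion each. The upper bound on
  \<open>Zh\<close> keeps away latent values that would bring in other branches of solutions, and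
  \<open>z0 \<in> interior Zh\<close> provides a latent value in \<open>Zh\<close> for every point
  of the graph near the base point. So one \<open>\<Phi>\<close> serves all small
  \<open>Zh\<close>.\<close>

lemma solution_set_graph:
  assumes V: "open V" "(a0, b0) \<in> V"
    and VN: "\<And>a b \<zeta>. (a, b) \<in> V \<Longrightarrow> \<zeta> \<in> N \<Longrightarrow> f (a, b, \<zeta>) = snd \<omega> c \<Longrightarrow> b = \<Phi> (a, P b)"
    and sol: "\<And>M. open M \<Longrightarrow> c0 \<in> M \<Longrightarrow> \<forall>\<^sub>F (a, b) in nhds (a0, b0).
       b = \<Phi> (a, P b) \<longrightarrow> (\<exists>\<zeta>\<in>M. (a, b, \<zeta>) \<in> G \<and> f (a, b, \<zeta>) = snd \<omega> c)"
    and Zh: "z0 \<in> interior Zh" "Zh \<subseteq> fst \<nu> \<inter> snd \<nu> -` N"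
  shows "\<forall>\<^sub>F (a, b) in nhds (a0, b0).
    (\<exists>z\<in>Zh. F (chart_inv \<kappa> a, chart_inv \<mu> b, z) = c) \<longleftrightarrow> b = \<Phi> (a, P b)"
proof -
  define M where "M = snd \<nu> ` (fst \<nu> \<inter> interior Zh)"
  have M: "open M" "c0 \<in> M"
    using chart_image_open[OF chart_\<nu>(1) open_interior] chart_\<nu>(2) Zh(1) by (auto simp: M_def)
  have "\<forall>\<^sub>F x in nhds (a0, b0). x \<in> V" by (rule eventually_nhds_in_open[OF V])
  with sol[OF M] eventually_prod_chart_inv[OF chart_\<kappa> chart_\<mu>] show ?thesis
  proof eventually_elim
    case (elim ab)
    obtain a b where ab: "ab = (a, b)" by (cases ab)
    have im: "a \<in> snd \<kappa> ` fst \<kappa>" "b \<in> snd \<mu> ` fst \<mu>" and inV: "(a, b) \<in> V"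
      and lift: "b = \<Phi> (a, P b) \<Longrightarrow> \<exists>\<zeta>\<in>M. (a, b, \<zeta>) \<in> G \<and> f (a, b, \<zeta>) = snd \<omega> c"
      using elim by (auto simp: ab)
    have f_eq: "f (a, b, snd \<nu> z) = snd \<omega> (F (chart_inv \<kappa> a, chart_inv \<mu> b, z))" if "z \<in> fst \<nu>" for z
    proof -
      have z: "snd \<nu> z \<in> snd \<nu> ` fst \<nu>" using that by simp
      have "(b, snd \<nu> z) \<in> snd (prod_chart \<mu> \<nu>) ` fst (prod_chart \<mu> \<nu>)"
        unfolding prod_chart_image using im(2) z by simp
      then have "chart_inv pc (a, b, snd \<nu> z) = (chart_inv \<kappa> a, chart_inv (prod_chart \<mu> \<nu>) (b, snd \<nu> z))"
        unfolding pc_def by (rule prod_chart_inv[OF chart_\<kappa>(1) chart_YZ(1) im(1)])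
      also have "\<dots> = (chart_inv \<kappa> a, chart_inv \<mu> b, z)"
        using prod_chart_inv[OF chart_\<mu>(1) chart_\<nu>(1) im(2) z] is_chart_inv[OF chart_\<nu>(1) that] by simp
      finally show ?thesis by (simp add: f_def)
    qed
    have "(\<exists>z\<in>Zh. F (chart_inv \<kappa> a, chart_inv \<mu> b, z) = c) \<longleftrightarrow> b = \<Phi> (a, P b)"
    proof
      assume "\<exists>z\<in>Zh. F (chart_inv \<kappa> a, chart_inv \<mu> b, z) = c"
      then obtain z where z: "z \<in> Zh" "F (chart_inv \<kappa> a, chart_inv \<mu> b, z) = c" by blast
      then have zn: "z \<in> fst \<nu>" "snd \<nu> z \<in> N" using Zh(2) by auto
      show "b = \<Phi> (a, P b)" using VN[OF inV zn(2)] f_eq[OF zn(1)] z(2) by simp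
    next
      assume "b = \<Phi> (a, P b)"
      then obtain \<zeta> where \<zeta>: "\<zeta> \<in> M" "(a, b, \<zeta>) \<in> G" "f (a, b, \<zeta>) = snd \<omega> c" using lift by blast
      then obtain z where z: "z \<in> fst \<nu>" "z \<in> interior Zh" "\<zeta> = snd \<nu> z" by (auto simp: M_def)
      \<comment> \<open>Membership in \<open>G\<close> places the value of \<open>F\<close> in the
        domain of \<open>\<omega>\<close>; there equal coordinates mean equal points, so the value
        is \<open>c\<close>.\<close>
      obtain x' y' z' where p: "(a, b, \<zeta>) = (snd \<kappa> x', snd \<mu> y', snd \<nu> z')" "x' \<in> fst \<kappa>" "y' \<in> fst \<mu>" "z' \<in> fst \<nu>"
        "F (x', y', z') \<in> fst \<omega>" using \<zeta>(2) by (rule point_of_G) blast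
      have "x' = chart_inv \<kappa> a" "y' = chart_inv \<mu> b" "z' = z"
        using p z is_chart_inv[OF chart_\<kappa>(1)] is_chart_inv[OF chart_\<mu>(1)] is_chart_inv[OF chart_\<nu>(1)] by (auto; metis)+
      then have "F (chart_inv \<kappa> a, chart_inv \<mu> b, z) \<in> fst \<omega>" using p(5) by simp
      moreover have "snd \<omega> (F (chart_inv \<kappa> a, chart_inv \<mu> b, z)) = snd \<omega> c"
        using f_eq[OF z(1)] \<zeta>(3) z(3) by simp
      ultimately have "F (chart_inv \<kappa> a, chart_inv \<mu> b, z) = c"
        using is_chart_inv[OF chart_\<omega>(1)] chart_\<omega>(2) by metis
      then show "\<exists>z\<in>Zh. F (chart_inv \<kappa> a, chart_inv \<mu> b, z) = c" using z(2) interior_subset by blast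
    qed
    then show ?case by (simp add: ab)
  qed
qed

end

lemma (in crep_charts) riemannian_crepI:
  assumes "riemannian_metric Y gY"
  shows "riemannian_crep X Y Z W F c r k x0 y0 z0 \<kappa> \<mu> \<nu> \<omega> gY"
proof (intro riemannian_crep.intro riemannian_crep_axioms.intro assms crep_charts_axioms)
  have "\<mu> \<in> Y" "snd \<mu> y0 \<in> snd \<mu> ` fst \<mu>" using \<mu> by (auto simp: charts_at_def)
  then show "inner_form (chart_form Y gY \<mu> (snd \<mu> y0))" by (rule inner_form_chart_form[OF diff_Y assms])
qed

text \<open>An equation between the set of minimisers and a singleton is used since
  \<open>arg_min\<close>, a choice operator, would be silent on existence and uniqueness.
  \<open>DH\<close> and \<open>N\<close> are quantified before \<open>Zh\<close>, which makes
  differential and condition number independent of the small neighbourhood chosen.\<close>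

theorem proposition12:
  fixes X :: "('x::{t2_space, second_countable_topology}, 'a::finite_dim_inner) chart set"
    and Y :: "('y::{t2_space, second_countable_topology}, 'b::finite_dim_inner) chart set"
    and Z :: "('z::{t2_space, second_countable_topology}, 'c::finite_dim_inner) chart set"
    and W :: "('w::{t2_space, second_countable_topology}, 'd::finite_dim_inner) chart set"
    and gX :: "('x, 'a) metric_tensor" and gY :: "('y, 'b) metric_tensor"
    and F :: "'x \<times> 'y \<times> 'z \<Rightarrow> 'w" and c :: 'w and r k :: nat
    and x0 :: 'x and y0 :: 'y and z0 :: 'z
  assumes crep: "CREP X Y Z W F c r k"
    and metric_X: "riemannian_metric X gX"
    and metric_Y: "riemannian_metric Y gY"
    and solution: "F (x0, y0, z0) = c"
  shows "(\<exists>!DH. solves_system X Y Z W gY F x0 y0 z0 DH) \<and>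
    (\<forall>DH. solves_system X Y Z W gY F x0 y0 z0 DH \<longrightarrow>
      (\<forall>\<xi>\<in>tangent_space X x0.
         {\<eta>. is_arg_min (riem_norm gY y0)
                (\<lambda>\<eta>. \<exists>u\<in>tangent_space (prod_atlas X (prod_atlas Y Z)) (x0, y0, z0).
                   differential (prod_atlas X (prod_atlas Y Z)) X (\<lambda>(x, y, z). x) (x0, y0, z0) u = \<xi> \<and>
                   differential (prod_atlas X (prod_atlas Y Z)) Y (\<lambda>(x, y, z). y) (x0, y0, z0) u = \<eta> \<and>
                   differential (prod_atlas X (prod_atlas Y Z)) W F (x0, y0, z0) u = 0) \<eta>}
         = {DH \<xi>}) \<and>
      (\<exists>N. open N \<and> z0 \<in> N \<and>
         (\<forall>Zh. z0 \<in> interior Zh \<and> Zh \<subseteq> N \<longrightarrow>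
            (\<forall>\<^sub>F x in nhds x0. is_arg_min (riem_dist Y gY y0) (\<lambda>y. \<exists>z\<in>Zh. F (x, y, z) = c)
               (canonical_solution Y gY F c y0 Zh x)) \<and>
            canonical_solution Y gY F c y0 Zh x0 = y0 \<and>
            differentiable_map_at X Y (canonical_solution Y gY F c y0 Zh) x0 \<and>
            (\<forall>\<xi>\<in>tangent_space X x0.
               differential X Y (canonical_solution Y gY F c y0 Zh) x0 \<xi> = DH \<xi>) \<and>
            condition_number X gX Y gY F c x0 y0 Zh = riem_onorm X gX x0 gY y0 DH)))"
proof -
  have DX: "diff_atlas X" and DY: "diff_atlas Y" and DZ: "diff_atlas Z" and DW: "diff_atlas W"
    using crep by (auto simp: CREP_def intro: smooth_manifold_imp_diff_atlas)
  obtain \<kappa> \<mu> \<nu> \<omega> where charts: "\<kappa> \<in> charts_at X x0" "\<mu> \<in> charts_at Y y0" "\<nu> \<in> charts_at Z z0" "\<omega> \<in> charts_at W c"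
    using charts_at_nonempty[OF DX] charts_at_nonempty[OF DY] charts_at_nonempty[OF DZ] charts_at_nonempty[OF DW]
    by metis
  interpret crep_charts X Y Z W F c r k x0 y0 z0 \<kappa> \<mu> \<nu> \<omega>
    by unfold_locales (rule crep solution charts)+
  interpret riemannian_crep X Y Z W F c r k x0 y0 z0 \<kappa> \<mu> \<nu> \<omega> gY
    by (rule riemannian_crepI[OF metric_Y])
  obtain P where P: "linear P" "\<And>b. P b \<in> K" "\<And>k. k \<in> K \<Longrightarrow> P k = k"
      "\<And>b k. k \<in> K \<Longrightarrow> B (b - P b) k = 0"
    using fm.orthogonal_projection[OF subspace_K] by blast
  have PP: "P (P b) = P b" for b using P by blast
  have PK: "P \<eta> = \<eta> \<longleftrightarrow> \<eta> \<in> K" for \<eta> using P(2)[of \<eta>] P(3)[of \<eta>] by auto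
  have PK': "P \<eta> = \<eta> \<longleftrightarrow> (\<exists>\<zeta>. f' (a0, b0, c0) (0, \<eta>, \<zeta>) = 0)" for \<eta>
    unfolding PK by (simp add: K_def D_def)
  have orth: "B (b - P b) k = 0" if "P k = k" for b k using P(4) that PK by blast
  have f0: "f (a0, b0, c0) = snd \<omega> c"
    using is_chart_inv[OF chart_pc, of "(x0, y0, z0)"] chart_\<kappa> chart_\<mu> chart_\<nu> solution
    by (simp add: f_def pc_p0[symmetric]) (simp add: pc_def)
  obtain N V J \<Phi> \<Phi>' where N: "open N" "c0 \<in> N" and V: "open V" "(a0, b0) \<in> V" and J: "open J" "(a0, P b0) \<in> J"
    and VN: "\<And>a b \<zeta>. (a, b) \<in> V \<Longrightarrow> \<zeta> \<in> N \<Longrightarrow> f (a, b, \<zeta>) = snd \<omega> c \<Longrightarrow> b = \<Phi> (a, P b)"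
    and sol: "\<And>M. open M \<Longrightarrow> c0 \<in> M \<Longrightarrow> \<forall>\<^sub>F (a, b) in nhds (a0, b0).
       b = \<Phi> (a, P b) \<longrightarrow> (\<exists>\<zeta>\<in>M. (a, b, \<zeta>) \<in> G \<and> f (a, b, \<zeta>) = snd \<omega> c)"
    and \<Phi>J: "\<And>a k. (a, k) \<in> J \<Longrightarrow> P k = k \<Longrightarrow> isCont \<Phi> (a, k) \<and> P (\<Phi> (a, k)) = k"
    and \<Phi>0: "\<Phi> (a0, P b0) = b0"
    and d\<Phi>: "(\<Phi> has_derivative \<Phi>') (at (a0, P b0))"
    and \<Phi>': "\<And>a k. P k = k \<Longrightarrow> P (\<Phi>' (a, k)) = k \<and> (\<exists>\<zeta>. f' (a0, b0, c0) (a, \<Phi>' (a, k), \<zeta>) = 0)"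
  proof (rule constant_rank_elimination[where f = f and f' = f' and c = "snd \<omega> c" and P = P,
      OF open_G p0_in_G f_derivative f'_cont ranks(1) ranks(2)[OF p0_in_G] ranks(3) P(1) PP PK' f0])
  qed (assumption+, rule that, assumption+)
  define L where "L a = \<Phi>' (a, 0)" for a
  have P0: "P 0 = 0" by (rule linear_0[OF P(1)])
  have "linear (\<lambda>a. (a, 0) :: 'a \<times> 'b)" by (rule linearI) auto
  from linear_compose[OF this has_derivative_linear[OF d\<Phi>]]
  have linL: "linear L" by (simp add: o_def L_def[abs_def])
  have PL: "P (L a) = 0" for a using \<Phi>'[OF P0] by (simp add: L_def)
  have DL: "\<exists>\<zeta>. D (a, L a, \<zeta>) = 0" for a using \<Phi>'[OF P0] by (simp add: L_def D_def)
  have BL: "B (L a) k = 0" if "k \<in> K" for a k using P(4)[OF that, of "L a"] by (simp add: PL)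
  \<comment> \<open>\<open>\<Phi>' (0, k)\<close> belongs to \<open>K\<close> by feasibility with
    input direction 0, and \<open>P\<close> is the identity there.\<close>
  have \<Phi>'K: "\<Phi>' (0, k) = k" if "P k = k" for k
  proof -
    have "\<Phi>' (0, k) \<in> K" using \<Phi>'[OF that, of 0] by (simp add: K_def D_def)
    then show ?thesis using \<Phi>'[OF that, of 0] P(3) by simp
  qed
  define H' where "H' = (\<lambda>\<xi>\<in>tangent_space X x0. coord_vector Y y0 \<mu> (L (\<xi> \<kappa>)))"
  have sys: "solves_system X Y Z W gY F x0 y0 z0 DH \<longleftrightarrow> DH = H'" for DH
    unfolding H'_def by (rule solves_system_iff[OF linL DL BL])
  define Nz where "Nz = fst \<nu> \<inter> snd \<nu> -` N"
  have Nz: "open Nz" "z0 \<in> Nz"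
    using continuous_open_preimage[OF is_chart_cont[OF chart_\<nu>(1)] is_chart_open(1)[OF chart_\<nu>(1)] N(1)] chart_\<nu>(2) N(2)
    by (auto simp: Nz_def)
  have "\<kappa> \<in> X" "a0 \<in> snd \<kappa> ` fst \<kappa>" using charts by (auto simp: charts_at_def)
  then interpret fX: inner_form "chart_form X gX \<kappa> a0"
    by (rule inner_form_chart_form[OF DX metric_X])
  have onorm: "riem_onorm X gX x0 gY y0 H' = (SUP a. ennreal (fm.n (L a) / fX.n a))"
  proof -
    have "riem_norm gX x0 (coord_vector X x0 \<kappa> a) = fX.n a" for a
      by (simp add: riem_norm_def fX.n_def chart_form_at[OF chart_\<kappa>])
    moreover have "riem_norm gY y0 (H' (coord_vector X x0 \<kappa> a)) = fm.n (L a)" for a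
      using coord_vector_in_tangent_space[OF DX \<kappa>] coord_vector_in_tangent_space[OF DY \<mu>]
      by (simp add: H'_def coord_vector_same[OF DX \<kappa>] riem_norm_coord coord_vector_same[OF DY \<mu>])
    ultimately show ?thesis
      unfolding riem_onorm_def tangent_space_eq_range[OF DX \<kappa>] by (simp add: image_image)
  qed
  have main: "(\<forall>\<^sub>F x in nhds x0. is_arg_min (riem_dist Y gY y0) (\<lambda>y. \<exists>z\<in>Zh. F (x, y, z) = c)
               (canonical_solution Y gY F c y0 Zh x)) \<and>
            canonical_solution Y gY F c y0 Zh x0 = y0 \<and>
            differentiable_map_at X Y (canonical_solution Y gY F c y0 Zh) x0 \<and>
            (\<forall>\<xi>\<in>tangent_space X x0.
               differential X Y (canonical_solution Y gY F c y0 Zh) x0 \<xi> = H' \<xi>) \<and>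
            condition_number X gX Y gY F c x0 y0 Zh = riem_onorm X gX x0 gY y0 H'"
    if Zh: "z0 \<in> interior Zh" "Zh \<subseteq> Nz" for Zh
  proof -
    define C where "C = canonical_solution Y gY F c y0 Zh"
    have C_eq: "C = (\<lambda>x. arg_min (riem_dist Y gY y0) (\<lambda>y. \<exists>z\<in>Zh. F (x, y, z) = c))"
      by (simp add: C_def canonical_solution_def fun_eq_iff)
    note graph = solution_set_graph[OF V VN sol Zh(1) Zh(2)[unfolded Nz_def]]
    note mc = minimiser_coordinates[where Sol = "\<lambda>x y. \<exists>z\<in>Zh. F (x, y, z) = c", OF manifolds(1) \<kappa> manifolds(2)
        metric_Y \<mu> P(1) PP orth J \<Phi>J \<Phi>0 d\<Phi> \<Phi>'K PL[unfolded L_def] graph]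
    have C0: "C x0 = y0" unfolding C_eq by (rule mc(2))
    have Ccont: "isCont C x0" unfolding C_eq by (rule mc(3))
    have Cmin: "\<forall>\<^sub>F x in nhds x0. is_arg_min (riem_dist Y gY y0) (\<lambda>y. \<exists>z\<in>Zh. F (x, y, z) = c) (C x)"
      unfolding C_eq by (rule mc(1))
    have \<mu>C: "\<mu> \<in> charts_at Y (C x0)" using \<mu> C0 by simp
    have dC: "(snd \<mu> \<circ> C \<circ> chart_inv \<kappa> has_derivative L) (at a0)"
      unfolding C_eq L_def by (rule mc(4))
    note dco = differential_coord[OF DX DY Ccont \<kappa> \<mu>C dC]
    have "condition_number X gX Y gY F c x0 y0 Zh = riem_onorm X gX x0 gY y0 H'"
      unfolding condition_number_def onorm C_def[symmetric]
      by (rule Limsup_riem_dist_quotient[OF manifolds(1) metric_X \<kappa> manifolds(2) metric_Y \<mu> C0 Ccont dC])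
    moreover have "\<forall>\<xi>\<in>tangent_space X x0. differential X Y C x0 \<xi> = H' \<xi>"
      using dco(2) C0 by (simp add: H'_def)
    ultimately show ?thesis using Cmin C0 dco(1) by (simp add: C_def[symmetric])
  qed
  show ?thesis
  proof (intro conjI allI impI)
    show "\<exists>!DH. solves_system X Y Z W gY F x0 y0 z0 DH" unfolding sys by blast
    fix DH assume "solves_system X Y Z W gY F x0 y0 z0 DH"
    then have DH: "DH = H'" by (simp add: sys)
    show "\<forall>\<xi>\<in>tangent_space X x0.
         {\<eta>. is_arg_min (riem_norm gY y0)
                (\<lambda>\<eta>. \<exists>u\<in>tangent_space XYZ (x0, y0, z0).
                   differential XYZ X (\<lambda>(x, y, z). x) (x0, y0, z0) u = \<xi> \<and>
                   differential XYZ Y (\<lambda>(x, y, z). y) (x0, y0, z0) u = \<eta> \<and>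
                   differential XYZ W F (x0, y0, z0) u = 0) \<eta>}
         = {DH \<xi>}"
      unfolding feasible_iff using arg_min_feasible[OF DL BL] by (simp add: DH H'_def)
    show "\<exists>N. open N \<and> z0 \<in> N \<and>
         (\<forall>Zh. z0 \<in> interior Zh \<and> Zh \<subseteq> N \<longrightarrow>
            (\<forall>\<^sub>F x in nhds x0. is_arg_min (riem_dist Y gY y0) (\<lambda>y. \<exists>z\<in>Zh. F (x, y, z) = c)
               (canonical_solution Y gY F c y0 Zh x)) \<and>
            canonical_solution Y gY F c y0 Zh x0 = y0 \<and>
            differentiable_map_at X Y (canonical_solution Y gY F c y0 Zh) x0 \<and>
            (\<forall>\<xi>\<in>tangent_space X x0.
               differential X Y (canonical_solution Y gY F c y0 Zh) x0 \<xi> = DH \<xi>) \<and>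
            condition_number X gX Y gY F c x0 y0 Zh = riem_onorm X gX x0 gY y0 DH)"
      unfolding DH using Nz main by blast
  qed
qed

end
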